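(* Let $n\ge 1$ and let $\Gamma<\mathrm{PSL}_2\mathbb{R}$ be a discrete finitely generated free group such that $S=\Gamma\backslash\mathbb{H}^2$ is a noncompact convex cocompact hyperbolic surface. Then $\sigma_{4n-1}(\Gamma)<\mathrm{SO}(2n,2n-1)$ admits an open cone of cocycles determining proper affine actions on $\mathbb{R}^{2n,2n-1}$; that is, the real vector space of $\sigma_{4n-1}(\Gamma)$-cocycles $u\colon\Gamma\to\mathbb{R}^{2n,2n-1}$ contains a nonempty open cone, every element $u$ of which determines a properly discontinuous affine action of $\Gamma$ on $\mathbb{R}^{2n,2n-1}$.
   Context: $\sigma_{4n-1}\colon\mathrm{PSL}_2\mathbb{R}\to\mathrm{SO}(2n,2n-1)<\mathrm{GL}_{4n-1}\mathbb{R}$ is the irreducible representation, i.e. the action of $\mathrm{SL}_2\mathbb{R}$ on $\mathrm{Sym}^{4n-2}(\mathbb{R}^2)\cong\mathbb{R}^{4n-1}$ (which factors through $\mathrm{PSL}_2\mathbb{R}$ and preserves a symmetric bilinear form of signature $(2n,2n-1)$). $\mathbb{R}^{2n,2n-1}$ denotes $\mathbb{R}^{4n-1}$ with this form. A cocycle for $\sigma_{4n-1}(\Gamma)$ is a map $u\colon\Gamma\to\mathbb{R}^{2n,2n-1}$ with $u(\gamma_1\gamma_2)=\sigma_{4n-1}(\gamma_1)u(\gamma_2)+u(\gamma_1)$ for all $\gamma_1,\gamma_2\in\Gamma$. It determines the affine action $\gamma\cdot x=\sigma_{4n-1}(\gamma)x+u(\gamma)$ of $\Gamma$ on $\mathbb{R}^{2n,2n-1}$.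 The action is called proper if it is properly discontinuous. The cocycles form a finite-dimensional real vector space with its usual topology; a cone is a subset closed under multiplication by positive scalars. The convex core of $S=\Gamma\backslash\mathbb{H}^2$ is $\mathrm{Core}(S)=\Gamma\backslash C(\Lambda_\Gamma)$, where $C(\Lambda_\Gamma)\subset\mathbb{H}^2$ is the convex hull of the limit set $\Lambda_\Gamma\subset\partial\mathbb{H}^2$. $S$ (and $\Gamma$) is convex cocompact if $\mathrm{Core}(S)$ is compact. *)

theory Defs
  imports "HOL-Analysis.Analysis" "HOL-Algebra.Group_Action" "HOL-Algebra.Generated_Groups"
begin

section \<open>Quotient topologies\<close>

definition quotient_topology :: "'a topology \<Rightarrow> ('a \<Rightarrow> 'b) \<Rightarrow> 'b topology" where
  "quotient_topology X p =
     topology (\<lambda>U. U \<subseteq> p ` topspace X \<and> openin X {x \<in> topspace X. p x \<in> U})"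

lemma openin_quotient_topology:
  "openin (quotient_topology X p) U \<longleftrightarrow>
     U \<subseteq> p ` topspace X \<and> openin X {x \<in> topspace X. p x \<in> U}"
proof -
  have "istopology (\<lambda>U. U \<subseteq> p ` topspace X \<and> openin X {x \<in> topspace X. p x \<in> U})"
  proof -
    have 1: "openin X {x \<in> topspace X. p x \<in> S \<inter> T}"
      if "openin X {x \<in> topspace X. p x \<in> S}" "openin X {x \<in> topspace X. p x \<in> T}" for S T
    proof -
      have "{x \<in> topspace X. p x \<in> S \<inter> T} =
          {x \<in> topspace X. p x \<in> S} \<inter> {x \<in> topspace X. p x \<in> T}" by auto
      then show ?thesis using that by auto
    qed
    have 2: "openin X {x \<in> topspace X. p x \<in> \<Union>\<K>}"
      if "\<And>K. K \<in> \<K> \<Longrightarrow> openin X {x \<in> topspace X. p x \<in> K}" for \<K>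
    proof -
      have "{x \<in> topspace X. p x \<in> \<Union>\<K>} = (\<Union>K\<in>\<K>. {x \<in> topspace X. p x \<in> K})" by auto
      then show ?thesis using that by auto
    qed
    show ?thesis
      unfolding istopology_def using 1 2 by blast
  qed
  then show ?thesis
    by (simp add: quotient_topology_def)
qed

lemma topspace_quotient_topology: "topspace (quotient_topology X p) = p ` topspace X"
proof
  show "topspace (quotient_topology X p) \<subseteq> p ` topspace X"
    unfolding topspace_def openin_quotient_topology by auto
  have "{x \<in> topspace X. p x \<in> p ` topspace X} = topspace X" by auto
  then have "openin (quotient_topology X p) (p ` topspace X)"
    by (simp add: openin_quotient_topology)
  then show "p ` topspace X \<subseteq> topspace (quotient_topology X p)"
    by (rule openin_subset)
qed

lemma quotient_map_quotient_topology: "quotient_map X (quotient_topology X p) p"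
  by (auto simp: quotient_map_def topspace_quotient_topology openin_quotient_topology)


section \<open>Finitely generated and free groups\<close>

definition finitely_generated_group :: "('a, 'b) monoid_scheme \<Rightarrow> bool" where
  "finitely_generated_group G \<longleftrightarrow>
     (\<exists>X. finite X \<and> X \<subseteq> carrier G \<and> generate G X = carrier G)"

text \<open>A word is a list of letters; the letter \<open>(x, True)\<close> stands for \<open>x\<close> and \<open>(x, False)\<close>
  for its inverse.\<close>

definition word_value :: "('a, 'b) monoid_scheme \<Rightarrow> ('a \<times> bool) list \<Rightarrow> 'a" where
  "word_value G w =
     foldr (\<lambda>(x, b) y. (if b then x else inv\<^bsub>G\<^esub> x) \<otimes>\<^bsub>G\<^esub> y) w \<one>\<^bsub>G\<^esub>"

definition reduced_word :: "('a \<times> bool) list \<Rightarrow> bool" where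
  "reduced_word w \<longleftrightarrow>
     successively (\<lambda>l l'. \<not> (fst l = fst l' \<and> snd l \<noteq> snd l')) w"

definition free_basis :: "('a, 'b) monoid_scheme \<Rightarrow> 'a set \<Rightarrow> bool" where
  "free_basis G X \<longleftrightarrow> X \<subseteq> carrier G \<and> generate G X = carrier G \<and>
     (\<forall>w. fst ` set w \<subseteq> X \<and> reduced_word w \<and> w \<noteq> [] \<longrightarrow> word_value G w \<noteq> \<one>\<^bsub>G\<^esub>)"

definition free_group :: "('a, 'b) monoid_scheme \<Rightarrow> bool" where
  "free_group G \<longleftrightarrow> group G \<and> (\<exists>X. free_basis G X)"


section \<open>The topological group PSL(2,R)\<close>

definition SL2 :: "(real^2^2) monoid" where
  "SL2 = \<lparr>carrier = {A. det A = 1}, mult = (**), one = mat 1\<rparr>"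

definition PSL2 :: "(real^2^2) set monoid" where
  "PSL2 = SL2 Mod {mat 1, - mat 1}"

definition PSL2_topology :: "(real^2^2) set topology" where
  "PSL2_topology =
     quotient_topology (top_of_set (carrier SL2)) (\<lambda>A. {mat 1, - mat 1} #>\<^bsub>SL2\<^esub> A)"

definition discrete_in_PSL2 :: "(real^2^2) set set \<Rightarrow> bool" where
  "discrete_in_PSL2 \<Gamma> \<longleftrightarrow> subtopology PSL2_topology \<Gamma> = discrete_topology \<Gamma>"

abbreviation PSL2_restrict :: "(real^2^2) set set \<Rightarrow> (real^2^2) set monoid" where
  "PSL2_restrict \<Gamma> \<equiv> PSL2\<lparr>carrier := \<Gamma>\<rparr>"

text \<open>An element of PSL(2,R) is a coset \<open>{A, - A}\<close>. Everything below that is defined through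
  the chosen representative is independent of the choice.\<close>

definition PSL2_rep :: "(real^2^2) set \<Rightarrow> real^2^2" where
  "PSL2_rep g = (SOME A. A \<in> g)"

lemma mat_neg_mult:
  fixes A :: "real^2^2"
  shows "(- mat 1) ** A = - A" "A ** (- mat 1) = - A"
  by (simp_all add: vec_eq_iff matrix_matrix_mult_def mat_def sum_2 forall_2)

lemma det_neg_2: "det (- A) = det (A :: real^2^2)"
  by (simp add: det_2)

lemma group_SL2: "group SL2"
proof (rule groupI)
  fix A assume "A \<in> carrier SL2"
  then have d: "det A = 1" by (simp add: SL2_def)
  then obtain B where B: "A ** B = mat 1" "B ** A = mat 1"
    using invertible_det_nz[of A] by (auto simp: invertible_def)
  then have "det B = 1" using d det_mul[of A B] by simp
  then show "\<exists>B\<in>carrier SL2. B \<otimes>\<^bsub>SL2\<^esub> A = \<one>\<^bsub>SL2\<^esub>"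
    using B by (auto simp: SL2_def)
qed (auto simp: SL2_def det_mul matrix_mul_assoc)

lemma normal_SL2: "{mat 1, - mat 1} \<lhd> SL2"
proof -
  interpret group SL2 by (rule group_SL2)
  have "subgroup {mat 1, - mat 1} SL2"
  proof (rule subgroupI)
    show "{mat 1, - mat 1} \<subseteq> carrier SL2"
      by (auto simp: SL2_def det_neg_2)
    fix A assume A: "A \<in> {mat 1 :: real^2^2, - mat 1}"
    have "A \<in> carrier SL2" using A by (auto simp: SL2_def det_neg_2)
    moreover have "A \<otimes>\<^bsub>SL2\<^esub> A = \<one>\<^bsub>SL2\<^esub>" using A by (auto simp: SL2_def mat_neg_mult)
    ultimately have "inv\<^bsub>SL2\<^esub> A = A" by (simp add: inv_equality)
    then show "inv\<^bsub>SL2\<^esub> A \<in> {mat 1, - mat 1}" using A by simp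
    fix B assume B: "B \<in> {mat 1 :: real^2^2, - mat 1}"
    show "A \<otimes>\<^bsub>SL2\<^esub> B \<in> {mat 1, - mat 1}"
      using A B by (auto simp: SL2_def mat_neg_mult)
  qed auto
  moreover have "{mat 1, - mat 1} #>\<^bsub>SL2\<^esub> A = A <#\<^bsub>SL2\<^esub> {mat 1, - mat 1}" for A
    by (simp add: r_coset_def l_coset_def SL2_def mat_neg_mult)
  ultimately show ?thesis
    by (simp add: normal_def normal_axioms_def is_group)
qed

lemma group_PSL2: "group PSL2"
  unfolding PSL2_def using normal_SL2 by (rule normal.factorgroup_is_group)

lemma coset_SL2: "{mat 1, - mat 1} #>\<^bsub>SL2\<^esub> A = {A, - A}"
  by (auto simp: r_coset_def SL2_def mat_neg_mult)

lemma carrier_PSL2: "carrier PSL2 = (\<lambda>A. {A, - A}) ` {A. det A = 1}"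
  unfolding PSL2_def FactGroup_def RCOSETS_def by (auto simp: coset_SL2) (auto simp: SL2_def)

lemma PSL2_rep_cases:
  assumes "g \<in> carrier PSL2" "A \<in> g"
  shows "det A = 1" "PSL2_rep g = A \<or> PSL2_rep g = - A"
proof -
  have "PSL2_rep g \<in> g" unfolding PSL2_rep_def using assms(2) by (rule someI)
  then show "det A = 1" "PSL2_rep g = A \<or> PSL2_rep g = - A"
    using assms by (auto simp: carrier_PSL2 det_neg_2)
qed


section \<open>The hyperbolic plane and its ideal boundary\<close>

definition H2 :: "complex set" where
  "H2 = {z. Im z > 0}"

definition hyp_dist :: "complex \<Rightarrow> complex \<Rightarrow> real" where
  "hyp_dist z w = arcosh (1 + (cmod (z - w))\<^sup>2 / (2 * Im z * Im w))"

definition PSL2_moebius :: "(real^2^2) set \<Rightarrow> complex \<Rightarrow> complex" where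
  "PSL2_moebius g = (let A = PSL2_rep g in
     moebius (of_real (A$1$1)) (of_real (A$1$2)) (of_real (A$2$1)) (of_real (A$2$2)))"

lemma PSL2_moebius_eq:
  assumes "g \<in> carrier PSL2" "A \<in> g"
  shows "PSL2_moebius g z =
    moebius (of_real (A$1$1)) (of_real (A$1$2)) (of_real (A$2$1)) (of_real (A$2$2)) z"
proof -
  have "(- a * z + - b) / (- c * z + - d) = (a * z + b) / (c * z + d)" for a b c d :: complex
  proof -
    have "- a * z + - b = - (a * z + b)" "- c * z + - d = - (c * z + d)" by simp_all
    then show ?thesis by (metis minus_divide_divide)
  qed
  then show ?thesis
    using PSL2_rep_cases(2)[OF assms] by (auto simp: PSL2_moebius_def moebius_def Let_def)
qed

definition H2_orbit :: "(real^2^2) set set \<Rightarrow> complex \<Rightarrow> complex set" where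
  "H2_orbit \<Gamma> z = orbit (PSL2_restrict \<Gamma>) PSL2_moebius z"

definition quotient_surface :: "(real^2^2) set set \<Rightarrow> complex set topology" where
  "quotient_surface \<Gamma> = quotient_topology (top_of_set H2) (H2_orbit \<Gamma>)"

text \<open>The hyperbolic plane is compactified inside the Riemann sphere, whose point at infinity is
  \<open>None\<close>; the ideal boundary is the real line together with infinity.\<close>

definition riemann_sphere :: "complex option topology" where
  "riemann_sphere = Alexandroff_compactification (euclidean :: complex topology)"

definition ideal_boundary :: "complex option set" where
  "ideal_boundary = insert None (Some ` {z. Im z = 0})"

definition limit_set :: "(real^2^2) set set \<Rightarrow> complex option set" where
  "limit_set \<Gamma> =
     {\<xi> \<in> ideal_boundary. \<exists>z\<in>H2. \<xi> \<in> riemann_sphere derived_set_of (Some ` H2_orbit \<Gamma> z)}"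

definition geodesically_convex :: "complex set \<Rightarrow> bool" where
  "geodesically_convex C \<longleftrightarrow> C \<subseteq> H2 \<and>
     (\<forall>z\<in>C. \<forall>w\<in>C. \<forall>v\<in>H2. hyp_dist z v + hyp_dist v w = hyp_dist z w \<longrightarrow> v \<in> C)"

definition geodesic_line :: "(real \<Rightarrow> complex) \<Rightarrow> complex option \<Rightarrow> complex option \<Rightarrow> bool" where
  "geodesic_line c \<xi> \<eta> \<longleftrightarrow> range c \<subseteq> H2 \<and> (\<forall>s t. hyp_dist (c s) (c t) = \<bar>s - t\<bar>) \<and>
     limitin riemann_sphere (\<lambda>t. Some (c t)) \<xi> at_bot \<and>
     limitin riemann_sphere (\<lambda>t. Some (c t)) \<eta> at_top"

text \<open>The part in the hyperbolic plane of the convex hull of a set of ideal points: the smallest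
  convex set containing every geodesic line with both endpoints in the given set. It is empty if
  there are fewer than two ideal points.\<close>

definition hyp_convex_hull :: "complex option set \<Rightarrow> complex set" where
  "hyp_convex_hull \<Lambda> = \<Inter>{C. geodesically_convex C \<and>
     (\<forall>c. \<forall>\<xi>\<in>\<Lambda>. \<forall>\<eta>\<in>\<Lambda>. geodesic_line c \<xi> \<eta> \<longrightarrow> range c \<subseteq> C)}"

definition convex_core :: "(real^2^2) set set \<Rightarrow> complex set set" where
  "convex_core \<Gamma> = H2_orbit \<Gamma> ` hyp_convex_hull (limit_set \<Gamma>)"

definition convex_cocompact :: "(real^2^2) set set \<Rightarrow> bool" where
  "convex_cocompact \<Gamma> \<longleftrightarrow> compactin (quotient_surface \<Gamma>) (convex_core \<Gamma>)"


section \<open>The irreducible representations\<close>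

text \<open>The vector \<open>x\<close> stands for the element \<open>\<Sum>k\<le>m. x k \<cdot> e\<^sub>1\<^sup>m\<^sup>-\<^sup>k e\<^sub>2\<^sup>k\<close> of the \<open>m\<close>-th symmetric
  power of the plane. Since \<open>A e\<^sub>1 = A\<^sub>1\<^sub>1 e\<^sub>1 + A\<^sub>2\<^sub>1 e\<^sub>2\<close> and \<open>A e\<^sub>2 = A\<^sub>1\<^sub>2 e\<^sub>1 + A\<^sub>2\<^sub>2 e\<^sub>2\<close>, the image
  of the \<open>k\<close>-th basis vector is \<open>(A\<^sub>1\<^sub>1 e\<^sub>1 + A\<^sub>2\<^sub>1 e\<^sub>2)\<^sup>m\<^sup>-\<^sup>k (A\<^sub>1\<^sub>2 e\<^sub>1 + A\<^sub>2\<^sub>2 e\<^sub>2)\<^sup>k\<close>; it is expanded by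
  putting \<open>e\<^sub>1 = 1\<close> and letting \<open>e\<^sub>2\<close> be the polynomial variable.\<close>

definition sym_power :: "nat \<Rightarrow> real^2^2 \<Rightarrow> (nat \<Rightarrow> real) \<Rightarrow> (nat \<Rightarrow> real)" where
  "sym_power m A x = (\<lambda>j. \<Sum>k\<le>m.
     poly.coeff ([:A$1$1, A$2$1:] ^ (m - k) * [:A$1$2, A$2$2:] ^ k) j * x k)"

definition sigma :: "nat \<Rightarrow> (real^2^2) set \<Rightarrow> (nat \<Rightarrow> real) \<Rightarrow> (nat \<Rightarrow> real)" where
  "sigma n g = sym_power (4 * n - 2) (PSL2_rep g)"

text \<open>The invariant form. It pairs the \<open>k\<close>-th and the \<open>(4n-2-k)\<close>-th coordinate, which gives
  \<open>2n-1\<close> hyperbolic planes, and it is positive on the middle basis vector, \<open>k = 2n-1\<close>; the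
  signature is therefore \<open>(2n, 2n-1)\<close>.\<close>

definition sigma_form :: "nat \<Rightarrow> (nat \<Rightarrow> real) \<Rightarrow> (nat \<Rightarrow> real) \<Rightarrow> real" where
  "sigma_form n x y = (let m = 4 * n - 2 in
     \<Sum>k\<le>m. (-1) ^ (k + 1) / real (m choose k) * x k * y (m - k))"

text \<open>The underlying topological vector space, with the coordinates of \<open>x\<close> being
  \<open>x 0, \<dots>, x (4n-2)\<close>.\<close>

abbreviation R_sig :: "nat \<Rightarrow> (nat \<Rightarrow> real) topology" where
  "R_sig n \<equiv> Euclidean_space (4 * n - 1)"

definition sym_eval :: "nat \<Rightarrow> (nat \<Rightarrow> real) \<Rightarrow> real \<Rightarrow> real \<Rightarrow> real" where
  "sym_eval m x s t = (\<Sum>k\<le>m. x k * s ^ (m - k) * t ^ k)"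

lemma degree_sym_power_poly:
  fixes a b c d :: real
  assumes "k \<le> m"
  shows "degree ([:a, b:] ^ (m - k) * [:c, d:] ^ k) \<le> m"
proof -
  have "degree ([:a, b:] ^ (m - k) * [:c, d:] ^ k)
      \<le> degree ([:a, b:] ^ (m - k)) + degree ([:c, d:] ^ k)"
    by (rule degree_mult_le)
  also have "\<dots> \<le> degree [:a, b:] * (m - k) + degree [:c, d:] * k"
    by (intro add_mono degree_power_le)
  also have "\<dots> \<le> 1 * (m - k) + 1 * k"
    by (intro add_mono mult_right_mono) auto
  finally show ?thesis using assms by simp
qed

lemma sym_power_zero:
  assumes "j > m"
  shows "sym_power m A x j = 0"
  unfolding sym_power_def
  by (intro sum.neutral ballI)
    (use assms degree_sym_power_poly in \<open>fastforce intro: coeff_eq_0 le_less_trans\<close>)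

lemma sum_coeff_homogeneous:
  fixes a b c d s t :: real
  assumes "k \<le> m"
  shows "(\<Sum>j\<le>m. poly.coeff ([:a, c:] ^ (m - k) * [:b, d:] ^ k) j * s ^ (m - j) * t ^ j)
    = (a * s + c * t) ^ (m - k) * (b * s + d * t) ^ k" (is "?f s = ?g s")
proof -
  let ?p = "[:a, c:] ^ (m - k) * [:b, d:] ^ k"
  have ne: "?f s = ?g s" if "s \<noteq> 0" for s
  proof -
    have "?f s = (\<Sum>j\<le>m. s ^ m * (poly.coeff ?p j * (t / s) ^ j))"
      using that by (intro sum.cong refl) (simp add: power_diff power_divide)
    also have "\<dots> = s ^ m * (\<Sum>j\<le>m. poly.coeff ?p j * (t / s) ^ j)"
      by (simp only: sum_distrib_left)
    also have "(\<Sum>j\<le>m. poly.coeff ?p j * (t / s) ^ j) = poly ?p (t / s)"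
      unfolding poly_altdef using degree_sym_power_poly[OF assms, of a c b d]
      by (intro sum.mono_neutral_right) (auto simp: coeff_eq_0)
    also have "s ^ m = s ^ (m - k) * s ^ k"
      using assms by (simp flip: power_add)
    also have "s ^ (m - k) * s ^ k * poly ?p (t / s)
        = (s * (a + t / s * c)) ^ (m - k) * (s * (b + t / s * d)) ^ k"
      by (simp add: power_mult_distrib mult_ac)
    also have "s * (a + t / s * c) = a * s + c * t" using that by (simp add: field_simps)
    also have "s * (b + t / s * d) = b * s + d * t" using that by (simp add: field_simps)
    finally show ?thesis .
  qed
  have "isCont ?f 0" "isCont ?g 0" by (intro continuous_intros)+
  then have "?f \<midarrow>0\<rightarrow> ?f 0" "?g \<midarrow>0\<rightarrow> ?g 0" by (simp_all only: isCont_def)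
  moreover have "(?f \<longlongrightarrow> L) (at 0) \<longleftrightarrow> (?g \<longlongrightarrow> L) (at 0)" for L
    by (intro tendsto_cong eventually_at_topological[THEN iffD2] exI[of _ UNIV]) (use ne in auto)
  ultimately have "?f 0 = ?g 0" by (meson LIM_unique)
  then show ?thesis using ne by (cases "s = 0") auto
qed

lemma sym_eval_sym_power:
  "sym_eval m (sym_power m A x) s t
    = sym_eval m x (A$1$1 * s + A$2$1 * t) (A$1$2 * s + A$2$2 * t)"
proof -
  have "sym_eval m (sym_power m A x) s t = (\<Sum>j\<le>m. \<Sum>k\<le>m. x k *
      (poly.coeff ([:A$1$1, A$2$1:] ^ (m - k) * [:A$1$2, A$2$2:] ^ k) j * s ^ (m - j) * t ^ j))"
    by (simp add: sym_eval_def sym_power_def sum_distrib_left sum_distrib_right mult_ac)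
  also have "\<dots> = (\<Sum>k\<le>m. x k * (\<Sum>j\<le>m.
      poly.coeff ([:A$1$1, A$2$1:] ^ (m - k) * [:A$1$2, A$2$2:] ^ k) j * s ^ (m - j) * t ^ j))"
    by (subst sum.swap) (simp only: sum_distrib_left)
  also have "\<dots> = sym_eval m x (A$1$1 * s + A$2$1 * t) (A$1$2 * s + A$2$2 * t)"
    unfolding sym_eval_def
    by (intro sum.cong refl) (subst sum_coeff_homogeneous, auto)
  finally show ?thesis .
qed

lemma sym_eval_inject:
  assumes "\<And>t. sym_eval m x 1 t = sym_eval m y 1 t" "k \<le> m"
  shows "x k = y k"
proof -
  have "(\<Sum>k\<le>m. x k * t ^ k) = (\<Sum>k\<le>m. y k * t ^ k)" for t
    using assms(1)[of t] by (simp add: sym_eval_def)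
  then show ?thesis
    using polyfun_eq_coeffs[of x m y] assms(2) by blast
qed

lemma sym_power_eqI:
  assumes "\<And>t. sym_eval m (sym_power m A x) 1 t = sym_eval m y 1 t"
    and "\<And>j. j > m \<Longrightarrow> y j = 0"
  shows "sym_power m A x = y"
proof
  fix j show "sym_power m A x j = y j"
    using assms sym_eval_inject[of m "sym_power m A x" y j] sym_power_zero[of m j A x]
    by (cases "j \<le> m") auto
qed

lemma sym_power_mult: "sym_power m (A ** B) x = sym_power m A (sym_power m B x)"
  by (rule sym_power_eqI)
    (simp_all add: sym_eval_sym_power sym_power_zero matrix_matrix_mult_def sum_2 algebra_simps)

lemma sym_power_one:
  assumes "\<And>j. j > m \<Longrightarrow> x j = 0"
  shows "sym_power m (mat 1) x = x"
  by (rule sym_power_eqI) (simp_all add: assms sym_eval_sym_power mat_def)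

lemma sym_power_uminus:
  assumes "even m"
  shows "sym_power m (- A) x = sym_power m A x"
proof (rule sym_power_eqI)
  fix t
  have "sym_eval m x (- s) (- t) = sym_eval m x s t" for s t
    unfolding sym_eval_def
  proof (intro sum.cong refl)
    fix k assume "k \<in> {..m}"
    then have "(-1) ^ (m - k) * (-1) ^ k = (1 :: real)"
      using assms by (simp flip: power_add)
    then show "x k * (- s) ^ (m - k) * (- t) ^ k = x k * s ^ (m - k) * t ^ k"
      by (simp add: power_minus[of s] power_minus[of t])
  qed
  from this[of "A$1$1 + A$2$1 * t" "A$1$2 + A$2$2 * t"]
  show "sym_eval m (sym_power m (- A) x) 1 t = sym_eval m (sym_power m A x) 1 t"
    by (simp add: sym_eval_sym_power)
qed (simp add: sym_power_zero)

lemma sigma_eq: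
  assumes "n \<ge> 1" "g \<in> carrier PSL2" "A \<in> g"
  shows "sigma n g = sym_power (4 * n - 2) A"
proof -
  have "even (4 * n - 2)" using assms(1) by auto
  then show ?thesis
    using PSL2_rep_cases(2)[OF assms(2,3)] sym_power_uminus by (auto simp: sigma_def)
qed

lemma sigma_in_R_sig:
  assumes "n \<ge> 1"
  shows "sigma n g x \<in> topspace (R_sig n)"
  using assms by (auto simp: sigma_def topspace_Euclidean_space intro!: sym_power_zero)

lemma sigma_mult:
  assumes "n \<ge> 1" "g \<in> carrier PSL2" "h \<in> carrier PSL2"
  shows "sigma n (g \<otimes>\<^bsub>PSL2\<^esub> h) x = sigma n g (sigma n h x)"
proof -
  obtain A B where A: "A \<in> g" and B: "B \<in> h"
    using assms by (auto simp: carrier_PSL2)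
  then have "A ** B \<in> g \<otimes>\<^bsub>PSL2\<^esub> h"
    by (force simp: PSL2_def FactGroup_def set_mult_def SL2_def)
  moreover have "g \<otimes>\<^bsub>PSL2\<^esub> h \<in> carrier PSL2"
    using assms group_PSL2 by (simp add: group.is_monoid monoid.m_closed)
  ultimately show ?thesis
    using assms A B by (simp add: sigma_eq sym_power_mult)
qed

text \<open>The vector \<open>(p e\<^sub>1 + q e\<^sub>2)\<^sup>m\<close>.\<close>

definition pure_power :: "nat \<Rightarrow> real \<Rightarrow> real \<Rightarrow> nat \<Rightarrow> real" where
  "pure_power m p q = (\<lambda>k. real (m choose k) * p ^ (m - k) * q ^ k)"

lemma sym_eval_pure_power: "sym_eval m (pure_power m p q) s t = (p * s + q * t) ^ m"
proof -
  have "(q * t + p * s) ^ m = (\<Sum>k\<le>m. real (m choose k) * (q * t) ^ k * (p * s) ^ (m - k))"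
    by (rule binomial_ring)
  then show ?thesis
    by (simp add: sym_eval_def pure_power_def power_mult_distrib add.commute mult_ac)
qed

lemma sym_power_pure_power:
  "sym_power m A (pure_power m p q)
    = pure_power m (A$1$1 * p + A$1$2 * q) (A$2$1 * p + A$2$2 * q)"
proof (rule sym_power_eqI)
  fix t
  show "sym_eval m (sym_power m A (pure_power m p q)) 1 t =
    sym_eval m (pure_power m (A$1$1 * p + A$1$2 * q) (A$2$1 * p + A$2$2 * q)) 1 t"
    by (simp add: sym_eval_sym_power sym_eval_pure_power algebra_simps)
qed (simp add: pure_power_def binomial_eq_0)

lemma sigma_form_pure_power:
  assumes "n \<ge> 1"
  shows "sigma_form n (pure_power (4 * n - 2) p q) y = - sym_eval (4 * n - 2) y (- q) p"
proof -
  define m where "m = 4 * n - 2"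
  have "sigma_form n (pure_power m p q) y
      = (\<Sum>k\<le>m. - ((- q) ^ k * p ^ (m - k) * y (m - k)))"
    unfolding sigma_form_def Let_def m_def[symmetric]
    by (intro sum.cong refl) (simp add: pure_power_def power_minus[of q])
  also have "\<dots> = (\<Sum>k\<le>m. - ((- q) ^ (m - k) * p ^ k * y k))"
    by (rule sum.reindex_bij_witness[of _ "\<lambda>k. m - k" "\<lambda>k. m - k"]) auto
  also have "\<dots> = - sym_eval m y (- q) p"
    by (simp add: sym_eval_def sum_negf mult_ac)
  finally show ?thesis by (simp add: m_def)
qed

lemma sigma_form_invariant:
  assumes n: "n \<ge> 1" and A: "det A = 1"
  shows "sigma_form n (sym_power (4 * n - 2) A x) (sym_power (4 * n - 2) A y) = sigma_form n x y"
proof -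
  define m where "m = 4 * n - 2"
  define M where "M j k = poly.coeff ([:A$1$1, A$2$1:] ^ (m - k) * [:A$1$2, A$2$2:] ^ k) j" for j k
  define w where "w k z = (-1) ^ (k + 1) / real (m choose k) * z (m - k)" for k and z :: "nat \<Rightarrow> real"
  define L where "L k = (\<Sum>j\<le>m. M j k * w j (sym_power m A y))" for k
  have form: "sigma_form n x z = (\<Sum>k\<le>m. x k * w k z)" for x z
    by (simp add: sigma_form_def w_def Let_def m_def mult_ac)
  have form': "sigma_form n (sym_power m A x) (sym_power m A y) = (\<Sum>k\<le>m. x k * L k)" for x
  proof -
    have "sigma_form n (sym_power m A x) (sym_power m A y)
        = (\<Sum>j\<le>m. \<Sum>k\<le>m. x k * (M j k * w j (sym_power m A y)))"
      by (simp add: form sym_power_def[of m A x] M_def sum_distrib_left sum_distrib_right mult_ac)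
    also have "\<dots> = (\<Sum>k\<le>m. x k * L k)"
      by (subst sum.swap) (simp add: L_def sum_distrib_left)
    finally show ?thesis .
  qed
  have pure: "sigma_form n (sym_power m A (pure_power m p q)) (sym_power m A y)
      = sigma_form n (pure_power m p q) y" for p q
  proof -
    have d: "A$1$1 * A$2$2 - A$1$2 * A$2$1 = 1" using A by (simp add: det_2)
    have "A$1$1 * - (A$2$1 * p + A$2$2 * q) + A$2$1 * (A$1$1 * p + A$1$2 * q)
        = - q * (A$1$1 * A$2$2 - A$1$2 * A$2$1)"
      by algebra
    moreover have "A$1$2 * - (A$2$1 * p + A$2$2 * q) + A$2$2 * (A$1$1 * p + A$1$2 * q)
        = p * (A$1$1 * A$2$2 - A$1$2 * A$2$1)"
      by algebra
    ultimately show ?thesis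
      using sigma_form_pure_power[OF n, folded m_def] d
      by (simp only: sym_power_pure_power sym_eval_sym_power mult_1_right)
  qed
  have "(\<Sum>k\<le>m. (real (m choose k) * L k) * q ^ k)
      = (\<Sum>k\<le>m. (real (m choose k) * w k y) * q ^ k)" for q
    using pure[of 1 q] by (simp add: form' form[of _ y] pure_power_def mult_ac)
  then have "real (m choose k) * L k = real (m choose k) * w k y" if "k \<le> m" for k
    using polyfun_eq_coeffs[of "\<lambda>k. real (m choose k) * L k" m "\<lambda>k. real (m choose k) * w k y"]
      that by blast
  then have "L k = w k y" if "k \<le> m" for k
    using that by auto
  then show ?thesis
    by (simp add: form' form[of x y] flip: m_def)
qed

corollary sigma_preserves_form:
  assumes "n \<ge> 1" "g \<in> carrier PSL2"
  shows "sigma_form n (sigma n g x) (sigma n g y) = sigma_form n x y"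
proof -
  obtain A where "A \<in> g" using assms by (auto simp: carrier_PSL2)
  then show ?thesis
    using assms sigma_form_invariant PSL2_rep_cases(1) by (auto simp: sigma_eq)
qed


section \<open>Cocycles and affine actions\<close>

definition cocycles :: "nat \<Rightarrow> (real^2^2) set set \<Rightarrow> ((real^2^2) set \<Rightarrow> nat \<Rightarrow> real) set" where
  "cocycles n \<Gamma> = {u \<in> \<Gamma> \<rightarrow>\<^sub>E topspace (R_sig n).
     \<forall>g\<in>\<Gamma>. \<forall>h\<in>\<Gamma>. u (g \<otimes>\<^bsub>PSL2\<^esub> h) = (\<lambda>i. sigma n g (u h) i + u g i)}"

text \<open>The topology of pointwise convergence. It is a Hausdorff vector space topology, and hence
  on the finite-dimensional space of cocycles it is the usual one.\<close>

definition cocycle_space :: "nat \<Rightarrow> (real^2^2) set set \<Rightarrow> ((real^2^2) set \<Rightarrow> nat \<Rightarrow> real) topology" where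
  "cocycle_space n \<Gamma> = subtopology (product_topology (\<lambda>g. R_sig n) \<Gamma>) (cocycles n \<Gamma>)"

definition cocycle_scale ::
    "(real^2^2) set set \<Rightarrow> real \<Rightarrow> ((real^2^2) set \<Rightarrow> nat \<Rightarrow> real) \<Rightarrow> (real^2^2) set \<Rightarrow> nat \<Rightarrow> real" where
  "cocycle_scale \<Gamma> c u = (\<lambda>g\<in>\<Gamma>. \<lambda>i. c * u g i)"

definition cocycle_cone :: "(real^2^2) set set \<Rightarrow> ((real^2^2) set \<Rightarrow> nat \<Rightarrow> real) set \<Rightarrow> bool" where
  "cocycle_cone \<Gamma> K \<longleftrightarrow> (\<forall>u\<in>K. \<forall>c>0. cocycle_scale \<Gamma> c u \<in> K)"

definition affine_action ::
    "nat \<Rightarrow> ((real^2^2) set \<Rightarrow> nat \<Rightarrow> real) \<Rightarrow> (real^2^2) set \<Rightarrow> (nat \<Rightarrow> real) \<Rightarrow> nat \<Rightarrow> real" where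
  "affine_action n u g x = (\<lambda>i. sigma n g x i + u g i)"

definition properly_discontinuous :: "'g set \<Rightarrow> 'a topology \<Rightarrow> ('g \<Rightarrow> 'a \<Rightarrow> 'a) \<Rightarrow> bool" where
  "properly_discontinuous \<Gamma> X act \<longleftrightarrow>
     (\<forall>C. compactin X C \<longrightarrow> finite {g \<in> \<Gamma>. act g ` C \<inter> C \<noteq> {}})"

lemma topspace_cocycle_space: "topspace (cocycle_space n \<Gamma>) = cocycles n \<Gamma>"
  by (auto simp: cocycle_space_def cocycles_def topspace_product_topology)

end

theory Submission
  imports Defs "HOL-Real_Asymp.Real_Asymp"
begin

text \<open>Let \<open>m = 4 n - 2\<close>. For a point \<open>a\<close> of the circle outside the limit set and a half-plane
  \<open>H\<close> whose boundary geodesic joins \<open>a\<close> to another such point \<open>b\<close>, the formal coboundary of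
  \<open>\<Sum>\<^sub>g 1[g\<inverse> o \<in> H] (g a)\<^sup>m\<close> has only finitely many terms for each group element and is a cocycle \<open>u\<close>.
  A geodesic with ideal endpoints \<open>x\<close>, \<open>y\<close> has the neutral vector \<open>(x y)\<^sup>2\<^sup>n\<^sup>-\<^sup>1\<close>, and its pairing with
  \<open>(g a)\<^sup>m\<close> is a value of the corresponding binary form, whose sign tells on which side of the
  geodesic \<open>g a\<close> lies. Hence along the segment from \<open>o\<close> to \<open>\<gamma> o\<close> every crossed translate of the
  arc from \<open>a\<close> to \<open>b\<close> contributes to the pairing of \<open>u \<gamma>\<close> with the neutral vector a term of the same
  sign. By cocompactness on the convex core finitely many arcs suffice to make the pairing grow
  linearly in the length of the segment, and this persists for all cocycles that are close to
  \<open>u\<close> on a finite set. If \<open>\<gamma>\<close> moves a point of a compact set into that set, the same pairing is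
  bounded, so the action is proper. The arcs exist because the limit set contains no interval:
  otherwise the hull would contain arbitrarily large balls, and the surface would be compact.
  If the limit set has at most one point, the group is finite or cyclic parabolic.\<close>

section \<open>Two by two matrices\<close>

text \<open>A determinant-one matrix \<open>X\<close> stands for the point \<open>X i\<close> with a
  direction, and \<open>(norm X)\<^sup>2\<close> is twice the hyperbolic cosine of its distance from
  \<open>i\<close>; so statements about distance and compactness become norm bounds on matrices. The
  segment from \<open>o\<close> to \<open>\<gamma> o\<close> is used instead of the axis of
  \<open>\<gamma>\<close>, so that all elements are treated alike. Its neutral vector is not fixed
  by \<open>\<gamma>\<close>, but the pairing does not change when the frame slides along the
  geodesic. If \<open>y = \<gamma> x + u \<gamma>\<close>, the term with \<open>y\<close> can be
  read in a frame at \<open>o\<close>, and the term with \<open>x\<close> in the frame at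
  \<open>\<gamma> o\<close> pulled back to \<open>o\<close>. Both frames have bounded norm, which is
  why bounded \<open>x\<close> and \<open>y\<close> have bounded pairings. Persistence under
  perturbation is a chain argument: the value of a cocycle at \<open>\<gamma>\<close> splits along
  the segment into values on a fixed finite set of group elements, each read in a bounded frame. An
  error \<open>\<epsilon>\<close> on that set costs at most a multiple of \<open>\<epsilon>\<close>
  per step, and \<open>\<epsilon>\<close> is chosen to use up half of the growth.\<close>

definition mat2 :: "real \<Rightarrow> real \<Rightarrow> real \<Rightarrow> real \<Rightarrow> real^2^2" where
  "mat2 a b c d = vector [vector [a, b], vector [c, d]]"

definition vec2 :: "real \<Rightarrow> real \<Rightarrow> real^2" where
  "vec2 p q = vector [p, q]"

text \<open>This is the inverse of a determinant-one matrix, written polynomially in the entries,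
  which suits both continuity arguments and \<open>algebra\<close>.\<close>

definition adj2 :: "real^2^2 \<Rightarrow> real^2^2" where
  "adj2 A = mat2 (A$2$2) (- A$1$2) (- A$2$1) (A$1$1)"

text \<open>Ideal points are represented by vectors up to scale; this area form tells whether two of
  them coincide, and its sign orients arcs.\<close>

definition wedge :: "real^2 \<Rightarrow> real^2 \<Rightarrow> real" where
  "wedge p q = p$1 * q$2 - p$2 * q$1"

lemma mat2_nth [simp]:
  "mat2 a b c d $1$1 = a" "mat2 a b c d $1$2 = b" "mat2 a b c d $2$1 = c" "mat2 a b c d $2$2 = d"
  by (simp_all add: mat2_def)

lemma vec2_nth [simp]: "vec2 p q $1 = p" "vec2 p q $2 = q"
  by (simp_all add: vec2_def)

lemma vec2_eta: "vec2 (p$1) (p$2) = p"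
  by (simp add: vec_eq_iff forall_2)

lemma mat2_eq_iff:
  fixes A B :: "real^2^2"
  shows "A = B \<longleftrightarrow> A$1$1 = B$1$1 \<and> A$1$2 = B$1$2 \<and> A$2$1 = B$2$1 \<and> A$2$2 = B$2$2"
  by (auto simp: vec_eq_iff forall_2)

lemma vec2_eq_iff: "p = q \<longleftrightarrow> p$1 = q$1 \<and> p$2 = q$2" for p q :: "real^2"
  by (auto simp: vec_eq_iff forall_2)

lemma mat2_mult_nth:
  fixes A B :: "real^2^2"
  shows "(A ** B)$i$j = A$i$1 * B$1$j + A$i$2 * B$2$j"
  by (simp add: matrix_matrix_mult_def sum_2)

lemma mat2_vec_nth:
  fixes A :: "real^2^2"
  shows "(A *v p)$i = A$i$1 * p$1 + A$i$2 * p$2"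
  by (simp add: matrix_vector_mult_def sum_2)

lemma mat_1_nth [simp]:
  "(mat 1 :: real^2^2)$1$1 = 1" "(mat 1 :: real^2^2)$1$2 = 0"
  "(mat 1 :: real^2^2)$2$1 = 0" "(mat 1 :: real^2^2)$2$2 = 1"
  by (simp_all add: mat_def)

lemmas mat2_simps = mat2_mult_nth mat2_vec_nth mat2_eq_iff vec2_eq_iff

lemma inner_2: "p \<bullet> q = p$1 * q$1 + p$2 * q$2" for p q :: "real^2"
  by (simp add: inner_vec_def sum_2)

lemma norm_vec2_sq: "(norm p)\<^sup>2 = (p$1)\<^sup>2 + (p$2)\<^sup>2" for p :: "real^2"
  unfolding power2_norm_eq_inner inner_2 by (simp add: power2_eq_square)

lemma norm_mat2_sq: "(norm A)\<^sup>2 = (A$1$1)\<^sup>2 + (A$1$2)\<^sup>2 + (A$2$1)\<^sup>2 + (A$2$2)\<^sup>2"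
  for A :: "real^2^2"
  unfolding power2_norm_eq_inner inner_vec_def by (simp add: sum_2 power2_eq_square)

lemma abs_nth_le_norm: "\<bar>A$i$j\<bar> \<le> norm A" for A :: "real^2^2"
  by (metis Finite_Cartesian_Product.norm_nth_le order_trans real_norm_def)

lemma norm_mat2_vec_le: "norm (A *v p) \<le> norm A * norm p" for A :: "real^2^2"
proof (rule power2_le_imp_le)
  have *: "(x * y + z * w)\<^sup>2 \<le> (x\<^sup>2 + z\<^sup>2) * (y\<^sup>2 + w\<^sup>2)" for x y z w :: real
  proof -
    have "(x\<^sup>2 + z\<^sup>2) * (y\<^sup>2 + w\<^sup>2) - (x * y + z * w)\<^sup>2 = (x * w - z * y)\<^sup>2"
      by (simp add: power2_eq_square algebra_simps)
    then show ?thesis by (metis diff_ge_0_iff_ge zero_le_power2)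
  qed
  show "(norm (A *v p))\<^sup>2 \<le> (norm A * norm p)\<^sup>2"
    using *[of "A$1$1" "p$1" "A$1$2" "p$2"] *[of "A$2$1" "p$1" "A$2$2" "p$2"]
    by (simp add: power_mult_distrib norm_vec2_sq norm_mat2_sq mat2_vec_nth algebra_simps)
qed simp

lemma norm_mat2_mult_le: "norm (A ** B) \<le> norm A * norm B" for A B :: "real^2^2"
proof (rule power2_le_imp_le)
  have c: "(norm M)\<^sup>2 = (norm (column 1 M))\<^sup>2 + (norm (column 2 M))\<^sup>2" for M :: "real^2^2"
    by (simp add: norm_mat2_sq norm_vec2_sq column_def)
  have m: "column j (A ** B) = A *v column j B" for j
    by (simp add: vec2_eq_iff column_def mat2_mult_nth mat2_vec_nth)
  have "(norm (A *v column j B))\<^sup>2 \<le> (norm A * norm (column j B))\<^sup>2" for j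
    by (intro power_mono norm_mat2_vec_le) simp
  from this[of 1] this[of 2] show "(norm (A ** B))\<^sup>2 \<le> (norm A * norm B)\<^sup>2"
    by (simp add: c[of "A ** B"] c[of B] m power_mult_distrib algebra_simps)
qed simp

lemma wedge_mult: "wedge (A *v p) (A *v q) = det A * wedge p q" for A :: "real^2^2"
  by (simp add: wedge_def mat2_vec_nth det_2) algebra

lemma inner_sq_wedge_sq: "(p \<bullet> q)\<^sup>2 + (wedge p q)\<^sup>2 = (norm p)\<^sup>2 * (norm q)\<^sup>2"
  unfolding norm_vec2_sq inner_2 wedge_def by algebra

lemma wedge_zero_iff:
  assumes "p \<noteq> 0"
  shows "wedge p q = 0 \<longleftrightarrow> (\<exists>c. q = c *\<^sub>R p)"
proof
  assume w: "wedge p q = 0"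
  have n: "(p$1)\<^sup>2 + (p$2)\<^sup>2 \<noteq> 0" using assms by (simp add: vec2_eq_iff)
  have "p$1 * q$2 = p$2 * q$1" using w by (simp add: wedge_def)
  then have "((p$1)\<^sup>2 + (p$2)\<^sup>2) * q$1 = (p \<bullet> q) * p$1" "((p$1)\<^sup>2 + (p$2)\<^sup>2) * q$2 = (p \<bullet> q) * p$2"
    unfolding inner_2 by algebra+
  then have "q = ((p \<bullet> q) / ((p$1)\<^sup>2 + (p$2)\<^sup>2)) *\<^sub>R p"
    using n by (simp add: vec2_eq_iff field_simps)
  then show "\<exists>c. q = c *\<^sub>R p" ..
qed (auto simp: wedge_def)

lemma adj2_adj2 [simp]: "adj2 (adj2 A) = A"
  by (simp add: adj2_def mat2_eq_iff)

lemma det_adj2 [simp]: "det (adj2 A) = det A"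
  by (simp add: adj2_def det_2)

lemma adj2_mult: "adj2 (A ** B) = adj2 B ** adj2 A"
  by (simp add: adj2_def mat2_simps)

lemma adj2_one [simp]: "adj2 (mat 1) = mat 1"
  by (simp add: adj2_def mat2_simps)

lemma norm_adj2 [simp]: "norm (adj2 A) = norm A"
proof -
  have "(norm (adj2 A))\<^sup>2 = (norm A)\<^sup>2" by (simp add: norm_mat2_sq adj2_def)
  then show ?thesis by simp
qed

lemma adj2_left:
  fixes A B :: "real^2^2"
  assumes "det A = 1"
  shows "adj2 A ** A = mat 1" "adj2 A ** (A ** B) = B" "adj2 A *v (A *v p) = p"
proof -
  show 1: "adj2 A ** A = mat 1"
    using assms by (simp add: adj2_def mat2_simps det_2 algebra_simps)
  show "adj2 A ** (A ** B) = B" by (simp add: 1 matrix_mul_assoc)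
  show "adj2 A *v (A *v p) = p" by (simp add: 1 matrix_vector_mul_assoc)
qed

lemma adj2_right:
  fixes A B :: "real^2^2"
  assumes "det A = 1"
  shows "A ** adj2 A = mat 1" "A ** (adj2 A ** B) = B" "A *v (adj2 A *v p) = p"
  using adj2_left[of "adj2 A"] assms by simp_all

lemma norm_SL2_ge_1:
  fixes A :: "real^2^2"
  assumes "det A = 1"
  shows "norm A \<ge> 1"
proof -
  have "2 * (A$1$1 * A$2$2 - A$1$2 * A$2$1) \<le> (norm A)\<^sup>2"
  proof -
    have "0 \<le> (A$1$1 - A$2$2)\<^sup>2 + (A$1$2 + A$2$1)\<^sup>2" by simp
    then show ?thesis unfolding norm_mat2_sq by (simp add: power2_eq_square algebra_simps)
  qed
  then have "1\<^sup>2 \<le> (norm A)\<^sup>2" using assms by (simp add: det_2)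
  then show ?thesis by (rule power2_le_imp_le) simp
qed

text \<open>Submultiplicativity is applied to the inverse, which has the same Frobenius
  norm.\<close>

lemma norm_le_SL2:
  fixes A B :: "real^2^2"
  assumes "det A = 1"
  shows "norm p \<le> norm A * norm (A *v p)" "norm B \<le> norm A * norm (A ** B)"
  using norm_mat2_vec_le[of "adj2 A" "A *v p"] norm_mat2_mult_le[of "adj2 A" "A ** B"]
    adj2_left[OF assms] by simp_all

section \<open>Rotations, the diagonal flow and the Cartan decomposition\<close>

definition rot :: "real \<Rightarrow> real^2^2" where
  "rot x = mat2 (cos x) (- sin x) (sin x) (cos x)"

text \<open>The halved exponents give unit speed: the flow takes \<open>i\<close> to
  \<open>exp t\<close> times \<open>i\<close>.\<close>

definition flow :: "real \<Rightarrow> real^2^2" where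
  "flow t = mat2 (exp (t / 2)) 0 0 (exp (- t / 2))"

lemma det_rot [simp]: "det (rot x) = 1"
  using sin_cos_squared_add[of x] by (simp add: rot_def det_2 power2_eq_square)

lemma det_flow [simp]: "det (flow t) = 1"
  by (simp add: flow_def det_2 flip: exp_add)

lemma flow_add: "flow s ** flow t = flow (s + t)"
  by (simp add: flow_def mat2_simps add_divide_distrib flip: exp_add)

lemma flow_0 [simp]: "flow 0 = mat 1"
  by (simp add: flow_def mat2_simps)

lemma adj2_flow: "adj2 (flow t) = flow (- t)"
  by (simp add: flow_def adj2_def mat2_simps)

lemma inner_rot: "(rot x *v p) \<bullet> (rot x *v q) = p \<bullet> q"
proof -
  have "(rot x *v p) \<bullet> (rot x *v q) = ((sin x)\<^sup>2 + (cos x)\<^sup>2) * (p \<bullet> q)"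
    unfolding rot_def inner_2 mat2_vec_nth mat2_nth vec2_nth by algebra
  then show ?thesis by simp
qed

lemma adj2_rot: "adj2 (rot x) = rot (- x)"
  by (simp add: rot_def adj2_def)

lemma norm_mult_rot: "norm (A ** rot x) = norm A" for A :: "real^2^2"
proof -
  have "(norm (A ** rot x))\<^sup>2 = ((sin x)\<^sup>2 + (cos x)\<^sup>2) * (norm A)\<^sup>2"
    unfolding norm_mat2_sq mat2_mult_nth rot_def mat2_nth by algebra
  then show ?thesis by simp
qed

lemma norm_flow_le: "norm (flow t) \<le> 2 * exp (\<bar>t\<bar> / 2)"
proof (rule power2_le_imp_le)
  have "exp t \<le> exp \<bar>t\<bar>" "exp (- t) \<le> exp \<bar>t\<bar>" by simp_all
  moreover have "0 < exp \<bar>t\<bar>" by simp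
  ultimately have "exp t + exp (- t) \<le> 4 * exp \<bar>t\<bar>" by linarith
  then show "(norm (flow t))\<^sup>2 \<le> (2 * exp (\<bar>t\<bar> / 2))\<^sup>2"
    by (simp add: norm_mat2_sq flow_def power_mult_distrib flip: exp_double)
qed simp

text \<open>A real matrix acts on the complex plane by sending \<open>z\<close> to the sum of \<open>\<alpha> z\<close> and \<open>\<beta>\<close> times
  the conjugate of \<open>z\<close>; the two rotation angles are half the sum and half the difference of
  the arguments of \<open>\<alpha>\<close> and \<open>\<beta>\<close>, and the singular values are \<open>|\<alpha>| \<plusminus> |\<beta>|\<close>.\<close>

lemma cartan_decomposition:
  fixes A :: "real^2^2"
  assumes "det A = 1"
  obtains x y t where "t \<ge> 0" "A = rot x ** flow t ** rot y"
proof -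
  define \<alpha> where "\<alpha> = Complex ((A$1$1 + A$2$2) / 2) ((A$2$1 - A$1$2) / 2)"
  define \<beta> where "\<beta> = Complex ((A$1$1 - A$2$2) / 2) ((A$2$1 + A$1$2) / 2)"
  define r s where "r = cmod \<alpha>" and "s = cmod \<beta>"
  obtain \<phi> \<psi> where \<phi>: "\<alpha> = rcis r \<phi>" and \<psi>: "\<beta> = rcis s \<psi>"
    unfolding r_def s_def by (metis rcis_cmod_Arg)
  have "r\<^sup>2 - s\<^sup>2 = 1"
    using assms unfolding r_def s_def cmod_power2 \<alpha>_def \<beta>_def det_2
    by (simp add: power2_eq_square field_simps)
  then have rs: "(r + s) * (r - s) = 1" by (simp add: power2_eq_square algebra_simps)
  have nn: "r \<ge> 0" "s \<ge> 0" by (simp_all add: r_def s_def)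
  then have p1: "r + s > 0" using rs by (smt (verit) mult_eq_0_iff)
  then have p2: "r - s > 0" using rs by (smt (verit) mult_nonneg_nonpos)
  define t where "t = 2 * ln (r + s)"
  have e1: "exp (t / 2) = r + s" using p1 by (simp add: t_def)
  have e2: "exp (- t / 2) = r - s"
  proof -
    have "exp (- t / 2) = inverse (r + s)" by (simp add: e1 exp_minus)
    then show ?thesis using rs by (metis inverse_unique)
  qed
  have "(r + s) \<ge> 1"
  proof (rule ccontr)
    assume "\<not> r + s \<ge> 1"
    then have "(r + s) * (r - s) < 1 * 1"
      using p1 p2 nn by (intro mult_strict_mono') auto
    then show False using rs by simp
  qed
  then have t: "t \<ge> 0" by (simp add: t_def)
  define x y where "x = (\<phi> + \<psi>) / 2" and "y = (\<phi> - \<psi>) / 2"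
  have xy: "\<phi> = x + y" "\<psi> = x - y" by (simp_all add: x_def y_def field_simps)
  have A: "A$1$1 = Re \<alpha> + Re \<beta>" "A$2$2 = Re \<alpha> - Re \<beta>" "A$2$1 = Im \<alpha> + Im \<beta>" "A$1$2 = Im \<beta> - Im \<alpha>"
    by (simp_all add: \<alpha>_def \<beta>_def field_simps)
  have "A = rot x ** flow t ** rot y"
    unfolding mat2_eq_iff A mat2_mult_nth rot_def flow_def mat2_nth e1 e2
    by (simp add: \<phi> \<psi> xy cos_add sin_add cos_diff sin_diff algebra_simps)
  with t show thesis by (rule that)
qed

section \<open>Moebius transformations and the ideal boundary\<close>

definition mob :: "real^2^2 \<Rightarrow> complex \<Rightarrow> complex" where
  "mob A = moebius (of_real (A$1$1)) (of_real (A$1$2)) (of_real (A$2$1)) (of_real (A$2$2))"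

text \<open>The base point of a frame. Right multiplication by \<open>rot\<close> only turns the
  frame, right multiplication by \<open>flow\<close> moves it along its geodesic, and left
  multiplication is the isometric action.\<close>

definition frame_pt :: "real^2^2 \<Rightarrow> complex" where
  "frame_pt X = mob X \<i>"

text \<open>Homogeneous coordinates on the ideal boundary. The zero vector is also sent to
  \<open>None\<close>, hence the hypotheses \<open>p \<noteq> 0\<close> below.\<close>

definition bd :: "real^2 \<Rightarrow> complex option" where
  "bd p = (if p$2 = 0 then None else Some (of_real (p$1 / p$2)))"

lemma mob_eq: "mob A z = (of_real (A$1$1) * z + of_real (A$1$2)) / (of_real (A$2$1) * z + of_real (A$2$2))"
  by (simp add: mob_def moebius_def)

lemma mob_denom_nonzero:
  fixes A :: "real^2^2"
  assumes "det A = 1" "z \<in> H2"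
  shows "of_real (A$2$1) * z + of_real (A$2$2) \<noteq> (0 :: complex)"
proof
  assume 0: "of_real (A$2$1) * z + of_real (A$2$2) = (0 :: complex)"
  then have "A$2$1 * Im z = 0" by (auto simp: complex_eq_iff)
  then have c: "A$2$1 = 0" using assms(2) by (simp add: H2_def)
  then have "A$2$2 = 0" using 0 by (simp add: complex_eq_iff)
  then show False using c assms(1) by (simp add: det_2)
qed

lemma mob_diff:
  assumes "det A = 1" "z \<in> H2" "w \<in> H2"
  shows "mob A z - mob A w = (z - w) / ((of_real (A$2$1) * z + of_real (A$2$2)) * (of_real (A$2$1) * w + of_real (A$2$2)))"
proof -
  define a b c d where "a = complex_of_real (A$1$1)" and "b = complex_of_real (A$1$2)"
    and "c = complex_of_real (A$2$1)" and "d = complex_of_real (A$2$2)"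
  have nz: "c * z + d \<noteq> 0" "c * w + d \<noteq> 0"
    using mob_denom_nonzero[OF assms(1)] assms(2,3) by (auto simp: c_def d_def)
  have "a * d - b * c = complex_of_real (det A)"
    by (simp add: a_def b_def c_def d_def det_2)
  then have 1: "a * d - b * c = 1" using assms(1) by simp
  have "(a * z + b) * (c * w + d) - (a * w + b) * (c * z + d) = (a * d - b * c) * (z - w)"
    by algebra
  then have "(a * z + b) * (c * w + d) - (a * w + b) * (c * z + d) = z - w" by (simp add: 1)
  then show ?thesis using nz
    unfolding mob_eq a_def[symmetric] b_def[symmetric] c_def[symmetric] d_def[symmetric]
    by (simp add: diff_frac_eq)
qed

lemma Im_mob:
  assumes "det A = 1"
  shows "Im (mob A z) = Im z / (cmod (of_real (A$2$1) * z + of_real (A$2$2)))\<^sup>2"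
proof -
  let ?d = "of_real (A$2$1) * z + of_real (A$2$2)"
  have "Im ((of_real (A$1$1) * z + of_real (A$1$2)) * cnj ?d) = det A * Im z"
    by (simp add: det_2 algebra_simps)
  moreover have "mob A z = ((of_real (A$1$1) * z + of_real (A$1$2)) * cnj ?d) / of_real ((cmod ?d)\<^sup>2)"
    unfolding mob_eq by (rule complex_div_cnj)
  ultimately show ?thesis using assms by (simp only: Im_divide_of_real)
qed

lemma mob_in_H2:
  assumes "det A = 1" "z \<in> H2"
  shows "mob A z \<in> H2"
  using mob_denom_nonzero[OF assms] assms(2) by (simp add: H2_def Im_mob[OF assms(1)])

lemma mob_mult:
  assumes "det B = 1" "z \<in> H2"
  shows "mob (A ** B) z = mob A (mob B z)"
proof -
  have nz: "of_real (B$2$1) * z + of_real (B$2$2) \<noteq> (0 :: complex)"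
    by (rule mob_denom_nonzero[OF assms])
  have *: "(a * x + b * y) / (c * x + d * y) = (a * (x / y) + b) / (c * (x / y) + d)"
    if "y \<noteq> 0" for a b c d x y :: complex
  proof -
    have "a * (x / y) + b = (a * x + b * y) / y" "c * (x / y) + d = (c * x + d * y) / y"
      using that by (simp_all add: field_simps)
    then show ?thesis using that by simp
  qed
  show ?thesis
    unfolding mob_eq[of A] mob_eq[of B] *[OF nz, symmetric]
    by (simp add: mob_eq mat2_mult_nth algebra_simps)
qed

lemma mob_one [simp]: "mob (mat 1) z = z"
  by (simp add: mob_eq)

lemma hyp_dist_mob:
  assumes "det A = 1" "z \<in> H2" "w \<in> H2"
  shows "hyp_dist (mob A z) (mob A w) = hyp_dist z w"
proof -
  let ?d = "\<lambda>z. cmod (of_real (A$2$1) * z + of_real (A$2$2))"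
  have nz: "?d z \<noteq> 0" "?d w \<noteq> 0"
    using mob_denom_nonzero[OF assms(1)] assms(2,3) by simp_all
  have "(cmod (z - w) / (?d z * ?d w))\<^sup>2 / (2 * (Im z / (?d z)\<^sup>2) * (Im w / (?d w)\<^sup>2))
      = (cmod (z - w))\<^sup>2 / (2 * Im z * Im w)"
    unfolding power_divide power_mult_distrib using nz by simp
  then show ?thesis
    unfolding hyp_dist_def mob_diff[OF assms] Im_mob[OF assms(1)] norm_divide norm_mult by (simp only:)
qed

lemma ii_in_H2 [simp]: "\<i> \<in> H2"
  by (simp add: H2_def)

lemma frame_pt_in_H2: "det X = 1 \<Longrightarrow> frame_pt X \<in> H2"
  by (simp add: frame_pt_def mob_in_H2)

lemma frame_pt_mult: "det X = 1 \<Longrightarrow> frame_pt (A ** X) = mob A (frame_pt X)"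
  by (simp add: frame_pt_def mob_mult)

lemma H2_frame_cases:
  assumes "z \<in> H2"
  obtains X where "det X = 1" "frame_pt X = z"
proof
  define s where "s = sqrt (Im z)"
  have s: "s > 0" "s * s = Im z" using assms by (simp_all add: s_def H2_def)
  let ?X = "mat2 s (Re z / s) 0 (1 / s)"
  show "det ?X = 1" using s by (simp add: det_2)
  show "frame_pt ?X = z"
    using s by (simp add: frame_pt_def mob_eq complex_eq_iff)
qed

text \<open>Divided by the imaginary part, the left side is, up to scale, the exponential of a
  Busemann function at the ideal point \<open>s / r\<close>; the inverse frame measures it as the
  length of a vector.\<close>

lemma cmod_lin_frame_pt:
  assumes "det X = 1"
  shows "(cmod (of_real r * frame_pt X - of_real s))\<^sup>2 = Im (frame_pt X) * (norm (adj2 X *v vec2 s r))\<^sup>2"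
proof -
  let ?d = "of_real (X$2$1) * \<i> + of_real (X$2$2)"
  have nz: "?d \<noteq> 0" using mob_denom_nonzero[OF assms ii_in_H2] .
  have "of_real r * frame_pt X - of_real s
      = (of_real r * (of_real (X$1$1) * \<i> + of_real (X$1$2)) - of_real s * ?d) / ?d"
    using nz by (simp add: frame_pt_def mob_eq diff_divide_distrib)
  then have "(cmod (of_real r * frame_pt X - of_real s))\<^sup>2
      = (cmod (of_real r * (of_real (X$1$1) * \<i> + of_real (X$1$2)) - of_real s * ?d))\<^sup>2 / (cmod ?d)\<^sup>2"
    by (simp add: norm_divide power_divide)
  also have "(cmod (of_real r * (of_real (X$1$1) * \<i> + of_real (X$1$2)) - of_real s * ?d))\<^sup>2
      = (norm (adj2 X *v vec2 s r))\<^sup>2"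
    unfolding cmod_power2 norm_vec2_sq by (simp add: adj2_def mat2_vec_nth power2_eq_square algebra_simps)
  finally show ?thesis by (simp add: frame_pt_def Im_mob[OF assms])
qed

text \<open>Adding the Busemann formula for the ideal points 0 and infinity gives
  \<open>(norm X)\<^sup>2\<close> as twice the hyperbolic cosine of the distance from
  \<open>i\<close> to the base point.\<close>

lemma norm_frame:
  assumes "det X = 1"
  shows "(cmod (frame_pt X))\<^sup>2 + 1 = Im (frame_pt X) * (norm X)\<^sup>2"
proof -
  have pos: "Im (frame_pt X) > 0" using frame_pt_in_H2[OF assms] by (simp add: H2_def)
  have 1: "(cmod (frame_pt X))\<^sup>2 = Im (frame_pt X) * (norm (adj2 X *v vec2 0 1))\<^sup>2"
    using cmod_lin_frame_pt[OF assms, of 1 0] by simp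
  have 2: "1 = Im (frame_pt X) * (norm (adj2 X *v vec2 1 0))\<^sup>2"
    using cmod_lin_frame_pt[OF assms, of 0 1] by simp
  have "(norm (adj2 X *v vec2 0 1))\<^sup>2 + (norm (adj2 X *v vec2 1 0))\<^sup>2 = (norm X)\<^sup>2"
    unfolding norm_vec2_sq norm_mat2_sq by (simp add: adj2_def mat2_vec_nth)
  with 1 2 show ?thesis by (metis distrib_left)
qed

text \<open>Up to a factor depending on \<open>p\<close>, the squared chordal distance from \<open>z\<close> to \<open>bd p\<close> is
  \<open>|p\<^sub>2 z - p\<^sub>1|\<^sup>2 / (|z|\<^sup>2 + 1)\<close>.\<close>

lemma bd_nhds_chordal:
  assumes "openin riemann_sphere U" "bd p \<in> U" "p \<noteq> 0"
  obtains \<epsilon> where "\<epsilon> > 0"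
    "\<And>z. (cmod (of_real (p$2) * z - of_real (p$1)))\<^sup>2 < \<epsilon> * ((cmod z)\<^sup>2 + 1) \<Longrightarrow> Some z \<in> U"
proof (cases "p$2 = 0")
  case True
  then have p1: "p$1 \<noteq> 0" using assms(3) by (simp add: vec2_eq_iff)
  have "None \<in> U" using assms(2) True by (simp add: bd_def)
  then obtain C where C: "compact C" "U = insert None (Some ` (- C))"
    using assms(1) unfolding riemann_sphere_def openin_Alexandroff_compactification
    by (auto simp: Compl_eq_Diff_UNIV)
  obtain B where B: "B > 0" "\<And>z. z \<in> C \<Longrightarrow> cmod z \<le> B"
    using compact_imp_bounded[OF C(1)] bounded_pos by blast
  have "Some z \<in> U" if "(cmod (of_real (p$2) * z - of_real (p$1)))\<^sup>2 < (p$1)\<^sup>2 / (B\<^sup>2 + 1) * ((cmod z)\<^sup>2 + 1)" for z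
  proof -
    have pos: "B\<^sup>2 + 1 > 0" by (simp add: add_nonneg_pos)
    have "(p$1)\<^sup>2 * 1 < (p$1)\<^sup>2 * (((cmod z)\<^sup>2 + 1) / (B\<^sup>2 + 1))" using that True by simp
    then have "1 < ((cmod z)\<^sup>2 + 1) / (B\<^sup>2 + 1)"
      using p1 by (metis mult_less_cancel_left_pos zero_less_power2)
    then have "B\<^sup>2 < (cmod z)\<^sup>2" using pos by (simp add: less_divide_eq)
    then have "B < cmod z" by (rule power2_less_imp_less) simp
    then have "z \<notin> C" using B(2) by force
    then show ?thesis by (simp add: C(2))
  qed
  moreover have "(p$1)\<^sup>2 / (B\<^sup>2 + 1) > 0" using p1 by (simp add: add_nonneg_pos)
  ultimately show thesis using that by blast
next
  case False
  define x where "x = p$1 / p$2"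
  have "Some (of_real x) \<in> U" using assms(2) False by (simp add: bd_def x_def)
  then obtain V where V: "open V" "of_real x \<in> V" "Some ` V \<subseteq> U"
  proof -
    consider V where "open V" "U = Some ` V" | C where "compact C" "U = insert None (Some ` (- C))"
      using assms(1) unfolding riemann_sphere_def openin_Alexandroff_compactification
      by (auto simp: Compl_eq_Diff_UNIV)
    then show thesis
    proof cases
      case 1
      then show ?thesis using \<open>Some (of_real x) \<in> U\<close> by (intro that[of V]) auto
    next
      case 2
      then show ?thesis using \<open>Some (of_real x) \<in> U\<close> compact_imp_closed
        by (intro that[of "- C"]) auto
    qed
  qed
  obtain \<delta> where \<delta>: "\<delta> > 0" "ball (of_real x) \<delta> \<subseteq> V" using V openE by blast
  \<comment> \<open>With \<open>d\<close> the distance from \<open>z\<close> to \<open>x\<close>,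
    \<open>(cmod z)\<^sup>2 + 1\<close> is at most \<open>2 * d\<^sup>2 + 2 * x\<^sup>2 + 1\<close>.
    This \<open>K\<close> is the value of that bound at \<open>d = \<delta>\<close>, so the
    threshold \<open>\<delta>\<^sup>2 / K\<close> forces \<open>d < \<delta>\<close>.\<close>
  define K where "K = 2 * x\<^sup>2 + 1 + 2 * \<delta>\<^sup>2"
  have K: "K > 0" using \<delta> by (simp add: K_def add_nonneg_pos)
  define e where "e = \<delta>\<^sup>2 / K"
  have e: "e > 0" using \<delta> K by (simp add: e_def)
  have "Some z \<in> U" if *: "(cmod (of_real (p$2) * z - of_real (p$1)))\<^sup>2 < (p$2)\<^sup>2 * e * ((cmod z)\<^sup>2 + 1)" for z
  proof -
    let ?d = "cmod (z - of_real x)"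
    have "of_real (p$2) * z - of_real (p$1) = of_real (p$2) * (z - of_real x)"
      using False by (simp add: x_def algebra_simps)
    then have "(p$2)\<^sup>2 * ?d\<^sup>2 < (p$2)\<^sup>2 * (e * ((cmod z)\<^sup>2 + 1))"
      using * by (simp add: norm_mult power_mult_distrib)
    then have 1: "?d\<^sup>2 < e * ((cmod z)\<^sup>2 + 1)"
      using False by (metis mult_less_cancel_left_pos zero_less_power2)
    have "cmod z \<le> ?d + \<bar>x\<bar>"
      using norm_triangle_ineq[of "z - of_real x" "of_real x"] by simp
    then have "(cmod z)\<^sup>2 \<le> (?d + \<bar>x\<bar>)\<^sup>2" by (intro power_mono) auto
    also have "\<dots> \<le> 2 * ?d\<^sup>2 + 2 * x\<^sup>2"
      using zero_le_power2[of "?d - \<bar>x\<bar>"] by (simp add: power2_sum power2_diff)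
    finally have "e * ((cmod z)\<^sup>2 + 1) \<le> e * (2 * ?d\<^sup>2 + 2 * x\<^sup>2 + 1)" using e by simp
    with 1 have "?d\<^sup>2 < e * (2 * ?d\<^sup>2 + 2 * x\<^sup>2 + 1)" by linarith
    then have "K * ?d\<^sup>2 < K * (e * (2 * ?d\<^sup>2 + 2 * x\<^sup>2 + 1))" using K by simp
    also have "\<dots> = \<delta>\<^sup>2 * (2 * ?d\<^sup>2 + 2 * x\<^sup>2 + 1)" using K by (simp add: e_def)
    finally have "(2 * x\<^sup>2 + 1) * ?d\<^sup>2 < (2 * x\<^sup>2 + 1) * \<delta>\<^sup>2" by (simp add: K_def algebra_simps)
    then have "?d\<^sup>2 < \<delta>\<^sup>2" by (rule mult_left_less_imp_less) simp
    then have "?d < \<delta>" using \<delta> by (simp add: power2_less_imp_less)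
    then have "z \<in> V" using \<delta>(2) by (auto simp: dist_norm norm_minus_commute)
    then show ?thesis using V(3) by auto
  qed
  moreover have "(p$2)\<^sup>2 * e > 0" using False e by simp
  ultimately show thesis using that by blast
qed

lemma chordal_nhds_bd:
  assumes "p \<noteq> 0" "\<epsilon> > 0"
  obtains U where "openin riemann_sphere U" "bd p \<in> U"
    "\<And>z. Some z \<in> U \<Longrightarrow> (cmod (of_real (p$2) * z - of_real (p$1)))\<^sup>2 < \<epsilon> * ((cmod z)\<^sup>2 + 1)"
proof (cases "p$2 = 0")
  case True
  define B where "B = \<bar>p$1\<bar> / sqrt \<epsilon>"
  let ?U = "insert None (Some ` (- cball 0 B))"
  have "openin riemann_sphere ?U"
    unfolding riemann_sphere_def openin_Alexandroff_compactification
    by (auto simp: Compl_eq_Diff_UNIV intro!: exI[of _ "cball 0 B"])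
  moreover have "bd p \<in> ?U" using True by (simp add: bd_def)
  moreover have "(cmod (of_real (p$2) * z - of_real (p$1)))\<^sup>2 < \<epsilon> * ((cmod z)\<^sup>2 + 1)" if "Some z \<in> ?U" for z
  proof -
    have "B < cmod z" using that by auto
    moreover have "B \<ge> 0" using assms(2) by (simp add: B_def)
    ultimately have "B\<^sup>2 < (cmod z)\<^sup>2" by (intro power_strict_mono) auto
    then have "\<epsilon> * B\<^sup>2 < \<epsilon> * (cmod z)\<^sup>2" using assms(2) by simp
    moreover have "\<epsilon> * B\<^sup>2 = (p$1)\<^sup>2" using assms(2) by (simp add: B_def power_divide)
    ultimately show ?thesis using True assms(2) by (simp add: algebra_simps)
  qed
  ultimately show thesis using that by blast
next
  case False
  define x where "x = p$1 / p$2"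
  define \<delta> where "\<delta> = sqrt \<epsilon> / \<bar>p$2\<bar>"
  have \<delta>: "\<delta> > 0" "(p$2)\<^sup>2 * \<delta>\<^sup>2 = \<epsilon>" using False assms(2) by (simp_all add: \<delta>_def power_divide)
  let ?U = "Some ` ball (complex_of_real x) \<delta>"
  have "openin riemann_sphere ?U" by (simp add: riemann_sphere_def)
  moreover have "bd p \<in> ?U" using False \<delta> by (simp add: bd_def x_def)
  moreover have "(cmod (of_real (p$2) * z - of_real (p$1)))\<^sup>2 < \<epsilon> * ((cmod z)\<^sup>2 + 1)" if "Some z \<in> ?U" for z
  proof -
    have "cmod (z - of_real x) < \<delta>" using that by (auto simp: dist_norm norm_minus_commute)
    then have "(cmod (z - of_real x))\<^sup>2 < \<delta>\<^sup>2" by (intro power_strict_mono) auto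
    then have "(p$2)\<^sup>2 * (cmod (z - of_real x))\<^sup>2 < \<epsilon>" using \<delta>(2) False
      by (metis mult_less_cancel_left_pos zero_less_power2)
    moreover have "of_real (p$2) * z - of_real (p$1) = of_real (p$2) * (z - of_real x)"
      using False by (simp add: x_def algebra_simps)
    ultimately have "(cmod (of_real (p$2) * z - of_real (p$1)))\<^sup>2 < \<epsilon> * 1"
      by (simp add: norm_mult power_mult_distrib)
    also have "\<dots> \<le> \<epsilon> * ((cmod z)\<^sup>2 + 1)" using assms(2) by simp
    finally show ?thesis .
  qed
  ultimately show thesis using that by blast
qed

lemma chordal_frame:
  assumes "det X = 1"
  shows "(cmod (of_real (p$2) * frame_pt X - of_real (p$1)))\<^sup>2 < \<epsilon> * ((cmod (frame_pt X))\<^sup>2 + 1)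
    \<longleftrightarrow> (norm (adj2 X *v p))\<^sup>2 < \<epsilon> * (norm X)\<^sup>2"
proof -
  have pos: "Im (frame_pt X) > 0" using frame_pt_in_H2[OF assms] by (simp add: H2_def)
  have "(cmod (of_real (p$2) * frame_pt X - of_real (p$1)))\<^sup>2 = Im (frame_pt X) * (norm (adj2 X *v p))\<^sup>2"
    by (simp add: cmod_lin_frame_pt[OF assms] vec2_eta)
  moreover have "\<epsilon> * ((cmod (frame_pt X))\<^sup>2 + 1) = Im (frame_pt X) * (\<epsilon> * (norm X)\<^sup>2)"
    by (simp add: norm_frame[OF assms])
  ultimately show ?thesis using pos by (simp only: mult_less_cancel_left_pos)
qed

lemma bd_in_ideal_boundary: "bd p \<in> ideal_boundary"
  by (simp add: bd_def ideal_boundary_def)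

text \<open>The flow line of the identity frame runs from 0 to infinity. Both endpoints are reached
  for the same reason: \<open>adj2 (X ** flow t)\<close> takes \<open>X *v v\<close> to
  \<open>flow (- t) *v v\<close>, which tends to zero.\<close>

lemma geodesic_line_frame:
  assumes "det X = 1"
  shows "geodesic_line (\<lambda>t. frame_pt (X ** flow t)) (bd (X *v vec2 0 1)) (bd (X *v vec2 1 0))"
proof -
  have det: "det (X ** flow t) = 1" for t using assms by (simp add: det_mul)
  have lim: "limitin riemann_sphere (\<lambda>t. Some (frame_pt (X ** flow t))) (bd (X *v v)) F"
    if v: "v \<noteq> 0" and small: "((\<lambda>t. norm (flow (- t) *v v)) \<longlongrightarrow> 0) F" for v F
    unfolding limitin_def
  proof (intro conjI allI impI)
    show "bd (X *v v) \<in> topspace riemann_sphere"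
      unfolding riemann_sphere_def topspace_Alexandroff_compactification by (simp add: bd_def)
    fix U assume U: "openin riemann_sphere U \<and> bd (X *v v) \<in> U"
    have nz: "X *v v \<noteq> 0" using v adj2_left(3)[OF assms, of v] by auto
    obtain \<epsilon> where \<epsilon>: "\<epsilon> > 0" "\<And>z. (cmod (of_real ((X *v v)$2) * z - of_real ((X *v v)$1)))\<^sup>2 < \<epsilon> * ((cmod z)\<^sup>2 + 1) \<Longrightarrow> Some z \<in> U"
      using bd_nhds_chordal[OF conjunct1[OF U] conjunct2[OF U] nz] by blast
    have "sqrt \<epsilon> > 0" using \<epsilon> by simp
    then have "\<forall>\<^sub>F t in F. norm (flow (- t) *v v) < sqrt \<epsilon>"
      using small order_tendstoD(2) by blast
    then show "\<forall>\<^sub>F t in F. Some (frame_pt (X ** flow t)) \<in> U"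
    proof eventually_elim
      case (elim t)
      have "adj2 (X ** flow t) *v (X *v v) = flow (- t) *v v"
        by (simp add: adj2_mult adj2_flow matrix_vector_mul_assoc[symmetric] adj2_left[OF assms])
      moreover have "(norm (flow (- t) *v v))\<^sup>2 < (sqrt \<epsilon>)\<^sup>2" using elim by (intro power_strict_mono) auto
      moreover have "\<epsilon> * 1\<^sup>2 \<le> \<epsilon> * (norm (X ** flow t))\<^sup>2"
        using \<epsilon>(1) norm_SL2_ge_1[OF det[of t]] by (intro mult_left_mono power_mono) auto
      ultimately have "(norm (adj2 (X ** flow t) *v (X *v v)))\<^sup>2 < \<epsilon> * (norm (X ** flow t))\<^sup>2"
        using \<epsilon>(1) by (simp only: real_sqrt_pow2 less_imp_le power_one mult_1_right)
      then show ?case using \<epsilon>(2) chordal_frame[OF det] by blast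
    qed
  qed
  have e: "norm (flow (- t) *v vec2 0 1) = exp (t / 2)" "norm (flow (- t) *v vec2 1 0) = exp (- t / 2)" for t
    by (simp_all add: flow_def norm_vec_def L2_set_def sum_2 mat2_vec_nth)
  have "((\<lambda>t::real. exp (t / 2)) \<longlongrightarrow> 0) at_bot" by real_asymp
  moreover have "((\<lambda>t::real. exp (- t / 2)) \<longlongrightarrow> 0) at_top" by real_asymp
  moreover have "hyp_dist (frame_pt (X ** flow s)) (frame_pt (X ** flow t)) = \<bar>s - t\<bar>" for s t
  proof -
    have f: "frame_pt (flow t) = complex_of_real (exp t) * \<i>" for t
    proof -
      have "complex_of_real (exp (t / 2)) = complex_of_real (exp t) * complex_of_real (exp (- (t / 2)))"
        unfolding of_real_mult[symmetric] exp_add[symmetric] by simp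
      then show ?thesis by (simp add: frame_pt_def mob_eq flow_def field_simps)
    qed
    have d: "cmod (complex_of_real (exp s) * \<i> - complex_of_real (exp t) * \<i>) = \<bar>exp s - exp t\<bar>"
      unfolding left_diff_distrib[symmetric] of_real_diff[symmetric] norm_mult norm_of_real by simp
    have "hyp_dist (frame_pt (flow s)) (frame_pt (flow t)) = arcosh (1 + (exp s - exp t)\<^sup>2 / (2 * exp s * exp t))"
      unfolding f hyp_dist_def d by (simp add: Re_exp)
    also have "1 + (exp s - exp t)\<^sup>2 / (2 * exp s * exp t) = cosh (s - t)"
      by (simp add: cosh_def exp_diff exp_minus field_simps power2_eq_square)
    finally have "hyp_dist (frame_pt (flow s)) (frame_pt (flow t)) = \<bar>s - t\<bar>"
      using arcosh_cosh_real[of "\<bar>s - t\<bar>"] by simp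
    then show ?thesis
      by (simp add: frame_pt_mult hyp_dist_mob[OF assms] frame_pt_in_H2)
  qed
  ultimately show ?thesis
    unfolding geodesic_line_def by (auto simp: e vec2_eq_iff frame_pt_in_H2 det intro!: lim)
qed

section \<open>Limit sets and convex hulls of matrix groups\<close>

text \<open>Meant for the preimage in SL(2,R) of a subgroup of PSL(2,R): closure under negation lets
  matrices replace cosets.\<close>

locale SL2_group =
  fixes G :: "(real^2^2) set"
  assumes det_G: "A \<in> G \<Longrightarrow> det A = 1"
    and one_G: "mat 1 \<in> G"
    and mult_G: "A \<in> G \<Longrightarrow> B \<in> G \<Longrightarrow> A ** B \<in> G"
    and adj2_G: "A \<in> G \<Longrightarrow> adj2 A \<in> G"
    and uminus_G: "A \<in> G \<Longrightarrow> - A \<in> G"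

lemma mem_Union_PSL2_iff:
  assumes "subgroup \<Gamma> PSL2"
  shows "A \<in> \<Union>\<Gamma> \<longleftrightarrow> {A, - A} \<in> \<Gamma>"
proof
  assume "A \<in> \<Union>\<Gamma>"
  then obtain g where g: "g \<in> \<Gamma>" "A \<in> g" by auto
  then have "g \<in> carrier PSL2" using subgroup.subset[OF assms] by auto
  then have "g = {A, - A}" using g(2) by (auto simp: carrier_PSL2)
  then show "{A, - A} \<in> \<Gamma>" using g by simp
qed auto

lemma PSL2_mult_eq:
  assumes "det A = 1" "det B = 1"
  shows "{A, - A} \<otimes>\<^bsub>PSL2\<^esub> {B, - B} = {A ** B, - (A ** B)}"
proof -
  have "(- A) ** B = - (A ** B)" "A ** (- B) = - (A ** B)" for A B :: "real^2^2"
    by (simp_all add: mat2_simps)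
  then show ?thesis by (auto simp: PSL2_def FactGroup_def set_mult_def SL2_def)
qed

lemma SL2_group_Union:
  assumes "subgroup \<Gamma> PSL2"
  shows "SL2_group (\<Union>\<Gamma>)"
proof
  have det: "det A = 1" if "A \<in> \<Union>\<Gamma>" for A
    using that subgroup.subset[OF assms] PSL2_rep_cases(1) by auto
  then show "det A = 1" if "A \<in> \<Union>\<Gamma>" for A using that .
  have one: "\<one>\<^bsub>PSL2\<^esub> = {mat 1, - mat 1}" by (simp add: PSL2_def FactGroup_def)
  then show 1: "mat 1 \<in> \<Union>\<Gamma>"
    using subgroup.one_closed[OF assms] unfolding mem_Union_PSL2_iff[OF assms] by simp
  show "A ** B \<in> \<Union>\<Gamma>" if "A \<in> \<Union>\<Gamma>" "B \<in> \<Union>\<Gamma>" for A B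
    using that det subgroup.m_closed[OF assms, of "{A, - A}" "{B, - B}"]
    by (simp only: mem_Union_PSL2_iff[OF assms] PSL2_mult_eq)
  show "- A \<in> \<Union>\<Gamma>" if "A \<in> \<Union>\<Gamma>" for A
    using that unfolding mem_Union_PSL2_iff[OF assms] by (simp add: insert_commute)
  show "adj2 A \<in> \<Union>\<Gamma>" if A: "A \<in> \<Union>\<Gamma>" for A
  proof -
    have g: "{A, - A} \<in> carrier PSL2"
      using A subgroup.subset[OF assms] unfolding mem_Union_PSL2_iff[OF assms] by blast
    have dA: "det A = 1" using A det by blast
    then have dB: "det (adj2 A) = 1" by simp
    have "{adj2 A, - adj2 A} \<in> carrier PSL2" using dB by (auto simp: carrier_PSL2)
    moreover have "{adj2 A, - adj2 A} \<otimes>\<^bsub>PSL2\<^esub> {A, - A} = \<one>\<^bsub>PSL2\<^esub>"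
      using PSL2_mult_eq[OF dB dA] adj2_left[OF dA] one by simp
    ultimately have "inv\<^bsub>PSL2\<^esub> {A, - A} = {adj2 A, - adj2 A}"
      using group.inv_equality[OF group_PSL2] g by blast
    then show ?thesis
      using A subgroup.m_inv_closed[OF assms] by (metis mem_Union_PSL2_iff[OF assms])
  qed
qed

lemma PSL2_moebius_eq_mob:
  assumes "g \<in> carrier PSL2" "A \<in> g"
  shows "PSL2_moebius g z = mob A z"
  using PSL2_moebius_eq[OF assms] by (simp add: mob_def)

lemma H2_orbit_eq:
  assumes "subgroup \<Gamma> PSL2"
  shows "H2_orbit \<Gamma> z = (\<lambda>A. mob A z) ` \<Union>\<Gamma>"
proof -
  have m: "PSL2_moebius g z = mob A z" if "g \<in> \<Gamma>" "A \<in> g" for g A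
    using that subgroup.subset[OF assms] PSL2_moebius_eq_mob by blast
  have "\<exists>A. A \<in> g" if "g \<in> \<Gamma>" for g
    using that subgroup.subset[OF assms] by (auto simp: carrier_PSL2)
  then have "\<exists>A\<in>\<Union>\<Gamma>. PSL2_moebius g z = mob A z" if "g \<in> \<Gamma>" for g
    using that m by blast
  moreover have "\<exists>g\<in>\<Gamma>. mob A z = PSL2_moebius g z" if "A \<in> \<Union>\<Gamma>" for A
    using that m by force
  ultimately show ?thesis unfolding H2_orbit_def orbit_def by (auto; blast)
qed

text \<open>The directions, up to scale, that are contracted by group elements as strongly as possible;
  they represent the points of the limit set.\<close>

definition lim_dirs :: "(real^2^2) set \<Rightarrow> (real^2) set" where
  "lim_dirs G = {p. p \<noteq> 0 \<and> (\<forall>\<epsilon>>0. \<exists>A\<in>G. norm (A *v p) < \<epsilon> * norm A)}"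

lemma nonzero_lim_dirs: "p \<in> lim_dirs G \<Longrightarrow> p \<noteq> 0"
  by (simp add: lim_dirs_def)

lemma lim_dirs_scaleR:
  assumes "p \<in> lim_dirs G" "c \<noteq> 0"
  shows "c *\<^sub>R p \<in> lim_dirs G"
  unfolding lim_dirs_def
proof (intro CollectI conjI allI impI)
  show "c *\<^sub>R p \<noteq> 0" using assms by (auto simp: lim_dirs_def)
  fix \<epsilon> :: real assume "\<epsilon> > 0"
  then have "\<epsilon> / \<bar>c\<bar> > 0" using assms(2) by simp
  then obtain A where A: "A \<in> G" "norm (A *v p) < \<epsilon> / \<bar>c\<bar> * norm A"
    using assms(1) unfolding lim_dirs_def by blast
  have "A *v (c *\<^sub>R p) = c *\<^sub>R (A *v p)" by (simp add: vec2_eq_iff mat2_vec_nth algebra_simps)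
  then have "norm (A *v (c *\<^sub>R p)) < \<epsilon> * norm A"
    using A(2) assms(2) by (simp add: field_simps)
  then show "\<exists>A\<in>G. norm (A *v (c *\<^sub>R p)) < \<epsilon> * norm A" using A(1) by blast
qed

lemma (in SL2_group) lim_dirs_invariant:
  assumes "p \<in> lim_dirs G" "B \<in> G"
  shows "B *v p \<in> lim_dirs G"
  unfolding lim_dirs_def
proof (intro CollectI conjI allI impI)
  have dB: "det B = 1" by (rule det_G[OF assms(2)])
  show "B *v p \<noteq> 0" using assms(1) adj2_left(3)[OF dB, of p] by (auto simp: lim_dirs_def)
  fix \<epsilon> :: real assume "\<epsilon> > 0"
  have B: "norm B > 0" using norm_SL2_ge_1[OF dB] by linarith
  then have "\<epsilon> / norm B > 0" using \<open>\<epsilon> > 0\<close> by simp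
  then obtain A where A: "A \<in> G" "norm (A *v p) < \<epsilon> / norm B * norm A"
    using assms(1) unfolding lim_dirs_def by blast
  have "A = (A ** adj2 B) ** B" using adj2_left[OF dB] by (simp add: matrix_mul_assoc[symmetric])
  then have "norm A \<le> norm (A ** adj2 B) * norm B" using norm_mat2_mult_le by metis
  then have "\<epsilon> / norm B * norm A \<le> \<epsilon> / norm B * (norm (A ** adj2 B) * norm B)"
    using \<open>\<epsilon> > 0\<close> B by (intro mult_left_mono) auto
  also have "\<dots> = \<epsilon> * norm (A ** adj2 B)" using B by simp
  finally have "norm ((A ** adj2 B) *v (B *v p)) < \<epsilon> * norm (A ** adj2 B)"
    using A(2) adj2_left(3)[OF dB, of p] by (simp add: matrix_vector_mul_assoc[symmetric])
  then show "\<exists>A\<in>G. norm (A *v (B *v p)) < \<epsilon> * norm A"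
    using A(1) assms(2) adj2_G mult_G by blast
qed

text \<open>By \<open>chordal_frame\<close> for the frame \<open>adj2 A\<close>, strong contraction
  of \<open>p\<close> by \<open>A\<close> means that the inverse of \<open>A\<close> moves
  \<open>i\<close> close to \<open>bd p\<close>. Another base point changes the contraction only by
  a constant factor.\<close>

lemma limit_set_iff_lim_dirs:
  assumes "subgroup \<Gamma> PSL2" "p \<noteq> 0"
  shows "bd p \<in> limit_set \<Gamma> \<longleftrightarrow> p \<in> lim_dirs (\<Union>\<Gamma>)"
proof -
  interpret SL2_group "\<Union>\<Gamma>" by (rule SL2_group_Union[OF assms(1)])
  show ?thesis
  proof
    assume p: "p \<in> lim_dirs (\<Union>\<Gamma>)"
    have "bd p \<in> riemann_sphere derived_set_of (Some ` H2_orbit \<Gamma> \<i>)"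
      unfolding in_derived_set_of
    proof (intro conjI allI impI)
      show "bd p \<in> topspace riemann_sphere"
        unfolding riemann_sphere_def topspace_Alexandroff_compactification by (simp add: bd_def)
      fix T assume T: "bd p \<in> T \<and> openin riemann_sphere T"
      obtain \<epsilon> where \<epsilon>: "\<epsilon> > 0" "\<And>z. (cmod (of_real (p$2) * z - of_real (p$1)))\<^sup>2 < \<epsilon> * ((cmod z)\<^sup>2 + 1) \<Longrightarrow> Some z \<in> T"
        using bd_nhds_chordal[OF conjunct2[OF T] conjunct1[OF T] assms(2)] by blast
      from \<epsilon>(1) have "sqrt \<epsilon> > 0" by simp
      then obtain A where A: "A \<in> \<Union>\<Gamma>" "norm (A *v p) < sqrt \<epsilon> * norm A"
        using p unfolding lim_dirs_def by blast
      have d: "det (adj2 A) = 1" using det_G[OF A(1)] by simp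
      have "(norm (A *v p))\<^sup>2 < (sqrt \<epsilon> * norm A)\<^sup>2"
        using A(2) by (intro power_strict_mono) auto
      then have "(norm (adj2 (adj2 A) *v p))\<^sup>2 < \<epsilon> * (norm (adj2 A))\<^sup>2"
        using \<epsilon>(1) by (simp add: power_mult_distrib)
      then have "Some (frame_pt (adj2 A)) \<in> T" using \<epsilon>(2) chordal_frame[OF d] by blast
      moreover have "Some (frame_pt (adj2 A)) \<noteq> bd p"
        using frame_pt_in_H2[OF d] by (auto simp: bd_def H2_def)
      moreover have "frame_pt (adj2 A) \<in> H2_orbit \<Gamma> \<i>"
        using adj2_G[OF A(1)] by (auto simp: H2_orbit_eq[OF assms(1)] frame_pt_def)
      ultimately show "\<exists>y\<noteq>bd p. y \<in> Some ` H2_orbit \<Gamma> \<i> \<and> y \<in> T" by blast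
    qed
    then show "bd p \<in> limit_set \<Gamma>"
      using ii_in_H2 bd_in_ideal_boundary unfolding limit_set_def by blast
  next
    assume "bd p \<in> limit_set \<Gamma>"
    then obtain z where z: "z \<in> H2" "bd p \<in> riemann_sphere derived_set_of (Some ` H2_orbit \<Gamma> z)"
      by (auto simp: limit_set_def)
    obtain X where X: "det X = 1" "frame_pt X = z" using H2_frame_cases[OF z(1)] .
    have X1: "norm X \<ge> 1" using norm_SL2_ge_1[OF X(1)] .
    then have pX: "norm X > 0" by linarith
    have "\<exists>A\<in>\<Union>\<Gamma>. norm (A *v p) < \<epsilon> * norm A" if "\<epsilon> > 0" for \<epsilon>
    proof -
      \<comment> \<open>Replacing the base point \<open>z\<close> by \<open>i\<close> costs a factor
        \<open>norm X\<close> on each side of the contraction inequality.\<close>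
      define e where "e = \<epsilon> / (norm X)\<^sup>2"
      have e: "e > 0" "e * (norm X)\<^sup>2 = \<epsilon>"
        using that pX by (simp_all add: e_def)
      then have e2: "e\<^sup>2 > 0" by simp
      obtain U where U: "openin riemann_sphere U" "bd p \<in> U"
        "\<And>z. Some z \<in> U \<Longrightarrow> (cmod (of_real (p$2) * z - of_real (p$1)))\<^sup>2 < e\<^sup>2 * ((cmod z)\<^sup>2 + 1)"
        using chordal_nhds_bd[OF assms(2) e2] by blast
      then obtain y where y: "y \<in> Some ` H2_orbit \<Gamma> z" "y \<in> U"
        using z(2) unfolding in_derived_set_of by blast
      then obtain A where A: "A \<in> \<Union>\<Gamma>" "y = Some (mob A z)"
        by (auto simp: H2_orbit_eq[OF assms(1)])
      have dA: "det A = 1" by (rule det_G[OF A(1)])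
      have d: "det (A ** X) = 1" using dA X(1) by (simp add: det_mul)
      have "frame_pt (A ** X) = mob A z" using X by (simp add: frame_pt_mult)
      then have "Some (frame_pt (A ** X)) \<in> U" using y(2) A(2) by simp
      then have "(norm (adj2 (A ** X) *v p))\<^sup>2 < e\<^sup>2 * (norm (A ** X))\<^sup>2"
        by (rule iffD1[OF chordal_frame[OF d] U(3)])
      then have "(norm (adj2 (A ** X) *v p))\<^sup>2 < (e * norm (A ** X))\<^sup>2"
        by (simp add: power_mult_distrib)
      then have *: "norm (adj2 (A ** X) *v p) < e * norm (A ** X)"
        by (rule power2_less_imp_less) (use e in auto)
      have "norm (adj2 A *v p) \<le> norm (adj2 X) * norm (adj2 X *v (adj2 A *v p))"
        using X(1) by (intro norm_le_SL2) simp
      also have "\<dots> = norm X * norm (adj2 (A ** X) *v p)"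
        by (simp add: adj2_mult matrix_vector_mul_assoc)
      also have "\<dots> < norm X * (e * norm (A ** X))" using * X1 by (intro mult_strict_left_mono) auto
      also have "\<dots> \<le> norm X * (e * (norm A * norm X))"
        using norm_mat2_mult_le e X1 by (intro mult_left_mono) auto
      also have "\<dots> = \<epsilon> * norm (adj2 A)" unfolding e(2)[symmetric] by (simp add: power2_eq_square)
      finally show ?thesis using adj2_G[OF A(1)] by blast
    qed
    then show "p \<in> lim_dirs (\<Union>\<Gamma>)" using assms(2) by (simp add: lim_dirs_def)
  qed
qed

section \<open>Convex hulls and cocompactness in terms of frames\<close>

lemma geodesically_convexD:
  assumes "geodesically_convex C" "z \<in> C" "w \<in> C" "v \<in> H2" "hyp_dist z v + hyp_dist v w = hyp_dist z w"
  shows "v \<in> C"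
proof -
  have "\<forall>z\<in>C. \<forall>w\<in>C. \<forall>v\<in>H2. hyp_dist z v + hyp_dist v w = hyp_dist z w \<longrightarrow> v \<in> C"
    using assms(1) unfolding geodesically_convex_def by (rule conjunct2)
  from this[THEN bspec, OF assms(2), THEN bspec, OF assms(3), THEN bspec, OF assms(4)] assms(5)
  show ?thesis by (rule mp)
qed

lemma geodesically_convex_hull: "geodesically_convex (hyp_convex_hull \<Lambda>)"
proof -
  define \<C> where "\<C> = {C. geodesically_convex C \<and>
    (\<forall>c. \<forall>\<xi>\<in>\<Lambda>. \<forall>\<eta>\<in>\<Lambda>. geodesic_line c \<xi> \<eta> \<longrightarrow> range c \<subseteq> C)}"
  have hull: "hyp_convex_hull \<Lambda> = \<Inter>\<C>" by (simp add: hyp_convex_hull_def \<C>_def)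
  have conv: "geodesically_convex C" if "C \<in> \<C>" for C using that by (simp add: \<C>_def)
  have "geodesically_convex H2" by (simp add: geodesically_convex_def)
  then have "H2 \<in> \<C>" by (simp add: \<C>_def geodesic_line_def)
  then have "\<Inter>\<C> \<subseteq> H2" by (rule Inter_lower)
  moreover have "v \<in> \<Inter>\<C>" if "z \<in> \<Inter>\<C>" "w \<in> \<Inter>\<C>" "v \<in> H2" "hyp_dist z v + hyp_dist v w = hyp_dist z w" for z w v
  proof
    fix C assume C: "C \<in> \<C>"
    then have "z \<in> C" "w \<in> C" using that(1,2) by auto
    then show "v \<in> C" using geodesically_convexD[OF conv[OF C] _ _ that(3,4)] by blast
  qed
  ultimately show ?thesis unfolding hull geodesically_convex_def by (intro conjI ballI impI)
qed

lemma frame_pt_in_hull: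
  assumes "subgroup \<Gamma> PSL2" "det X = 1"
    and "X *v vec2 1 0 \<in> lim_dirs (\<Union>\<Gamma>)" "X *v vec2 0 1 \<in> lim_dirs (\<Union>\<Gamma>)"
  shows "frame_pt X \<in> hyp_convex_hull (limit_set \<Gamma>)"
proof -
  have "bd (X *v vec2 0 1) \<in> limit_set \<Gamma>" "bd (X *v vec2 1 0) \<in> limit_set \<Gamma>"
    using assms(3,4) limit_set_iff_lim_dirs[OF assms(1)] nonzero_lim_dirs by blast+
  then have "range (\<lambda>t. frame_pt (X ** flow t)) \<subseteq> hyp_convex_hull (limit_set \<Gamma>)"
    using geodesic_line_frame[OF assms(2)] unfolding hyp_convex_hull_def
    by (intro Inter_greatest) (simp only: mem_Collect_eq)
  moreover have "frame_pt X = frame_pt (X ** flow 0)" by simp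
  ultimately show ?thesis by blast
qed

lemma frame_pt_segment_in_hull:
  assumes "det B = 1" "frame_pt B \<in> hyp_convex_hull \<Lambda>" "frame_pt (B ** flow L) \<in> hyp_convex_hull \<Lambda>"
    and "0 \<le> t" "t \<le> L"
  shows "frame_pt (B ** flow t) \<in> hyp_convex_hull \<Lambda>"
proof -
  have d: "hyp_dist (frame_pt (B ** flow s)) (frame_pt (B ** flow t)) = \<bar>s - t\<bar>" for s t
    using geodesic_line_frame[OF assms(1)] by (simp add: geodesic_line_def)
  have "det (B ** flow t) = 1" using assms(1) by (simp add: det_mul)
  then have "frame_pt (B ** flow t) \<in> H2" by (rule frame_pt_in_H2)
  moreover have "hyp_dist (frame_pt B) (frame_pt (B ** flow t)) + hyp_dist (frame_pt (B ** flow t)) (frame_pt (B ** flow L))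
      = hyp_dist (frame_pt B) (frame_pt (B ** flow L))"
    using d[of 0 t] d[of t L] d[of 0 L] assms(4,5) by simp
  ultimately show ?thesis
    by (rule geodesically_convexD[OF geodesically_convex_hull assms(2,3)])
qed

lemma continuous_on_mob:
  assumes "det A = 1"
  shows "continuous_on H2 (mob A)"
  unfolding mob_eq[abs_def] using mob_denom_nonzero[OF assms] by (intro continuous_intros) auto

lemma H2_orbit_eq_iff:
  assumes "subgroup \<Gamma> PSL2" "x \<in> H2"
  shows "H2_orbit \<Gamma> x = H2_orbit \<Gamma> z \<longleftrightarrow> (\<exists>A\<in>\<Union>\<Gamma>. mob A x = z)"
proof -
  interpret SL2_group "\<Union>\<Gamma>" by (rule SL2_group_Union[OF assms(1)])
  show ?thesis
  proof
    assume "H2_orbit \<Gamma> x = H2_orbit \<Gamma> z"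
    moreover have "mob (mat 1) z \<in> H2_orbit \<Gamma> z"
      using one_G unfolding H2_orbit_eq[OF assms(1)] by blast
    ultimately have "z \<in> H2_orbit \<Gamma> x" by simp
    then show "\<exists>A\<in>\<Union>\<Gamma>. mob A x = z" unfolding H2_orbit_eq[OF assms(1)] by blast
  next
    assume "\<exists>A\<in>\<Union>\<Gamma>. mob A x = z"
    then obtain A where A: "A \<in> \<Union>\<Gamma>" "mob A x = z" by blast
    have dA: "det A = 1" using det_G[OF A(1)] .
    have "mob B z = mob (B ** A) x" for B using mob_mult[OF dA assms(2)] A(2) by simp
    then have "mob B z \<in> H2_orbit \<Gamma> x" if "B \<in> \<Union>\<Gamma>" for B
      unfolding H2_orbit_eq[OF assms(1)] by (rule image_eqI) (rule mult_G[OF that A(1)])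
    then have 1: "H2_orbit \<Gamma> z \<subseteq> H2_orbit \<Gamma> x"
      unfolding H2_orbit_eq[OF assms(1), of z] by (rule image_subsetI)
    have "z \<in> H2" using mob_in_H2[OF dA assms(2)] A(2) by simp
    have "mob (adj2 A) z = x" using mob_mult[OF dA assms(2), of "adj2 A"] A(2) adj2_left[OF dA] by simp
    then have "mob B x = mob (B ** adj2 A) z" for B
      using mob_mult[of "adj2 A" z B] dA \<open>z \<in> H2\<close> by simp
    then have "mob B x \<in> H2_orbit \<Gamma> z" if "B \<in> \<Union>\<Gamma>" for B
      unfolding H2_orbit_eq[OF assms(1)] by (rule image_eqI) (rule mult_G[OF that adj2_G[OF A(1)]])
    then have "H2_orbit \<Gamma> x \<subseteq> H2_orbit \<Gamma> z"
      unfolding H2_orbit_eq[OF assms(1), of x] by (rule image_subsetI)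
    with 1 show "H2_orbit \<Gamma> x = H2_orbit \<Gamma> z" by blast
  qed
qed

text \<open>The sets \<open>N k\<close> are the open hyperbolic balls about \<open>i\<close>. Their
  images are an increasing open cover of the compact core, so one ball meets every orbit in the
  hull, and \<open>norm_frame\<close> turns membership in it into a norm bound.\<close>

lemma convex_cocompact_frames:
  assumes sub: "subgroup \<Gamma> PSL2" and cc: "convex_cocompact \<Gamma>"
  obtains r where "\<And>X. det X = 1 \<Longrightarrow> frame_pt X \<in> hyp_convex_hull (limit_set \<Gamma>) \<Longrightarrow> \<exists>A\<in>\<Union>\<Gamma>. norm (A ** X) < r"
proof -
  interpret SL2_group "\<Union>\<Gamma>" by (rule SL2_group_Union[OF sub])
  define N where "N k = {z \<in> H2. (cmod z)\<^sup>2 + 1 < real k * Im z}" for k :: nat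
  define V where "V k = H2_orbit \<Gamma> ` N k" for k
  have mono: "V k \<subseteq> V l" if "k \<le> l" for k l
  proof -
    have "N k \<subseteq> N l"
    proof
      fix z assume z: "z \<in> N k"
      then have "real k * Im z \<le> real l * Im z"
        using that by (intro mult_right_mono) (auto simp: N_def H2_def)
      then show "z \<in> N l" using z by (auto simp: N_def)
    qed
    then show ?thesis by (auto simp: V_def)
  qed
  have V_iff: "H2_orbit \<Gamma> x \<in> V k \<longleftrightarrow> (\<exists>A\<in>\<Union>\<Gamma>. mob A x \<in> N k)" if "x \<in> H2" for x k
    unfolding V_def image_iff H2_orbit_eq_iff[OF sub that] by blast
  have openH: "open H2" unfolding H2_def by (intro open_Collect_less continuous_intros)
  have openN: "open (N k)" for k
  proof -
    have "N k = H2 \<inter> {z. (cmod z)\<^sup>2 + 1 < real k * Im z}" by (auto simp: N_def)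
    then show ?thesis
      using openH by (auto intro!: open_Int open_Collect_less continuous_intros)
  qed
  have openV: "openin (quotient_surface \<Gamma>) (V k)" for k
    unfolding quotient_surface_def openin_quotient_topology
  proof
    show "V k \<subseteq> H2_orbit \<Gamma> ` topspace (top_of_set H2)" by (auto simp: V_def N_def)
    have "{x \<in> H2. H2_orbit \<Gamma> x \<in> V k} = (\<Union>A\<in>\<Union>\<Gamma>. {x \<in> H2. mob A x \<in> N k})"
      using V_iff by auto
    moreover have "open {x \<in> H2. mob A x \<in> N k}" if "A \<in> \<Union>\<Gamma>" for A
    proof -
      have "{x \<in> H2. mob A x \<in> N k} = H2 \<inter> mob A -` N k" by auto
      then show ?thesis
        using continuous_open_preimage[OF continuous_on_mob openH openN] det_G[OF that] by simp
    qed
    then have "open (\<Union>A\<in>\<Union>\<Gamma>. {x \<in> H2. mob A x \<in> N k})" by (intro open_UN ballI)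
    ultimately have "open {x \<in> H2. H2_orbit \<Gamma> x \<in> V k}" by (simp only:)
    then show "openin (top_of_set H2) {x \<in> topspace (top_of_set H2). H2_orbit \<Gamma> x \<in> V k}"
      by (simp add: openin_open_eq[OF openH])
  qed
  have "convex_core \<Gamma> \<subseteq> \<Union>(range V)"
  proof
    fix c assume "c \<in> convex_core \<Gamma>"
    then obtain z where z: "z \<in> hyp_convex_hull (limit_set \<Gamma>)" "c = H2_orbit \<Gamma> z"
      by (auto simp: convex_core_def)
    have zH: "z \<in> H2" using z(1) geodesically_convex_hull by (auto simp: geodesically_convex_def)
    then have Im: "Im z > 0" by (simp add: H2_def)
    obtain k where "((cmod z)\<^sup>2 + 1) / Im z < real k" using reals_Archimedean2 by blast
    then have "z \<in> N k" using Im zH by (simp add: N_def field_simps)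
    then show "c \<in> \<Union>(range V)" using z(2) by (auto simp: V_def)
  qed
  then obtain \<F> where "finite \<F>" "\<F> \<subseteq> range V" "convex_core \<Gamma> \<subseteq> \<Union>\<F>"
    using compactinD[OF cc[unfolded convex_cocompact_def], of "range V"] openV by blast
  then obtain K where K: "finite K" "convex_core \<Gamma> \<subseteq> (\<Union>k\<in>K. V k)"
    by (metis (no_types) finite_subset_image)
  define k where "k = Max (insert 0 K)"
  have core: "convex_core \<Gamma> \<subseteq> V k"
  proof -
    have "V l \<subseteq> V k" if "l \<in> K" for l
      using that K(1) unfolding k_def by (intro mono Max_ge) auto
    then show ?thesis using K(2) by blast
  qed
  show thesis
  proof
    fix X :: "real^2^2" assume X: "det X = 1" "frame_pt X \<in> hyp_convex_hull (limit_set \<Gamma>)"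
    have "H2_orbit \<Gamma> (frame_pt X) \<in> V k" using X(2) core by (auto simp: convex_core_def)
    then obtain A where A: "A \<in> \<Union>\<Gamma>" "mob A (frame_pt X) \<in> N k"
      using V_iff frame_pt_in_H2[OF X(1)] by blast
    have d: "det (A ** X) = 1" using det_G[OF A(1)] X(1) by (simp add: det_mul)
    have "frame_pt (A ** X) \<in> N k" using A(2) X(1) by (simp add: frame_pt_mult)
    then have "Im (frame_pt (A ** X)) * (norm (A ** X))\<^sup>2 < real k * Im (frame_pt (A ** X))" "Im (frame_pt (A ** X)) > 0"
      unfolding N_def H2_def mem_Collect_eq norm_frame[OF d] by blast+
    then have "(norm (A ** X))\<^sup>2 < real k"
      by (simp only: mult.commute[of "real k"] mult_less_cancel_left_pos)
    also have "real k \<le> (real k + 1)\<^sup>2" by (simp add: power2_eq_square algebra_simps)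
    finally have "norm (A ** X) < real k + 1" by (rule power2_less_imp_less) simp
    then show "\<exists>A\<in>\<Union>\<Gamma>. norm (A ** X) < real k + 1" using A(1) by blast
  qed
qed

text \<open>Every orbit meets a fixed closed ball, whose compact image is therefore the whole
  quotient.\<close>

lemma compact_quotient_surface_frames:
  assumes sub: "subgroup \<Gamma> PSL2" and "\<And>X. det X = 1 \<Longrightarrow> \<exists>A\<in>\<Union>\<Gamma>. norm (A ** X) < r"
  shows "compact_space (quotient_surface \<Gamma>)"
proof -
  interpret SL2_group "\<Union>\<Gamma>" by (rule SL2_group_Union[OF sub])
  \<comment> \<open>The weak inequality makes \<open>K\<close> closed in the complex plane; the
    second condition already keeps it off the real axis.\<close>
  define K where "K = {z. Im z \<ge> 0 \<and> (cmod z)\<^sup>2 + 1 \<le> r\<^sup>2 * Im z}"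
  have KH: "K \<subseteq> H2"
  proof
    fix z assume z: "z \<in> K"
    have "Im z \<noteq> 0"
    proof
      assume "Im z = 0"
      then have "(cmod z)\<^sup>2 + 1 \<le> 0" using z by (simp add: K_def)
      then show False using zero_le_power2[of "cmod z"] by linarith
    qed
    then show "z \<in> H2" using z by (simp add: K_def H2_def)
  qed
  have "closed K" unfolding K_def
    by (intro closed_Collect_conj closed_Collect_le continuous_intros)
  moreover have "bounded K"
  proof (rule boundedI)
    fix z assume z: "z \<in> K"
    have "cmod z * cmod z \<le> r\<^sup>2 * cmod z"
    proof -
      have "r\<^sup>2 * Im z \<le> r\<^sup>2 * cmod z" by (intro mult_left_mono) (auto intro: order_trans[OF _ abs_Im_le_cmod])
      then show ?thesis using z by (auto simp: K_def power2_eq_square)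
    qed
    moreover have "cmod z > 0" using z KH by (auto simp: H2_def)
    ultimately show "cmod z \<le> r\<^sup>2" by simp
  qed
  ultimately have "compact K" using compact_eq_bounded_closed by blast
  then have "compactin (top_of_set H2) K" using KH by (simp add: compactin_subtopology)
  then have "compactin (quotient_surface \<Gamma>) (H2_orbit \<Gamma> ` K)"
    unfolding quotient_surface_def
    by (rule image_compactin) (rule quotient_imp_continuous_map[OF quotient_map_quotient_topology])
  moreover have "topspace (quotient_surface \<Gamma>) = H2_orbit \<Gamma> ` K"
  proof -
    have "H2_orbit \<Gamma> z \<in> H2_orbit \<Gamma> ` K" if z: "z \<in> H2" for z
    proof -
      obtain X where X: "det X = 1" "frame_pt X = z" using H2_frame_cases[OF z] .
      obtain A where A: "A \<in> \<Union>\<Gamma>" "norm (A ** X) < r" using assms(2)[OF X(1)] by blast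
      have d: "det (A ** X) = 1" using det_G[OF A(1)] X(1) by (simp add: det_mul)
      have "(norm (A ** X))\<^sup>2 \<le> r\<^sup>2" using A(2) by (intro power_mono) auto
      moreover have Im: "Im (frame_pt (A ** X)) > 0" using frame_pt_in_H2[OF d] by (simp add: H2_def)
      ultimately have "Im (frame_pt (A ** X)) * (norm (A ** X))\<^sup>2 \<le> r\<^sup>2 * Im (frame_pt (A ** X))"
        by (simp only: mult.commute[of "r\<^sup>2"]) (intro mult_left_mono, auto)
      then have inK: "frame_pt (A ** X) \<in> K"
        unfolding K_def mem_Collect_eq norm_frame[OF d] using Im by simp
      have "mob A z = frame_pt (A ** X)" using X by (simp add: frame_pt_mult)
      then have "H2_orbit \<Gamma> z = H2_orbit \<Gamma> (frame_pt (A ** X))"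
        using A(1) by (intro iffD2[OF H2_orbit_eq_iff[OF sub z]] bexI)
      then show ?thesis using inK by (rule image_eqI)
    qed
    then show ?thesis using KH by (auto simp: quotient_surface_def topspace_quotient_topology)
  qed
  ultimately show ?thesis by (simp add: compact_space_def)
qed

text \<open>If an interval consisted of limit points, the hull would contain arbitrarily large hyperbolic
  balls, hence translates of every point of the hyperbolic plane to a bounded set would exist.\<close>

lemma ex_not_lim_dir:
  assumes sub: "subgroup \<Gamma> PSL2" and cc: "convex_cocompact \<Gamma>"
    and nc: "\<not> compact_space (quotient_surface \<Gamma>)" and ab: "a < b"
  obtains x where "a < x" "x < b" "vec2 x 1 \<notin> lim_dirs (\<Union>\<Gamma>)"
proof -
  interpret SL2_group "\<Union>\<Gamma>" by (rule SL2_group_Union[OF sub])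
  obtain r where r: "\<And>X. det X = 1 \<Longrightarrow> frame_pt X \<in> hyp_convex_hull (limit_set \<Gamma>) \<Longrightarrow> \<exists>A\<in>\<Union>\<Gamma>. norm (A ** X) < r"
    using convex_cocompact_frames[OF sub cc] by blast
  have "\<exists>x. a < x \<and> x < b \<and> vec2 x 1 \<notin> lim_dirs (\<Union>\<Gamma>)"
  proof (rule ccontr)
    assume "\<not> ?thesis"
    then have all: "vec2 x 1 \<in> lim_dirs (\<Union>\<Gamma>)" if "a < x" "x < b" for x using that by blast
    have small: "z \<in> hyp_convex_hull (limit_set \<Gamma>)" if "Im z > 0" "a < Re z - Im z" "Re z + Im z < b" for z
    proof -
      \<comment> \<open>The frame \<open>X\<close> has \<open>z\<close> at the top of the semicircle
        with endpoints \<open>Re z - Im z\<close> and \<open>Re z + Im z\<close>; \<open>s\<close>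
        normalizes its determinant.\<close>
      define s where "s = 1 / sqrt (2 * Im z)"
      have s: "s \<noteq> 0" "s * s * (2 * Im z) = 1" using that(1) by (simp_all add: s_def)
      define X where "X = mat2 (s * (Re z + Im z)) (s * (Re z - Im z)) s s"
      have "det X = s * s * (2 * Im z)" by (simp add: X_def det_2 algebra_simps)
      then have d: "det X = 1" using s by simp
      have "X *v vec2 1 0 = s *\<^sub>R vec2 (Re z + Im z) 1" "X *v vec2 0 1 = s *\<^sub>R vec2 (Re z - Im z) 1"
        by (simp_all add: X_def mat2_simps)
      then have "frame_pt X \<in> hyp_convex_hull (limit_set \<Gamma>)"
        using that s(1) by (intro frame_pt_in_hull[OF sub d]) (auto intro!: lim_dirs_scaleR all)
      moreover have "frame_pt X = z"
      proof -
        have "frame_pt X = (of_real (s * (Re z + Im z)) * \<i> + of_real (s * (Re z - Im z))) / (of_real s * \<i> + of_real s)"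
          by (simp add: frame_pt_def mob_eq X_def)
        also have "of_real (s * (Re z + Im z)) * \<i> + of_real (s * (Re z - Im z)) = z * (of_real s * \<i> + of_real s)"
          by (simp add: complex_eq_iff algebra_simps)
        also have "of_real s * \<i> + of_real s \<noteq> 0" using s(1) by (simp add: complex_eq_iff)
        ultimately show ?thesis by simp
      qed
      ultimately show ?thesis by simp
    qed
    have "\<exists>A\<in>\<Union>\<Gamma>. norm (A ** Z) < r" if Z: "det Z = 1" for Z
    proof -
      \<comment> \<open>The ball must contain the frame \<open>Y\<close> built from \<open>Z\<close>
        below, whose norm is at most \<open>\<bar>r\<bar> * norm Z\<close>; the summand 2 makes room
        for the identity frame. The affine map \<open>X\<close> then shrinks the ball by a factor
        \<open>e\<close> into the part of the hull found in \<open>small\<close>.\<close>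
      define R where "R = (\<bar>r\<bar> * norm Z)\<^sup>2 + 2"
      have R: "R \<ge> 2" by (simp add: R_def)
      define c where "c = (b - a) / 2"
      define e where "e = c / (4 * R)"
      have e: "e > 0" "2 * (e * R) < c" using R ab by (simp_all add: e_def c_def)
      define X where "X = mat2 (sqrt e) ((a + b) / 2 / sqrt e) 0 (1 / sqrt e)"
      have dX: "det X = 1" using e by (simp add: X_def det_2)
      have X_pt: "mob X w = of_real ((a + b) / 2) + of_real e * w" for w
      proof -
        have "sqrt e * sqrt e = e" using e by simp
        then have "complex_of_real (sqrt e) * complex_of_real (sqrt e) = of_real e"
          by (simp flip: of_real_mult)
        then show ?thesis using e by (simp add: mob_eq X_def field_simps)
      qed
      have hull: "frame_pt (X ** Y) \<in> hyp_convex_hull (limit_set \<Gamma>)" if Y: "det Y = 1" "(norm Y)\<^sup>2 \<le> R" for Y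
      proof -
        let ?w = "frame_pt Y"
        have Im: "Im ?w > 0" using frame_pt_in_H2[OF Y(1)] by (simp add: H2_def)
        have "(cmod ?w)\<^sup>2 \<le> Im ?w * R"
          using norm_frame[OF Y(1)] mult_left_mono[OF Y(2), of "Im ?w"] Im by linarith
        also have "\<dots> \<le> cmod ?w * R" using R abs_Im_le_cmod[of ?w] by (intro mult_right_mono) auto
        finally have "cmod ?w * cmod ?w \<le> cmod ?w * R" by (simp add: power2_eq_square)
        moreover have "cmod ?w > 0" using Im by auto
        ultimately have w: "cmod ?w \<le> R" by simp
        have "\<bar>e * Re ?w\<bar> \<le> e * R" "\<bar>e * Im ?w\<bar> \<le> e * R"
          using w abs_Re_le_cmod[of ?w] abs_Im_le_cmod[of ?w] e(1) by (auto simp: abs_mult)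
        then have bounds: "\<bar>e * Re ?w\<bar> + \<bar>e * Im ?w\<bar> < (b - a) / 2" using e(2) by (simp add: c_def)
        have "frame_pt (X ** Y) = of_real ((a + b) / 2) + of_real e * ?w"
          using Y(1) by (simp add: frame_pt_mult X_pt)
        then have ReIm: "Re (frame_pt (X ** Y)) = (a + b) / 2 + e * Re ?w" "Im (frame_pt (X ** Y)) = e * Im ?w"
          by simp_all
        have "e * Im ?w > 0" using e(1) Im by simp
        with bounds show ?thesis
          by (intro small; simp only: ReIm) argo+
      qed
      have "frame_pt (X ** mat 1) \<in> hyp_convex_hull (limit_set \<Gamma>)"
        by (rule hull) (use R in \<open>simp_all add: norm_mat2_sq\<close>)
      then obtain A where A: "A \<in> \<Union>\<Gamma>" "norm (A ** X) < r" using r[OF dX] by auto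
      \<comment> \<open>With this choice \<open>X ** Y\<close> is \<open>adj2 A ** Z\<close>, so a
        translate of the arbitrary frame \<open>Z\<close> has its base point in the hull.\<close>
      define Y where "Y = adj2 (A ** X) ** Z"
      have dAX: "det (A ** X) = 1" using det_G[OF A(1)] dX by (simp add: det_mul)
      have dY: "det Y = 1" using dAX Z by (simp add: Y_def det_mul)
      have "norm Y \<le> norm (A ** X) * norm Z"
        unfolding Y_def using norm_mat2_mult_le[of "adj2 (A ** X)" Z] by simp
      also have "\<dots> \<le> \<bar>r\<bar> * norm Z" using A(2) by (intro mult_right_mono) auto
      finally have "(norm Y)\<^sup>2 \<le> (\<bar>r\<bar> * norm Z)\<^sup>2" by (intro power_mono) auto
      then have "(norm Y)\<^sup>2 \<le> R" unfolding R_def by linarith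
      then have "frame_pt (X ** Y) \<in> hyp_convex_hull (limit_set \<Gamma>)" using hull dY by blast
      moreover have "det (X ** Y) = 1" using dX dY by (simp add: det_mul)
      ultimately obtain B where B: "B \<in> \<Union>\<Gamma>" "norm (B ** (X ** Y)) < r" using r by blast
      have "X ** Y = adj2 A ** Z"
        using adj2_right(2)[OF dX] by (simp add: Y_def adj2_mult matrix_mul_assoc[symmetric])
      then have "norm ((B ** adj2 A) ** Z) < r" using B(2) by (simp add: matrix_mul_assoc)
      then show ?thesis using B(1) A(1) mult_G adj2_G by blast
    qed
    then show False using compact_quotient_surface_frames[OF sub] nc by blast
  qed
  then show thesis using that by blast
qed

section \<open>Discrete groups\<close>

locale discrete_SL2_group = SL2_group +
  assumes finite_ball: "finite {A \<in> G. norm A \<le> C}"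

lemma discrete_SL2_group_Union:
  assumes sub: "subgroup \<Gamma> PSL2" and disc: "discrete_in_PSL2 \<Gamma>"
  shows "discrete_SL2_group (\<Union>\<Gamma>)"
proof -
  interpret SL2_group "\<Union>\<Gamma>" by (rule SL2_group_Union[OF sub])
  define e where "e = {mat 1 :: real^2^2, - mat 1}"
  have "e \<in> \<Gamma>" using one_G unfolding mem_Union_PSL2_iff[OF sub] e_def .
  then have "openin (subtopology PSL2_topology \<Gamma>) {e}"
    using disc by (simp add: discrete_in_PSL2_def)
  then obtain U where U: "openin PSL2_topology U" "{e} = U \<inter> \<Gamma>"
    by (auto simp: openin_subtopology)
  let ?W = "{A \<in> carrier SL2. {A, - A} \<in> U}"
  have "openin (top_of_set (carrier SL2)) ?W"
    using U(1) by (simp add: PSL2_topology_def openin_quotient_topology coset_SL2)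
  moreover have "mat 1 \<in> ?W" using U(2) by (auto simp: SL2_def e_def)
  ultimately obtain \<delta> where \<delta>: "\<delta> > 0" "ball (mat 1) \<delta> \<inter> carrier SL2 \<subseteq> ?W"
    by (meson openin_contains_ball)
  \<comment> \<open>The cap at 1 excludes \<open>- mat 1\<close>, which has distance
    \<open>sqrt 8\<close> from the identity.\<close>
  define \<epsilon> where "\<epsilon> = min \<delta> 1"
  have \<epsilon>: "\<epsilon> > 0" using \<delta>(1) by (simp add: \<epsilon>_def)
  have near_one: "A = mat 1" if A: "A \<in> \<Union>\<Gamma>" "norm (mat 1 - A) < \<epsilon>" for A
  proof -
    have "A \<in> ball (mat 1) \<delta> \<inter> carrier SL2"
      using A det_G by (simp add: \<epsilon>_def dist_norm SL2_def)
    then have "{A, - A} \<in> U" using \<delta>(2) by blast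
    moreover have "{A, - A} \<in> \<Gamma>" using A(1) unfolding mem_Union_PSL2_iff[OF sub] .
    ultimately have "{A, - A} \<in> {e}" unfolding U(2) by (rule IntI)
    then have "{A, - A} = e" by (rule singletonD)
    then have "A \<in> e" by blast
    then have "A = mat 1 \<or> A = - mat 1" by (simp add: e_def)
    moreover have "A \<noteq> - mat 1"
    proof
      assume "A = - mat 1"
      then have "(norm (mat 1 - A))\<^sup>2 = 8" by (simp add: norm_mat2_sq)
      moreover have "norm (mat 1 - A) \<le> 1" using A(2) by (simp add: \<epsilon>_def)
      then have "(norm (mat 1 - A))\<^sup>2 \<le> 1\<^sup>2" by (intro power_mono) auto
      ultimately show False by simp
    qed
    ultimately show ?thesis by blast
  qed
  show ?thesis
  proof
    fix C
    let ?S = "{A \<in> \<Union>\<Gamma>. norm A \<le> C}"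
    define K where "K = max C 1"
    have "A = B" if AB: "A \<in> ?S" "B \<in> ?S" "dist A B < \<epsilon> / K" for A B
    proof -
      have dA: "det A = 1" using AB(1) det_G by blast
      have K: "norm A \<le> K" "K > 0" using AB(1) by (auto simp: K_def)
      have "mat 1 - adj2 A ** B = adj2 A ** (A - B)"
        unfolding adj2_left(1)[OF dA, symmetric] by (simp add: mat2_simps algebra_simps)
      then have "norm (mat 1 - adj2 A ** B) \<le> norm A * norm (A - B)"
        using norm_mat2_mult_le[of "adj2 A" "A - B"] by simp
      also have "\<dots> \<le> K * norm (A - B)" using K by (intro mult_right_mono) auto
      also have "\<dots> < \<epsilon>" using AB(3) K by (simp add: dist_norm field_simps)
      finally have "adj2 A ** B = mat 1"
        using near_one mult_G adj2_G AB(1,2) by blast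
      then have "A ** (adj2 A ** B) = A ** mat 1" by simp
      then show "A = B" using adj2_right(2)[OF dA] by simp
    qed
    moreover have "\<epsilon> / K > 0" using \<epsilon> by (simp add: K_def)
    ultimately have "uniform_discrete ?S" unfolding uniform_discrete_def by blast
    moreover have "bounded ?S" by (rule boundedI[of _ C]) auto
    ultimately show "finite ?S" using uniform_discrete_finite_iff by blast
  qed
qed

text \<open>In the Cartan decomposition the second basis vector, turned back by
  \<open>rot (- y)\<close>, is scaled by \<open>exp (- t / 2)\<close>.\<close>

lemma ex_contracted_unit:
  fixes A :: "real^2^2"
  assumes "det A = 1"
  obtains p where "norm p = 1" "norm (A *v p) \<le> 1"
proof -
  obtain x y t where t: "t \<ge> 0" and A: "A = rot x ** flow t ** rot y"
    using cartan_decomposition[OF assms] .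
  have nr: "norm (rot z *v v) = norm v" for z v
    by (simp add: norm_eq_sqrt_inner inner_rot)
  have n1: "norm (vec2 0 1) = 1" by (simp add: norm_vec_def L2_set_def sum_2)
  define p where "p = rot (- y) *v vec2 0 1"
  have "rot y *v p = vec2 0 1"
    unfolding p_def adj2_rot[symmetric] by (rule adj2_right(3)) simp
  then have "A *v p = rot x *v (flow t *v vec2 0 1)"
    by (simp add: A matrix_vector_mul_assoc[symmetric])
  also have "flow t *v vec2 0 1 = exp (- t / 2) *\<^sub>R vec2 0 1"
    by (simp add: flow_def mat2_simps)
  finally have "norm (A *v p) = exp (- t / 2)" by (simp add: nr n1)
  moreover have "norm p = 1" by (simp add: p_def nr n1)
  ultimately show thesis using t by (intro that) auto
qed

context discrete_SL2_group
begin

text \<open>Elements of unbounded norm have contracted unit vectors, and any accumulation point of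
  these works, because replacing a vector by a nearby one changes its image by at most
  \<open>norm A\<close> times their distance.\<close>

lemma lim_dirs_nonempty:
  assumes "infinite G"
  shows "lim_dirs G \<noteq> {}"
proof -
  have "\<exists>A\<in>G. norm A > C" for C
  proof (rule ccontr)
    assume "\<not> ?thesis"
    then have "G = {A \<in> G. norm A \<le> C}" by force
    then show False using finite_ball assms by metis
  qed
  then have "\<exists>A. A \<in> G \<and> real k < norm A" for k by blast
  then obtain A where A: "\<And>k::nat. A k \<in> G" "\<And>k. norm (A k) > real k" by metis
  have "\<exists>p. norm p = 1 \<and> norm (A k *v p) \<le> 1" for k
    using ex_contracted_unit[OF det_G[OF A(1)]] by metis
  then obtain p where p: "\<And>k. norm (p k) = 1" "\<And>k. norm (A k *v p k) \<le> 1" by metis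
  have "bounded (range p)" by (rule boundedI[of _ 1]) (auto simp: p(1))
  then obtain q r where r: "strict_mono r" "(p \<circ> r) \<longlonglongrightarrow> q"
    using bounded_imp_convergent_subsequence by blast
  then have "(\<lambda>k. norm ((p \<circ> r) k)) \<longlonglongrightarrow> norm q" by (intro tendsto_norm)
  then have q: "norm q = 1" by (simp add: p(1) LIMSEQ_const_iff)
  have "\<exists>B\<in>G. norm (B *v q) < \<epsilon> * norm B" if \<epsilon>: "\<epsilon> > 0" for \<epsilon>
  proof -
    have "\<forall>\<^sub>F k in sequentially. dist ((p \<circ> r) k) q < \<epsilon> / 2"
      by (rule tendstoD[OF r(2)]) (use \<epsilon> in simp)
    moreover have "\<forall>\<^sub>F k in sequentially. k \<ge> nat \<lceil>2 / \<epsilon>\<rceil>" by (rule eventually_ge_at_top)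
    ultimately obtain k where k: "dist (p (r k)) q < \<epsilon> / 2" "k \<ge> nat \<lceil>2 / \<epsilon>\<rceil>"
      using eventually_happens[OF eventually_conj] by force
    let ?B = "A (r k)"
    have "2 / \<epsilon> \<le> real (r k)" using k(2) seq_suble[OF r(1), of k] by linarith
    then have "2 / \<epsilon> < norm ?B" using A(2)[of "r k"] by linarith
    then have 1: "1 < \<epsilon> / 2 * norm ?B" using \<epsilon> by (simp add: field_simps)
    have "?B *v q = ?B *v p (r k) + ?B *v (q - p (r k))"
      by (simp add: matrix_vector_mult_diff_distrib)
    then have 2: "norm (?B *v q) \<le> 1 + norm ?B * norm (q - p (r k))"
      using norm_triangle_le[of "?B *v p (r k)" "?B *v (q - p (r k))"] p(2)[of "r k"]
        norm_mat2_vec_le[of ?B "q - p (r k)"] by (metis add_mono)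
    have "norm ?B * norm (q - p (r k)) \<le> norm ?B * (\<epsilon> / 2)"
      using k(1) by (intro mult_left_mono) (auto simp: dist_norm norm_minus_commute)
    then have "norm (?B *v q) < \<epsilon> * norm ?B" using 1 2 by (simp add: mult.commute)
    then show ?thesis using A(1) by blast
  qed
  then have "q \<in> lim_dirs G" using q by (auto simp: lim_dirs_def)
  then show ?thesis by blast
qed

end

section \<open>Local finiteness of the translates of a geodesic\<close>

text \<open>For independent \<open>u\<close> and \<open>v\<close>, the quotient of
  \<open>\<bar>u \<bullet> v\<bar>\<close> by \<open>\<bar>wedge u v\<bar>\<close> is the hyperbolic
  sine of the distance from \<open>i\<close> to the geodesic joining the ideal points
  \<open>bd u\<close> and \<open>bd v\<close>. If \<open>i\<close> and its image under the inverse
  of \<open>M\<close> are not strictly on the same side, this distance is bounded in terms of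
  \<open>M\<close>.\<close>

lemma inner_opposite_signs_bound:
  fixes M :: "real^2^2"
  assumes "det M = 1" "(u \<bullet> v) * ((M *v u) \<bullet> (M *v v)) \<le> 0"
  shows "\<bar>u \<bullet> v\<bar> \<le> (norm M)\<^sup>2 * \<bar>wedge u v\<bar>"
proof (cases "u \<bullet> v = 0")
  case False
  define w where "w = vec2 (- u$2) (u$1)"
  have u: "u \<noteq> 0" using False by auto
  have "(norm w)\<^sup>2 = (norm u)\<^sup>2" by (simp add: norm_vec2_sq w_def)
  then have nw: "norm w = norm u" by simp
  \<comment> \<open>Expansion of \<open>v\<close> in the orthogonal basis \<open>u\<close>,
    \<open>w\<close>, where \<open>w\<close> is \<open>u\<close> turned by a right angle.\<close>
  have "(norm u)\<^sup>2 * ((M *v u) \<bullet> (M *v v))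
      = (u \<bullet> v) * (norm (M *v u))\<^sup>2 + wedge u v * ((M *v u) \<bullet> (M *v w))"
    unfolding norm_vec2_sq inner_2 mat2_vec_nth w_def wedge_def vec2_nth by algebra
  then have "(u \<bullet> v) * ((norm u)\<^sup>2 * ((M *v u) \<bullet> (M *v v)))
      = (u \<bullet> v) * ((u \<bullet> v) * (norm (M *v u))\<^sup>2 + wedge u v * ((M *v u) \<bullet> (M *v w)))" by simp
  moreover have "(u \<bullet> v) * ((norm u)\<^sup>2 * ((M *v u) \<bullet> (M *v v))) \<le> 0"
    using mult_left_mono[OF assms(2), of "(norm u)\<^sup>2"] by (simp add: mult_ac)
  ultimately have "(u \<bullet> v)\<^sup>2 * (norm (M *v u))\<^sup>2 \<le> - ((u \<bullet> v) * wedge u v * ((M *v u) \<bullet> (M *v w)))"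
    by (simp add: power2_eq_square algebra_simps del: power2_norm_eq_inner)
  also have "\<dots> \<le> \<bar>u \<bullet> v\<bar> * \<bar>wedge u v\<bar> * \<bar>(M *v u) \<bullet> (M *v w)\<bar>"
    by (metis abs_ge_minus_self abs_mult)
  also have "\<dots> \<le> \<bar>u \<bullet> v\<bar> * \<bar>wedge u v\<bar> * (norm (M *v u) * (norm M * norm u))"
  proof (intro mult_left_mono)
    have "\<bar>(M *v u) \<bullet> (M *v w)\<bar> \<le> norm (M *v u) * norm (M *v w)" by (rule Cauchy_Schwarz_ineq2)
    also have "\<dots> \<le> norm (M *v u) * (norm M * norm u)"
      using norm_mat2_vec_le[of M w] nw by (intro mult_left_mono) auto
    finally show "\<bar>(M *v u) \<bullet> (M *v w)\<bar> \<le> norm (M *v u) * (norm M * norm u)" .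
  qed simp
  also have "\<dots> \<le> \<bar>u \<bullet> v\<bar> * \<bar>wedge u v\<bar> * (norm (M *v u) * (norm M * (norm M * norm (M *v u))))"
    using norm_le_SL2(1)[OF assms(1), of u] by (intro mult_left_mono) auto
  finally have "(\<bar>u \<bullet> v\<bar> * (norm (M *v u))\<^sup>2) * \<bar>u \<bullet> v\<bar>
      \<le> (\<bar>u \<bullet> v\<bar> * (norm (M *v u))\<^sup>2) * ((norm M)\<^sup>2 * \<bar>wedge u v\<bar>)"
    by (simp add: power2_eq_square mult_ac)
  moreover have "M *v u \<noteq> 0" using adj2_left(3)[OF assms(1), of u] u by auto
  then have "\<bar>u \<bullet> v\<bar> * (norm (M *v u))\<^sup>2 > 0" using False by simp
  ultimately show ?thesis by (simp only: mult_le_cancel_left_pos)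
qed simp

text \<open>The geodesic with ideal endpoints \<open>A a\<close> and \<open>A b\<close> separates the base points of the
  frames \<open>Y\<close> and \<open>Z\<close> iff the value for \<open>Y\<close> differs from the value for \<open>Z\<close>.\<close>

definition side :: "real^2 \<Rightarrow> real^2 \<Rightarrow> real^2^2 \<Rightarrow> real^2^2 \<Rightarrow> real" where
  "side a b Y A = of_bool (((adj2 Y ** A) *v a) \<bullet> ((adj2 Y ** A) *v b) < 0)"

text \<open>Separation bounds the inner product of the translated endpoints, and the determinant
  fixes their area; by Lagrange's identity the product of their lengths is bounded. Outside the
  limit set each length is at least a constant times \<open>norm A\<close>, so \<open>A\<close> lies
  in a finite ball.\<close>

lemma (in discrete_SL2_group) finite_side_change:
  assumes a: "a \<noteq> 0" "a \<notin> lim_dirs G" and b: "b \<noteq> 0" "b \<notin> lim_dirs G"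
    and Y: "det Y = 1" and Z: "det Z = 1"
  shows "finite {A \<in> G. side a b Y A \<noteq> side a b Z A}"
proof -
  obtain c where c: "c > 0" "\<And>A. A \<in> G \<Longrightarrow> c * norm A \<le> norm (A *v a)"
    using a unfolding lim_dirs_def by (auto simp: not_less)
  obtain d where d: "d > 0" "\<And>A. A \<in> G \<Longrightarrow> d * norm A \<le> norm (A *v b)"
    using b unfolding lim_dirs_def by (auto simp: not_less)
  define M where "M = adj2 Z ** Y"
  have dM: "det M = 1" using Y Z by (simp add: M_def det_mul)
  have Y1: "norm Y > 0" using norm_SL2_ge_1[OF Y] by linarith
  define K where "K = ((norm M)\<^sup>2 + 1) * \<bar>wedge a b\<bar>"
  have "norm A \<le> K * (norm Y)\<^sup>2 / (c * d)" if A: "A \<in> G" "side a b Y A \<noteq> side a b Z A" for A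
  proof -
    define u v where "u = (adj2 Y ** A) *v a" and "v = (adj2 Y ** A) *v b"
    have M_eq: "M *v ((adj2 Y ** A) *v p) = (adj2 Z ** A) *v p" for p
      unfolding M_def matrix_vector_mul_assoc matrix_mul_assoc[symmetric] adj2_right(2)[OF Y] ..
    have dA: "det (adj2 Y ** A) = 1" using Y det_G[OF A(1)] by (simp add: det_mul)
    have w: "wedge u v = wedge a b" by (simp add: u_def v_def wedge_mult dA)
    have "(u \<bullet> v < 0) \<noteq> ((M *v u) \<bullet> (M *v v) < 0)"
      using A(2) by (auto simp: side_def u_def v_def M_eq)
    then have "(u \<bullet> v) * ((M *v u) \<bullet> (M *v v)) \<le> 0"
      by (auto simp: mult_le_0_iff)
    then have "\<bar>u \<bullet> v\<bar> \<le> (norm M)\<^sup>2 * \<bar>wedge a b\<bar>"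
      using inner_opposite_signs_bound[OF dM] w by metis
    then have K: "\<bar>u \<bullet> v\<bar> + \<bar>wedge u v\<bar> \<le> K" unfolding K_def w by (simp add: algebra_simps)
    have "(norm u * norm v)\<^sup>2 = \<bar>u \<bullet> v\<bar>\<^sup>2 + \<bar>wedge u v\<bar>\<^sup>2"
      using inner_sq_wedge_sq[of u v] by (simp add: power_mult_distrib)
    also have "\<dots> \<le> (\<bar>u \<bullet> v\<bar> + \<bar>wedge u v\<bar>)\<^sup>2" by (simp add: power2_sum)
    finally have "norm u * norm v \<le> \<bar>u \<bullet> v\<bar> + \<bar>wedge u v\<bar>" by (rule power2_le_imp_le) simp
    then have uv: "norm u * norm v \<le> K" using K by linarith
    have low: "norm (A *v p) \<le> norm Y * norm ((adj2 Y ** A) *v p)" for p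
      using norm_le_SL2(1)[of "adj2 Y" "A *v p"] Y by (simp add: matrix_vector_mul_assoc)
    have "c * norm A * (d * norm A) \<le> norm (A *v a) * norm (A *v b)"
      using c d A(1) by (intro mult_mono) auto
    also have "\<dots> \<le> (norm Y * norm u) * (norm Y * norm v)"
      unfolding u_def v_def by (intro mult_mono low) auto
    also have "\<dots> = (norm u * norm v) * (norm Y)\<^sup>2" by (simp add: power2_eq_square)
    also have "\<dots> \<le> K * (norm Y)\<^sup>2" using uv by (intro mult_right_mono) auto
    finally have "c * d * (norm A * norm A) \<le> K * (norm Y)\<^sup>2" by (simp add: mult_ac)
    moreover have "c * d * (norm A * 1) \<le> c * d * (norm A * norm A)"
      using c(1) d(1) norm_SL2_ge_1[OF det_G[OF A(1)]] by (intro mult_left_mono) auto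
    ultimately have "norm A * (c * d) \<le> K * (norm Y)\<^sup>2" by (simp add: mult_ac)
    then show ?thesis using c(1) d(1) by (simp add: pos_le_divide_eq)
  qed
  then show ?thesis by (intro finite_subset[OF _ finite_ball]) auto
qed

section \<open>Symmetric powers\<close>

lemma sym_power_sum:
  "sym_power m A (\<lambda>i. \<Sum>s\<in>S. c s * v s i) = (\<lambda>j. \<Sum>s\<in>S. c s * sym_power m A (v s) j)"
proof
  fix j
  have "sym_power m A (\<lambda>i. \<Sum>s\<in>S. c s * v s i) j = (\<Sum>k\<le>m. \<Sum>s\<in>S. c s *
      (poly.coeff ([:A$1$1, A$2$1:] ^ (m - k) * [:A$1$2, A$2$2:] ^ k) j * v s k))"
    by (simp add: sym_power_def sum_distrib_left mult.left_commute)
  also have "\<dots> = (\<Sum>s\<in>S. c s * sym_power m A (v s) j)"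
    by (subst sum.swap) (simp add: sym_power_def sum_distrib_left)
  finally show "sym_power m A (\<lambda>i. \<Sum>s\<in>S. c s * v s i) j = (\<Sum>s\<in>S. c s * sym_power m A (v s) j)" .
qed

lemma sym_power_add: "sym_power m A (\<lambda>i. x i + y i) = (\<lambda>j. sym_power m A x j + sym_power m A y j)"
  by (simp add: sym_power_def distrib_left sum.distrib)

lemma sym_power_scale: "sym_power m A (\<lambda>i. c * x i) = (\<lambda>j. c * sym_power m A x j)"
  by (simp add: sym_power_def sum_distrib_left mult_ac)

lemma coeff_mult_dominated:
  fixes p q P Q :: "real poly"
  assumes "\<And>i. \<bar>poly.coeff p i\<bar> \<le> poly.coeff P i" "\<And>i. \<bar>poly.coeff q i\<bar> \<le> poly.coeff Q i"
  shows "\<bar>poly.coeff (p * q) i\<bar> \<le> poly.coeff (P * Q) i"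
proof -
  have "\<bar>poly.coeff (p * q) i\<bar> \<le> (\<Sum>j\<le>i. \<bar>poly.coeff p j\<bar> * \<bar>poly.coeff q (i - j)\<bar>)"
    unfolding coeff_mult by (rule order_trans[OF sum_abs]) (simp add: abs_mult)
  also have "\<dots> \<le> (\<Sum>j\<le>i. poly.coeff P j * poly.coeff Q (i - j))"
  proof (intro sum_mono mult_mono assms)
    show "0 \<le> poly.coeff P j" for j using assms(1)[of j] by linarith
  qed simp
  finally show ?thesis by (simp add: coeff_mult)
qed

lemma coeff_power_dominated:
  fixes p P :: "real poly"
  assumes "\<And>i. \<bar>poly.coeff p i\<bar> \<le> poly.coeff P i"
  shows "\<bar>poly.coeff (p ^ k) i\<bar> \<le> poly.coeff (P ^ k) i"
proof (induction k arbitrary: i)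
  case (Suc k)
  then show ?case using coeff_mult_dominated[OF assms, of "p ^ k" "P ^ k"] by simp
qed (simp add: coeff_1)

text \<open>Majorants: the coefficients of both linear factors are dominated by those of
  \<open>P\<close>, hence all matrix entries by coefficients of \<open>P ^ m\<close>.\<close>

lemma sym_power_bound:
  obtains K where "K \<ge> 0"
    "\<And>A x j. norm A \<le> R \<Longrightarrow> \<bar>sym_power m A x j\<bar> \<le> K * (\<Sum>k\<le>m. \<bar>x k\<bar>)"
proof
  define P where "P = [:\<bar>R\<bar>, \<bar>R\<bar>:]"
  define K where "K = (\<Sum>j\<le>m. \<bar>poly.coeff (P ^ m) j\<bar>)"
  show K: "K \<ge> 0" by (simp add: K_def sum_nonneg)
  fix A :: "real^2^2" and x :: "nat \<Rightarrow> real" and j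
  assume A: "norm A \<le> R"
  have nth: "\<bar>A$i$k\<bar> \<le> \<bar>R\<bar>" for i k
    using abs_nth_le_norm[of A i k] A by linarith
  have dom: "\<bar>poly.coeff [:A$1$i, A$2$i:] j\<bar> \<le> poly.coeff P j" for i j
    using nth by (simp add: P_def coeff_pCons split: nat.split)
  show "\<bar>sym_power m A x j\<bar> \<le> K * (\<Sum>k\<le>m. \<bar>x k\<bar>)"
  proof (cases "j \<le> m")
    case True
    have "\<bar>poly.coeff ([:A$1$1, A$2$1:] ^ (m - k) * [:A$1$2, A$2$2:] ^ k) j\<bar> \<le> K" if "k \<le> m" for k
    proof -
      have "\<bar>poly.coeff ([:A$1$1, A$2$1:] ^ (m - k) * [:A$1$2, A$2$2:] ^ k) j\<bar>
          \<le> poly.coeff (P ^ (m - k) * P ^ k) j"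
        by (intro coeff_mult_dominated coeff_power_dominated dom)
      also have "P ^ (m - k) * P ^ k = P ^ m" using that by (simp flip: power_add)
      also have "poly.coeff (P ^ m) j \<le> \<bar>poly.coeff (P ^ m) j\<bar>" by simp
      also have "\<dots> \<le> K" unfolding K_def using True by (intro member_le_sum) auto
      finally show ?thesis .
    qed
    then have "\<bar>sym_power m A x j\<bar> \<le> (\<Sum>k\<le>m. K * \<bar>x k\<bar>)"
      unfolding sym_power_def
      by (intro order_trans[OF sum_abs] sum_mono) (simp add: abs_mult mult_right_mono)
    then show ?thesis by (simp add: sum_distrib_left)
  next
    case False
    then show ?thesis using K by (simp add: sym_power_zero sum_nonneg)
  qed
qed

text \<open>Pairing with the neutral vector of the geodesic of the frame \<open>B\<close>.\<close>

definition middle_coeff :: "nat \<Rightarrow> real^2^2 \<Rightarrow> (nat \<Rightarrow> real) \<Rightarrow> real" where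
  "middle_coeff n B x = sym_power (4 * n - 2) (adj2 B) x (2 * n - 1)"

lemma sym_power_flow:
  assumes "k \<le> m"
  shows "sym_power m (flow t) x k = exp (t / 2) ^ (m - k) * exp (- t / 2) ^ k * x k"
proof -
  have 1: "[:0, c:] ^ i = monom (c ^ i) i" for c :: real and i
  proof -
    have "[:0, c:] = monom c 1" by (simp add: monom_altdef)
    then show ?thesis by (simp add: monom_power)
  qed
  have "poly.coeff ([:flow t$1$1, flow t$2$1:] ^ (m - i) * [:flow t$1$2, flow t$2$2:] ^ i) k
      = (if i = k then exp (t / 2) ^ (m - k) * exp (- t / 2) ^ k else 0)" for i
    by (simp add: flow_def 1 poly_const_pow)
  then have "sym_power m (flow t) x k
      = (\<Sum>i\<le>m. if i = k then exp (t / 2) ^ (m - k) * exp (- t / 2) ^ k * x i else 0)"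
    unfolding sym_power_def by (intro sum.cong refl) auto
  then show ?thesis using assms by simp
qed

text \<open>The middle basis vector has weight zero under the diagonal flow, so the functional
  depends on the geodesic of the frame and not on the position along it.\<close>

lemma middle_coeff_flow:
  assumes "n \<ge> 1"
  shows "middle_coeff n (B ** flow t) x = middle_coeff n B x"
proof -
  have m: "4 * n - 2 - (2 * n - 1) = 2 * n - 1" "2 * n - 1 \<le> 4 * n - 2" using assms by auto
  have "exp (- (t / 2)) ^ k * exp (t / 2) ^ k = 1" for t :: real and k
    by (simp flip: power_mult_distrib exp_add)
  then show ?thesis
    unfolding middle_coeff_def adj2_mult adj2_flow sym_power_mult sym_power_flow[OF m(2)] m(1) by simp
qed

lemma middle_coeff_sym_power:
  "middle_coeff n B (sym_power (4 * n - 2) A x) = middle_coeff n (adj2 A ** B) x"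
  by (simp add: middle_coeff_def adj2_mult sym_power_mult)

lemma middle_coeff_pure_power:
  assumes "n \<ge> 1"
  shows "middle_coeff n B (pure_power (4 * n - 2) (p$1) (p$2))
    = real ((4 * n - 2) choose (2 * n - 1)) * ((adj2 B *v p)$1 * (adj2 B *v p)$2) ^ (2 * n - 1)"
proof -
  have "4 * n - 2 - (2 * n - 1) = 2 * n - 1" using assms by auto
  then show ?thesis
    unfolding middle_coeff_def sym_power_pure_power unfolding pure_power_def
    by (simp add: mat2_vec_nth power_mult_distrib)
qed

lemma middle_coeff_sum:
  "middle_coeff n B (\<lambda>i. \<Sum>s\<in>S. c s * v s i) = (\<Sum>s\<in>S. c s * middle_coeff n B (v s))"
  by (simp add: middle_coeff_def sym_power_sum)

lemma middle_coeff_add: "middle_coeff n B (\<lambda>i. x i + y i) = middle_coeff n B x + middle_coeff n B y"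
  by (simp add: middle_coeff_def sym_power_add)

lemma middle_coeff_scale: "middle_coeff n B (\<lambda>i. c * x i) = c * middle_coeff n B x"
  by (simp add: middle_coeff_def sym_power_scale)

lemma middle_coeff_bound:
  obtains K where "K \<ge> 0"
    "\<And>B x. norm B \<le> R \<Longrightarrow> \<bar>middle_coeff n B x\<bar> \<le> K * (\<Sum>k\<le>4 * n - 2. \<bar>x k\<bar>)"
  unfolding middle_coeff_def using sym_power_bound[of R "4 * n - 2"] by (metis norm_adj2)

section \<open>Cocycles\<close>

text \<open>If the sum of all \<open>h Y A\<close> times \<open>A v\<close> over the group converged, this would be the difference
  of its values at \<open>Z\<close> and \<open>Y\<close>, and the resulting cocycles would be coboundaries.\<close>

definition jump_sum ::
    "nat \<Rightarrow> (real^2^2) set \<Rightarrow> (real^2^2 \<Rightarrow> real^2^2 \<Rightarrow> real) \<Rightarrow> (nat \<Rightarrow> real) \<Rightarrow> real^2^2 \<Rightarrow> real^2^2 \<Rightarrow> nat \<Rightarrow> real" where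
  "jump_sum m G h v Y Z = (\<lambda>j. \<Sum>A\<in>{A \<in> G. h Y A \<noteq> h Z A}. (h Z A - h Y A) * sym_power m A v j)"

lemma jump_sum_superset:
  assumes "finite T" "{A \<in> G. h Y A \<noteq> h Z A} \<subseteq> T" "T \<subseteq> G"
  shows "jump_sum m G h v Y Z = (\<lambda>j. \<Sum>A\<in>T. (h Z A - h Y A) * sym_power m A v j)"
proof
  fix j
  show "jump_sum m G h v Y Z j = (\<Sum>A\<in>T. (h Z A - h Y A) * sym_power m A v j)"
    unfolding jump_sum_def by (rule sum.mono_neutral_left) (use assms in auto)
qed

text \<open>The differences telescope over a common finite index set. Finiteness matters, since a
  sum over an infinite set is 0 by convention.\<close>

lemma jump_sum_add:
  assumes "finite {A \<in> G. h Y A \<noteq> h Z A}" "finite {A \<in> G. h Z A \<noteq> h W A}"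
  shows "jump_sum m G h v Y W = (\<lambda>j. jump_sum m G h v Y Z j + jump_sum m G h v Z W j)"
proof -
  let ?T = "{A \<in> G. h Y A \<noteq> h Z A} \<union> {A \<in> G. h Z A \<noteq> h W A}"
  have T: "finite ?T" "?T \<subseteq> G" using assms by auto
  have *: "jump_sum m G h v X X' = (\<lambda>j. \<Sum>A\<in>?T. (h X' A - h X A) * sym_power m A v j)"
    if "{A \<in> G. h X A \<noteq> h X' A} \<subseteq> ?T" for X X'
    by (rule jump_sum_superset[OF T(1) that T(2)])
  have "{A \<in> G. h Y A \<noteq> h W A} \<subseteq> ?T" "{A \<in> G. h Y A \<noteq> h Z A} \<subseteq> ?T" "{A \<in> G. h Z A \<noteq> h W A} \<subseteq> ?T"
    by auto
  from this[THEN *] show ?thesis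
    by (simp only: sum.distrib[symmetric] distrib_right[symmetric]) simp
qed

lemma jump_sum_zero: "j > m \<Longrightarrow> jump_sum m G h v Y Z j = 0"
  by (simp add: jump_sum_def sym_power_zero)

lemma (in SL2_group) jump_sum_equivariant:
  assumes B: "B \<in> G" and h: "\<And>X A. A \<in> G \<Longrightarrow> h (B ** X) (B ** A) = h X A"
  shows "jump_sum m G h v (B ** Y) (B ** Z) = sym_power m B (jump_sum m G h v Y Z)"
proof
  fix j
  let ?S = "{A \<in> G. h Y A \<noteq> h Z A}"
  have dB: "det B = 1" by (rule det_G[OF B])
  have "jump_sum m G h v (B ** Y) (B ** Z) j
      = (\<Sum>A\<in>?S. (h (B ** Z) (B ** A) - h (B ** Y) (B ** A)) * sym_power m (B ** A) v j)"
    unfolding jump_sum_def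
  proof (rule sum.reindex_bij_witness[of _ "\<lambda>A. B ** A" "\<lambda>A. adj2 B ** A"])
    fix A assume A: "A \<in> {A \<in> G. h (B ** Y) A \<noteq> h (B ** Z) A}"
    then have A': "adj2 B ** A \<in> G" using mult_G adj2_G B by blast
    show "B ** (adj2 B ** A) = A" by (rule adj2_right(2)[OF dB])
    then show "adj2 B ** A \<in> ?S" using A A' h[OF A', of Y] h[OF A', of Z] by simp
    show "(h (B ** Z) (B ** (adj2 B ** A)) - h (B ** Y) (B ** (adj2 B ** A))) * sym_power m (B ** (adj2 B ** A)) v j
        = (h (B ** Z) A - h (B ** Y) A) * sym_power m A v j"
      by (simp add: adj2_right(2)[OF dB])
  next
    fix A assume A: "A \<in> ?S"
    show "adj2 B ** (B ** A) = A" by (rule adj2_left(2)[OF dB])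
    show "B ** A \<in> {A \<in> G. h (B ** Y) A \<noteq> h (B ** Z) A}" using A h mult_G[OF B] by auto
  qed
  also have "\<dots> = (\<Sum>A\<in>?S. (h Z A - h Y A) * sym_power m B (sym_power m A v) j)"
    using h by (intro sum.cong refl) (auto simp: sym_power_mult)
  also have "\<dots> = sym_power m B (jump_sum m G h v Y Z) j"
    unfolding jump_sum_def sym_power_sum ..
  finally show "jump_sum m G h v (B ** Y) (B ** Z) j = sym_power m B (jump_sum m G h v Y Z) j" .
qed

section \<open>Cocycles on \<open>\<Gamma>\<close> from functions on matrices\<close>

lemma in_R_sig_iff: "n \<ge> 1 \<Longrightarrow> x \<in> topspace (R_sig n) \<longleftrightarrow> (\<forall>j>4 * n - 2. x j = 0)"
proof -
  assume "n \<ge> 1"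
  then have "j \<ge> 4 * n - 1 \<longleftrightarrow> j > 4 * n - 2" for j by auto
  then show ?thesis by (simp add: topspace_Euclidean_space)
qed

lemma cocycle_sum:
  assumes "u \<in> cocycles n \<Gamma>" and "subgroup \<Gamma> PSL2" "n \<ge> 1" "A \<in> \<Union>\<Gamma>" "B \<in> \<Union>\<Gamma>"
  shows "u {A ** B, - (A ** B)} = (\<lambda>i. sym_power (4 * n - 2) A (u {B, - B}) i + u {A, - A} i)"
proof -
  interpret SL2_group "\<Union>\<Gamma>" by (rule SL2_group_Union[OF assms(2)])
  have g: "{A, - A} \<in> \<Gamma>" "{B, - B} \<in> \<Gamma>"
    using assms(4,5) unfolding mem_Union_PSL2_iff[OF assms(2)] .
  then have "{A, - A} \<in> carrier PSL2" using subgroup.subset[OF assms(2)] by blast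
  then have "sigma n {A, - A} = sym_power (4 * n - 2) A"
    using assms(3) by (intro sigma_eq) auto
  moreover have "{A, - A} \<otimes>\<^bsub>PSL2\<^esub> {B, - B} = {A ** B, - (A ** B)}"
    using det_G assms(4,5) by (intro PSL2_mult_eq) auto
  moreover have "u ({A, - A} \<otimes>\<^bsub>PSL2\<^esub> {B, - B}) = (\<lambda>i. sigma n {A, - A} (u {B, - B}) i + u {A, - A} i)"
    using assms(1) g by (simp add: cocycles_def)
  ultimately show ?thesis by simp
qed

text \<open>Descent to cosets needs equal values at \<open>A\<close> and \<open>- A\<close>. As
  \<open>- mat 1\<close> acts trivially in even degree and has square one, twice its value is the
  value at the identity, which is zero.\<close>

lemma cocycle_of_matrices:
  assumes sub: "subgroup \<Gamma> PSL2" and n: "n \<ge> 1"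
    and w: "\<And>A B. A \<in> \<Union>\<Gamma> \<Longrightarrow> B \<in> \<Union>\<Gamma> \<Longrightarrow>
      w (A ** B) = (\<lambda>i. sym_power (4 * n - 2) A (w B) i + w A i)"
    and zero: "\<And>A j. j > 4 * n - 2 \<Longrightarrow> w A j = 0"
  obtains u where "u \<in> cocycles n \<Gamma>" "\<And>A. A \<in> \<Union>\<Gamma> \<Longrightarrow> u {A, - A} = w A"
proof
  let ?m = "4 * n - 2"
  interpret SL2_group "\<Union>\<Gamma>" by (rule SL2_group_Union[OF sub])
  define u where "u = (\<lambda>g\<in>\<Gamma>. w (PSL2_rep g))"
  have one: "w (mat 1) = (\<lambda>i. 0)"
  proof -
    have "w (mat 1) = (\<lambda>i. w (mat 1) i + w (mat 1) i)"
      using w[OF one_G one_G] sym_power_one[of ?m "w (mat 1)"] zero by simp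
    then show ?thesis by (simp add: fun_eq_iff)
  qed
  have even: "even ?m" using n by auto
  have m1: "- mat 1 \<in> \<Union>\<Gamma>" by (rule uminus_G[OF one_G])
  have "w (- mat 1) = (\<lambda>i. 0)"
  proof -
    have "w (- mat 1 ** - mat 1) = (\<lambda>i. w (- mat 1) i + w (- mat 1) i)"
      using w[OF m1 m1] sym_power_uminus[OF even, of "mat 1"] sym_power_one[of ?m "w (- mat 1)"] zero
      by simp
    moreover have "- mat 1 ** - mat 1 = (mat 1 :: real^2^2)" by (simp add: mat_neg_mult)
    ultimately show ?thesis using one by (simp add: fun_eq_iff)
  qed
  then have neg: "w (- A) = w A" if A: "A \<in> \<Union>\<Gamma>" for A
    using w[OF m1 A] zero sym_power_uminus[OF even, of "mat 1" "w A"] sym_power_one[of ?m "w A"]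
    by (simp add: mat_neg_mult)
  show u: "u {A, - A} = w A" if A: "A \<in> \<Union>\<Gamma>" for A
  proof -
    have g: "{A, - A} \<in> \<Gamma>" using A unfolding mem_Union_PSL2_iff[OF sub] .
    then have "{A, - A} \<in> carrier PSL2" using subgroup.subset[OF sub] by blast
    then have "PSL2_rep {A, - A} = A \<or> PSL2_rep {A, - A} = - A"
      by (rule PSL2_rep_cases(2)) simp
    then show ?thesis using g neg[OF A] by (auto simp: u_def)
  qed
  have rep: "\<exists>A\<in>\<Union>\<Gamma>. g = {A, - A}" if "g \<in> \<Gamma>" for g
  proof -
    have "g \<in> carrier PSL2" using that subgroup.subset[OF sub] by blast
    then obtain A where g: "g = {A, - A}" unfolding carrier_PSL2 by blast
    then have "A \<in> \<Union>\<Gamma>" using that by (intro UnionI[of g]) simp_all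
    then show ?thesis using g by (rule bexI[rotated])
  qed
  show "u \<in> cocycles n \<Gamma>"
    unfolding cocycles_def
  proof (intro CollectI conjI ballI)
    show "u \<in> \<Gamma> \<rightarrow>\<^sub>E topspace (R_sig n)"
      unfolding u_def using in_R_sig_iff[OF n] zero by (intro PiE_I) auto
    fix g h assume "g \<in> \<Gamma>" "h \<in> \<Gamma>"
    then obtain A B where A: "A \<in> \<Union>\<Gamma>" "g = {A, - A}" and B: "B \<in> \<Union>\<Gamma>" "h = {B, - B}"
      using rep by meson
    have "{A, - A} \<in> carrier PSL2" using \<open>g \<in> \<Gamma>\<close> A(2) subgroup.subset[OF sub] by blast
    then have s: "sigma n g = sym_power ?m A" unfolding A(2) by (intro sigma_eq[OF n]) auto
    have "g \<otimes>\<^bsub>PSL2\<^esub> h = {A ** B, - (A ** B)}"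
      unfolding A(2) B(2) by (rule PSL2_mult_eq[OF det_G[OF A(1)] det_G[OF B(1)]])
    then have "u (g \<otimes>\<^bsub>PSL2\<^esub> h) = w (A ** B)" using u mult_G[OF A(1) B(1)] by simp
    also have "\<dots> = (\<lambda>i. sigma n g (u h) i + u g i)"
      unfolding s using w[OF A(1) B(1)] u[OF A(1)] u[OF B(1)] by (simp only: A(2) B(2))
    finally show "u (g \<otimes>\<^bsub>PSL2\<^esub> h) = (\<lambda>i. sigma n g (u h) i + u g i)" .
  qed
qed

lemma cocycle_scale_in_cocycles:
  assumes u: "u \<in> cocycles n \<Gamma>" and sub: "subgroup \<Gamma> PSL2"
  shows "cocycle_scale \<Gamma> c u \<in> cocycles n \<Gamma>"
  unfolding cocycles_def
proof (intro CollectI conjI ballI)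
  have "u g \<in> topspace (R_sig n)" if "g \<in> \<Gamma>" for g using u that by (auto simp: cocycles_def)
  then show "cocycle_scale \<Gamma> c u \<in> \<Gamma> \<rightarrow>\<^sub>E topspace (R_sig n)"
    unfolding cocycle_scale_def by (intro PiE_I) (auto simp: topspace_Euclidean_space)
  fix g h assume g: "g \<in> \<Gamma>" "h \<in> \<Gamma>"
  then have "g \<otimes>\<^bsub>PSL2\<^esub> h \<in> \<Gamma>" by (rule subgroup.m_closed[OF sub])
  moreover have "u (g \<otimes>\<^bsub>PSL2\<^esub> h) = (\<lambda>i. sigma n g (u h) i + u g i)"
    using u g by (simp add: cocycles_def)
  ultimately show "cocycle_scale \<Gamma> c u (g \<otimes>\<^bsub>PSL2\<^esub> h)
      = (\<lambda>i. sigma n g (cocycle_scale \<Gamma> c u h) i + cocycle_scale \<Gamma> c u g i)"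
    using g by (simp add: cocycle_scale_def sigma_def sym_power_scale distrib_left)
qed

lemma compactin_R_sig_bounded:
  assumes "compactin (R_sig n) C"
  obtains M where "\<And>x k. x \<in> C \<Longrightarrow> k \<le> 4 * n - 2 \<Longrightarrow> \<bar>x k\<bar> \<le> M"
proof -
  have "\<exists>M. \<forall>x\<in>C. \<bar>x k\<bar> \<le> M" for k
  proof -
    have "continuous_map (R_sig n) euclideanreal (\<lambda>x. x k)"
      unfolding Euclidean_space_def
      by (rule continuous_map_from_subtopology) (rule continuous_map_product_projection, simp)
    then have "compactin euclideanreal ((\<lambda>x. x k) ` C)"
      using assms by (rule image_compactin[rotated])
    then have "bounded ((\<lambda>x. x k) ` C)" by (simp add: compact_imp_bounded)
    then show ?thesis by (auto simp: bounded_iff)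
  qed
  then obtain M where M: "\<And>k x. x \<in> C \<Longrightarrow> \<bar>x k\<bar> \<le> M k" by metis
  show thesis
  proof
    fix x k assume x: "x \<in> C" "k \<le> 4 * n - 2"
    have "\<bar>x k\<bar> \<le> M k" by (rule M[OF x(1)])
    also have "\<dots> \<le> (\<Sum>k\<le>4 * n - 2. \<bar>M k\<bar>)"
      using x(2) member_le_sum[of k "{..4 * n - 2}" "\<lambda>k. \<bar>M k\<bar>"] by force
    finally show "\<bar>x k\<bar> \<le> (\<Sum>k\<le>4 * n - 2. \<bar>M k\<bar>)" .
  qed
qed

lemma continuous_map_cocycle_eval:
  assumes "g \<in> \<Gamma>"
  shows "continuous_map (cocycle_space n \<Gamma>) euclideanreal (\<lambda>u. u g k)"
proof -
  have "continuous_map (R_sig n) euclideanreal (\<lambda>x. x k)"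
    unfolding Euclidean_space_def
    by (rule continuous_map_from_subtopology) (rule continuous_map_product_projection, simp)
  moreover have "continuous_map (cocycle_space n \<Gamma>) (R_sig n) (\<lambda>u. u g)"
    unfolding cocycle_space_def
    by (rule continuous_map_from_subtopology) (rule continuous_map_product_projection[OF assms])
  ultimately show ?thesis
    using continuous_map_compose[of _ _ "\<lambda>u. u g" _ "\<lambda>x. x k"] by (simp add: o_def)
qed

section \<open>The neutral pairing along a geodesic\<close>

lemma side_equivariant: "det B = 1 \<Longrightarrow> side a b (B ** Y) (B ** A) = side a b Y A"
  by (simp add: side_def adj2_mult matrix_mul_assoc[symmetric] adj2_left)

lemma side_rot: "side a b (Y ** rot x) A = side a b Y A"
  by (simp add: side_def adj2_mult adj2_rot matrix_mul_assoc[symmetric]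
      matrix_vector_mul_assoc[symmetric] inner_rot)

text \<open>Along a flow line the deciding inner product has the form
  \<open>exp (- t) * P + exp t * Q\<close>. It can change sign only if \<open>P\<close> and
  \<open>Q\<close> have opposite signs, that is, if the flow line separates the ideal endpoints of
  the translated arc.\<close>

lemma side_flow:
  "side a b (B ** flow t) A = of_bool (exp (- t) * (((adj2 B ** A) *v a)$1 * ((adj2 B ** A) *v b)$1)
    + exp t * (((adj2 B ** A) *v a)$2 * ((adj2 B ** A) *v b)$2) < 0)"
proof -
  have "(flow (- t) *v p) \<bullet> (flow (- t) *v q) = exp (- t) * (p$1 * q$1) + exp t * (p$2 * q$2)" for p q
  proof -
    have "exp (- t / 2) * exp (- t / 2) = exp (- t)" "exp (t / 2) * exp (t / 2) = exp t"
      by (simp_all flip: exp_add)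
    moreover have "(flow (- t) *v p) \<bullet> (flow (- t) *v q)
        = (exp (- t / 2) * exp (- t / 2)) * (p$1 * q$1) + (exp (t / 2) * exp (t / 2)) * (p$2 * q$2)"
      by (simp add: inner_2 flow_def mat2_vec_nth)
    ultimately show ?thesis by simp
  qed
  then show ?thesis
    by (simp add: side_def adj2_mult adj2_flow matrix_mul_assoc[symmetric] matrix_vector_mul_assoc[symmetric])
qed

text \<open>The two summands of \<open>f\<close> have opposite signs at a crossing, so the endpoints \<open>p\<close> and \<open>q\<close> of the
  arc lie on different sides of the geodesic; the orientation \<open>wedge p q < 0\<close> decides which.\<close>

lemma crossing_sign:
  fixes p q :: "real^2"
  assumes "wedge p q < 0" "s \<le> t"
  defines "f \<equiv> \<lambda>t. exp (- t) * (p$1 * q$1) + exp t * (p$2 * q$2)"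
  shows "(of_bool (f t < 0) - of_bool (f s < 0)) * (p$1 * p$2) \<ge> (0 :: real)"
proof -
  define P Q where "P = p$1 * q$1" and "Q = p$2 * q$2"
  have f: "f t = exp (- t) * P + exp t * Q" for t by (simp add: f_def P_def Q_def)
  have e: "exp s \<le> exp t" "exp (- t) \<le> exp (- s)" using assms(2) by simp_all
  \<comment> \<open>When \<open>P\<close> and \<open>Q\<close> have opposite signs, the right side
    has the sign of \<open>Q\<close>, which in turn is the direction of the crossing.\<close>
  have pp: "(p$1 * p$2) * wedge p q = (p$1)\<^sup>2 * Q - (p$2)\<^sup>2 * P"
    by (simp add: wedge_def P_def Q_def power2_eq_square algebra_simps)
  show ?thesis
  proof (cases "f t < 0"; cases "f s < 0")
    assume t: "f t < 0" and s: "\<not> f s < 0"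
    have Q: "Q < 0"
    proof (rule ccontr)
      assume "\<not> Q < 0"
      then have 1: "exp s * Q \<le> exp t * Q" using e by (intro mult_right_mono) auto
      have "exp t * Q \<ge> 0" using \<open>\<not> Q < 0\<close> by simp
      then have "exp (- t) * P < 0" using t f[of t] by linarith
      then have "P < 0" by (simp add: mult_less_0_iff)
      then have "exp (- s) * P \<le> exp (- t) * P" using e by (intro mult_right_mono_neg) auto
      then show False using 1 s t f[of s] f[of t] by linarith
    qed
    then have "exp s * Q < 0" by (simp add: mult_less_0_iff)
    then have "exp (- s) * P > 0" using s f[of s] by linarith
    then have "P > 0" by (simp add: zero_less_mult_iff)
    then have "(p$1)\<^sup>2 * Q \<le> 0" "(p$2)\<^sup>2 * P \<ge> 0" using Q by (simp_all add: mult_nonneg_nonpos)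
    then have "(p$1 * p$2) * wedge p q \<le> 0" using pp by linarith
    then have "p$1 * p$2 \<ge> 0" using assms(1) by (simp add: mult_le_0_iff)
    then show ?thesis using s t by simp
  next
    assume t: "\<not> f t < 0" and s: "f s < 0"
    have Q: "Q > 0"
    proof (rule ccontr)
      assume "\<not> Q > 0"
      then have 1: "exp t * Q \<le> exp s * Q" using e by (intro mult_right_mono_neg) auto
      have "exp t * Q \<le> 0" using \<open>\<not> Q > 0\<close> by (simp add: mult_nonneg_nonpos)
      then have "exp (- t) * P \<ge> 0" using t f[of t] by linarith
      then have "P \<ge> 0" by (simp add: zero_le_mult_iff)
      then have "exp (- t) * P \<le> exp (- s) * P" using e by (intro mult_right_mono) auto
      then show False using 1 s t f[of s] f[of t] by linarith
    qed
    then have "exp s * Q > 0" by simp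
    then have "exp (- s) * P < 0" using s f[of s] by linarith
    then have "P < 0" by (simp add: mult_less_0_iff)
    then have "(p$1)\<^sup>2 * Q \<ge> 0" "(p$2)\<^sup>2 * P \<le> 0" using Q by (simp_all add: mult_nonneg_nonpos)
    then have "(p$1 * p$2) * wedge p q \<ge> 0" using pp by linarith
    then have "p$1 * p$2 \<le> 0" using assms(1) by (simp add: zero_le_mult_iff)
    then show ?thesis using s t by simp
  qed simp_all
qed

lemma odd_power_mult_nonneg:
  fixes d x :: real
  assumes "d * x \<ge> 0" "odd k"
  shows "d * x ^ k \<ge> 0"
  using assms by (auto simp: zero_le_mult_iff zero_le_power_eq power_le_zero_eq)

context SL2_group
begin

definition arc_pairs :: "((real^2) \<times> (real^2)) set" where
  "arc_pairs = {(a, b). a \<noteq> 0 \<and> a \<notin> lim_dirs G \<and> b \<noteq> 0 \<and> b \<notin> lim_dirs G \<and> wedge a b < 0}"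

text \<open>The deformation cocycle is obtained by placing a strip along every translate of finitely many
  arcs; the translates may cross each other.\<close>

definition strip_sum :: "nat \<Rightarrow> ((real^2) \<times> (real^2)) set \<Rightarrow> real^2^2 \<Rightarrow> real^2^2 \<Rightarrow> nat \<Rightarrow> real" where
  "strip_sum n I Y Z = (\<lambda>j. \<Sum>s\<in>I.
     jump_sum (4 * n - 2) G (side (fst s) (snd s)) (pure_power (4 * n - 2) (fst s$1) (fst s$2)) Y Z j)"

end

context discrete_SL2_group
begin

lemma finite_side_change_arc:
  assumes "s \<in> arc_pairs" "det Y = 1" "det Z = 1"
  shows "finite {A \<in> G. side (fst s) (snd s) Y A \<noteq> side (fst s) (snd s) Z A}"
  using assms by (intro finite_side_change) (auto simp: arc_pairs_def)

lemma strip_sum_add: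
  assumes "I \<subseteq> arc_pairs" "det Y = 1" "det Z = 1" "det W = 1"
  shows "strip_sum n I Y W = (\<lambda>j. strip_sum n I Y Z j + strip_sum n I Z W j)"
proof -
  have "jump_sum m G (side (fst s) (snd s)) v Y W =
      (\<lambda>j. jump_sum m G (side (fst s) (snd s)) v Y Z j + jump_sum m G (side (fst s) (snd s)) v Z W j)"
    if "s \<in> I" for s m v
    using that assms by (intro jump_sum_add finite_side_change_arc) auto
  then show ?thesis by (simp add: strip_sum_def sum.distrib)
qed

lemma strip_sum_equivariant:
  assumes "B \<in> G"
  shows "strip_sum n I (B ** Y) (B ** Z) = sym_power (4 * n - 2) B (strip_sum n I Y Z)"
proof -
  have "jump_sum m G (side a b) v (B ** Y) (B ** Z) = sym_power m B (jump_sum m G (side a b) v Y Z)" for m a b v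
    by (rule jump_sum_equivariant[OF assms]) (rule side_equivariant[OF det_G[OF assms]])
  then show ?thesis
    unfolding strip_sum_def sym_power_sum[where c = "\<lambda>_. 1", simplified] by simp
qed

lemma strip_sum_rot: "strip_sum n I (Y ** rot x) (Z ** rot y) = strip_sum n I Y Z"
  by (simp add: strip_sum_def jump_sum_def side_rot)

lemma strip_sum_zero: "j > 4 * n - 2 \<Longrightarrow> strip_sum n I Y Z j = 0"
  by (simp add: strip_sum_def jump_sum_zero)

lemma middle_coeff_strip_sum:
  assumes "n \<ge> 1"
  shows "middle_coeff n B (strip_sum n I Y Z) = (\<Sum>s\<in>I. \<Sum>A\<in>{A \<in> G. side (fst s) (snd s) Y A \<noteq> side (fst s) (snd s) Z A}.
    real ((4 * n - 2) choose (2 * n - 1)) * ((side (fst s) (snd s) Z A - side (fst s) (snd s) Y A) *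
      (((adj2 B ** A) *v fst s)$1 * ((adj2 B ** A) *v fst s)$2) ^ (2 * n - 1)))"
  unfolding strip_sum_def middle_coeff_sum[where c = "\<lambda>_. 1", simplified] jump_sum_def
    middle_coeff_scale middle_coeff_sym_power middle_coeff_pure_power[OF assms] adj2_mult adj2_adj2
  by (simp add: mult_ac)

text \<open>Determinant one preserves the orientation of every translated arc, so all crossings fall
  under the same sign rule. The rule survives the power because the middle exponent
  \<open>2 * n - 1\<close> is odd; here the dimension \<open>4 * n - 1\<close> matters.\<close>

lemma strip_term_nonneg:
  assumes "n \<ge> 1" "wedge a b < 0" "det B = 1" "A \<in> G" "s \<le> t"
  shows "(side a b (B ** flow t) A - side a b (B ** flow s) A) *
      (((adj2 B ** A) *v a)$1 * ((adj2 B ** A) *v a)$2) ^ (2 * n - 1) \<ge> 0"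
proof (rule odd_power_mult_nonneg)
  have "det (adj2 B ** A) = 1" using assms(3) det_G[OF assms(4)] by (simp add: det_mul)
  then have "wedge ((adj2 B ** A) *v a) ((adj2 B ** A) *v b) < 0" using assms(2) by (simp add: wedge_mult)
  from crossing_sign[OF this assms(5)]
  show "(side a b (B ** flow t) A - side a b (B ** flow s) A) *
      (((adj2 B ** A) *v a)$1 * ((adj2 B ** A) *v a)$2) \<ge> 0"
    unfolding side_flow .
  show "odd (2 * n - 1)" using assms(1) by simp
qed

lemma middle_coeff_strip_sum_nonneg:
  assumes "n \<ge> 1" "I \<subseteq> arc_pairs" "det B = 1" "s \<le> t"
  shows "middle_coeff n B (strip_sum n I (B ** flow s) (B ** flow t)) \<ge> 0"
  unfolding middle_coeff_strip_sum[OF assms(1)]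
proof (rule sum_nonneg, rule sum_nonneg)
  fix p A assume p: "p \<in> I"
    and A: "A \<in> {A \<in> G. side (fst p) (snd p) (B ** flow s) A \<noteq> side (fst p) (snd p) (B ** flow t) A}"
  have "wedge (fst p) (snd p) < 0" using p assms(2) by (auto simp: arc_pairs_def)
  moreover have "A \<in> G" using A by blast
  ultimately have "(side (fst p) (snd p) (B ** flow t) A - side (fst p) (snd p) (B ** flow s) A) *
      (((adj2 B ** A) *v fst p)$1 * ((adj2 B ** A) *v fst p)$2) ^ (2 * n - 1) \<ge> 0"
    by (intro strip_term_nonneg assms)
  then show "real ((4 * n - 2) choose (2 * n - 1)) *
      ((side (fst p) (snd p) (B ** flow t) A - side (fst p) (snd p) (B ** flow s) A) *
      (((adj2 B ** A) *v fst p)$1 * ((adj2 B ** A) *v fst p)$2) ^ (2 * n - 1)) \<ge> 0"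
    by (rule mult_nonneg_nonneg[OF of_nat_0_le_iff])
qed

end

text \<open>The geodesic of the frame \<open>X\<close> crosses the arc from \<open>a\<close> to \<open>b\<close> between the times
  \<open>- \<kappa>\<close> and \<open>\<kappa>\<close>: the last expression is the product of the values of \<open>e\<^sup>-\<^sup>t P + e\<^sup>t Q\<close> at
  these two times.\<close>

definition crosses :: "real \<Rightarrow> real^2 \<Rightarrow> real^2 \<Rightarrow> real^2^2 \<Rightarrow> bool" where
  "crosses \<kappa> a b X \<longleftrightarrow> 1 < \<kappa> * \<bar>(adj2 X *v a)$1 * (adj2 X *v a)$2\<bar> \<and>
     (let P = (adj2 X *v a)$1 * (adj2 X *v b)$1; Q = (adj2 X *v a)$2 * (adj2 X *v b)$2
      in P\<^sup>2 + Q\<^sup>2 + P * Q * (2 * cosh (2 * \<kappa>)) < 0)"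

text \<open>One parameter serves as time window and as inverse size of the pairing, so that finitely
  many arcs can share its largest value. The window condition forces \<open>P * Q < 0\<close>, hence
  becomes weaker as the hyperbolic cosine grows.\<close>

lemma crosses_mono:
  assumes "crosses \<kappa> a b X" "\<kappa> \<le> l" "0 \<le> \<kappa>"
  shows "crosses l a b X"
proof -
  define P Q where "P = (adj2 X *v a)$1 * (adj2 X *v b)$1" and "Q = (adj2 X *v a)$2 * (adj2 X *v b)$2"
  have c: "P\<^sup>2 + Q\<^sup>2 + P * Q * (2 * cosh (2 * \<kappa>)) < 0" "1 < \<kappa> * \<bar>(adj2 X *v a)$1 * (adj2 X *v a)$2\<bar>"
    using assms(1) by (simp_all add: crosses_def P_def Q_def Let_def)
  have "P * Q * (2 * cosh (2 * \<kappa>)) < 0" using c(1) zero_le_power2[of P] zero_le_power2[of Q] by linarith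
  then have "P * Q < 0" using cosh_real_pos[of "2 * \<kappa>"] by (simp add: mult_less_0_iff zero_less_mult_iff)
  moreover have "cosh (2 * \<kappa>) \<le> cosh (2 * l)" using assms(2,3) by (simp add: cosh_real_nonneg_le_iff)
  ultimately have "P * Q * (2 * cosh (2 * l)) \<le> P * Q * (2 * cosh (2 * \<kappa>))"
    by (simp only: mult_le_cancel_left_neg)
  then have "P\<^sup>2 + Q\<^sup>2 + P * Q * (2 * cosh (2 * l)) < 0" using c(1) by linarith
  moreover have "\<kappa> * \<bar>(adj2 X *v a)$1 * (adj2 X *v a)$2\<bar> \<le> l * \<bar>(adj2 X *v a)$1 * (adj2 X *v a)$2\<bar>"
    using assms(2) by (intro mult_right_mono) auto
  then have "1 < l * \<bar>(adj2 X *v a)$1 * (adj2 X *v a)$2\<bar>" using c(2) by linarith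
  ultimately show ?thesis by (simp add: crosses_def P_def Q_def Let_def)
qed

lemma open_crosses: "open {X. crosses \<kappa> a b X}"
  unfolding crosses_def Let_def adj2_def mat2_vec_nth mat2_nth
  by (intro open_Collect_conj open_Collect_less continuous_intros)

context discrete_SL2_group
begin

text \<open>Two directions outside the limit set are chosen on either side of an endpoint of the
  geodesic, so close that exactly one of the two coordinates in the frame changes sign between them.
  The endpoint is the backward one, \<open>X$1$2 / X$2$2\<close>, unless it is infinite.\<close>

lemma ex_crosses:
  assumes dens: "\<And>a b. a < b \<Longrightarrow> \<exists>x. a < x \<and> x < b \<and> vec2 x 1 \<notin> lim_dirs G"
    and X: "det X = 1"
  shows "\<exists>s\<in>arc_pairs. \<exists>k::nat. crosses (real k) (fst s) (snd s) X"
proof -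
  have l: "(adj2 X *v vec2 x 1)$1 = X$2$2 * x - X$1$2" "(adj2 X *v vec2 x 1)$2 = X$1$1 - X$2$1 * x" for x
    by (simp_all add: adj2_def mat2_vec_nth)
  have "\<exists>x y. x < y \<and> vec2 x 1 \<notin> lim_dirs G \<and> vec2 y 1 \<notin> lim_dirs G \<and>
      ((X$2$2 * x - X$1$2) * (X$2$2 * y - X$1$2)) * ((X$1$1 - X$2$1 * x) * (X$1$1 - X$2$1 * y)) < 0"
  proof (cases "X$2$2 = 0")
    case False
    define d c r where "d = X$2$2" and "c = X$2$1" and "r = X$1$2 / X$2$2"
    have d: "d \<noteq> 0" using False by (simp add: d_def)
    have r1: "X$2$2 * x - X$1$2 = d * (x - r)" for x using False by (simp add: d_def r_def algebra_simps)
    have "X$1$1 = 1 / d + c * r"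
      using X False by (simp add: d_def c_def r_def det_2 field_simps)
    then have r2: "X$1$1 - X$2$1 * x = 1 / d - c * (x - r)" for x by (simp add: c_def algebra_simps)
    \<comment> \<open>Within this distance of \<open>r\<close> the second coordinate
      \<open>1 / d - c * (x - r)\<close> keeps the sign of \<open>d\<close>.\<close>
    define \<delta> where "\<delta> = 1 / (\<bar>d\<bar> * (\<bar>c\<bar> + 1))"
    have \<delta>: "\<delta> > 0" using d by (simp add: \<delta>_def)
    obtain x where x: "r - \<delta> < x" "x < r" "vec2 x 1 \<notin> lim_dirs G" using dens[of "r - \<delta>" r] \<delta> by auto
    obtain y where y: "r < y" "y < r + \<delta>" "vec2 y 1 \<notin> lim_dirs G" using dens[of r "r + \<delta>"] \<delta> by auto
    have near: "\<bar>d * (c * z)\<bar> < 1" if "\<bar>z\<bar> < \<delta>" for z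
    proof -
      have "\<bar>d * (c * z)\<bar> = \<bar>d\<bar> * (\<bar>c\<bar> * \<bar>z\<bar>)" by (simp add: abs_mult)
      also have "\<dots> \<le> \<bar>d\<bar> * ((\<bar>c\<bar> + 1) * \<bar>z\<bar>)" by (intro mult_left_mono mult_right_mono) auto
      also have "\<dots> < \<bar>d\<bar> * ((\<bar>c\<bar> + 1) * \<delta>)" using that d
        by (intro mult_strict_left_mono) (auto simp: add_nonneg_pos)
      also have "\<dots> = 1" using d by (simp add: \<delta>_def)
      finally show ?thesis .
    qed
    have pos: "1 - d * (c * (x - r)) > 0" "1 - d * (c * (y - r)) > 0"
      using near[of "x - r"] near[of "y - r"] x y by (auto simp: abs_less_iff)
    have "((X$2$2 * x - X$1$2) * (X$2$2 * y - X$1$2)) * ((X$1$1 - X$2$1 * x) * (X$1$1 - X$2$1 * y))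
        = ((x - r) * (y - r)) * ((1 - d * (c * (x - r))) * (1 - d * (c * (y - r))))"
      using d unfolding r1 r2 by (simp add: field_simps)
    also have "\<dots> < 0"
    proof (rule mult_neg_pos)
      show "(x - r) * (y - r) < 0" using x y by (intro mult_neg_pos) auto
      show "(1 - d * (c * (x - r))) * (1 - d * (c * (y - r))) > 0" using pos by (rule mult_pos_pos)
    qed
    finally show ?thesis using x y by (intro exI[of _ x] exI[of _ y]) auto
  next
    case True
    \<comment> \<open>The backward endpoint is infinite, so the forward one is used; now the first
      coordinate is constant.\<close>
    define c r where "c = X$2$1" and "r = X$1$1 / X$2$1"
    have bc: "X$1$2 * c = - 1" using X True by (simp add: c_def det_2)
    then have c: "c \<noteq> 0" by auto
    have r: "X$1$1 - X$2$1 * x = - c * (x - r)" for x using c by (simp add: c_def r_def algebra_simps)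
    obtain x where x: "r - 1 < x" "x < r" "vec2 x 1 \<notin> lim_dirs G" using dens[of "r - 1" r] by auto
    obtain y where y: "r < y" "y < r + 1" "vec2 y 1 \<notin> lim_dirs G" using dens[of r "r + 1"] by auto
    have "((X$2$2 * x - X$1$2) * (X$2$2 * y - X$1$2)) * ((X$1$1 - X$2$1 * x) * (X$1$1 - X$2$1 * y))
        = (X$1$2 * c)\<^sup>2 * ((x - r) * (y - r))"
      unfolding r by (simp add: True power2_eq_square)
    also have "\<dots> < 0" using x y by (simp add: bc mult_neg_pos)
    finally show ?thesis using x y by (intro exI[of _ x] exI[of _ y]) auto
  qed
  then obtain x y where xy: "x < y" "vec2 x 1 \<notin> lim_dirs G" "vec2 y 1 \<notin> lim_dirs G"
    "((X$2$2 * x - X$1$2) * (X$2$2 * y - X$1$2)) * ((X$1$1 - X$2$1 * x) * (X$1$1 - X$2$1 * y)) < 0"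
    by blast
  have s: "(vec2 x 1, vec2 y 1) \<in> arc_pairs"
    using xy by (simp add: arc_pairs_def wedge_def vec2_eq_iff)
  define P Q where "P = (adj2 X *v vec2 x 1)$1 * (adj2 X *v vec2 y 1)$1"
    and "Q = (adj2 X *v vec2 x 1)$2 * (adj2 X *v vec2 y 1)$2"
  define q where "q = \<bar>(adj2 X *v vec2 x 1)$1 * (adj2 X *v vec2 x 1)$2\<bar>"
  have PQ: "P * Q < 0" using xy(4) by (simp add: P_def Q_def l)
  have q: "q > 0" using xy(4) by (auto simp: q_def l)
  \<comment> \<open>\<open>k1\<close> serves the lower bound on the pairing, and \<open>k2\<close>
    the time window, through the bound \<open>2 * cosh (2 * k) \<ge> 2 * k\<close>.\<close>
  obtain k1 :: nat where k1: "1 / q < real k1" using reals_Archimedean2 by blast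
  obtain k2 :: nat where k2: "(P\<^sup>2 + Q\<^sup>2) / (- (P * Q)) < real k2" using reals_Archimedean2 by blast
  define k where "k = k1 + k2"
  have "1 < real k1 * q" using k1 q by (simp add: field_simps)
  also have "\<dots> \<le> real k * q" using q by (intro mult_right_mono) (auto simp: k_def)
  finally have 1: "1 < real k * q" .
  have "P\<^sup>2 + Q\<^sup>2 < real k2 * (- (P * Q))" using k2 pos_divide_less_eq[of "- (P * Q)" "P\<^sup>2 + Q\<^sup>2" "real k2"] PQ by linarith
  also have "\<dots> \<le> (2 * cosh (2 * real k)) * (- (P * Q))"
  proof (intro mult_right_mono)
    have "real k2 \<le> 2 * real k" by (simp add: k_def)
    also have "\<dots> \<le> exp (2 * real k)" using exp_ge_add_one_self[of "2 * real k"] by linarith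
    also have "\<dots> \<le> 2 * cosh (2 * real k)" by (simp add: cosh_def)
    finally show "real k2 \<le> 2 * cosh (2 * real k)" .
  qed (use PQ in auto)
  finally have "P\<^sup>2 + Q\<^sup>2 + P * Q * (2 * cosh (2 * real k)) < 0" by (simp add: algebra_simps)
  then have "crosses (real k) (vec2 x 1) (vec2 y 1) X"
    using 1 by (simp add: crosses_def P_def Q_def q_def Let_def)
  then show ?thesis using s by force
qed

text \<open>Crossing within a given window is an open condition on the frame, and determinant-one
  frames of bounded norm form a compact set.\<close>

lemma ex_finite_arcs:
  assumes "\<And>a b. a < b \<Longrightarrow> \<exists>x. a < x \<and> x < b \<and> vec2 x 1 \<notin> lim_dirs G"
  obtains I \<kappa> where "finite I" "I \<subseteq> arc_pairs" "\<kappa> > 0"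
    "\<And>X. det X = 1 \<Longrightarrow> norm X \<le> R \<Longrightarrow> \<exists>s\<in>I. crosses \<kappa> (fst s) (snd s) X"
proof -
  define S where "S = {X :: real^2^2. det X = 1 \<and> norm X \<le> R}"
  have "closed S"
    unfolding S_def det_2 by (intro closed_Collect_conj closed_Collect_eq closed_Collect_le continuous_intros)
  moreover have "bounded S" by (rule boundedI[of _ R]) (auto simp: S_def)
  ultimately have "compact S" using compact_eq_bounded_closed by blast
  define f where "f c = {X. crosses (real (snd c)) (fst (fst c)) (snd (fst c)) X}"
    for c :: "((real^2) \<times> (real^2)) \<times> nat"
  have cover: "S \<subseteq> (\<Union>c\<in>arc_pairs \<times> UNIV. f c)"
  proof
    fix X assume "X \<in> S"
    then obtain s k where "s \<in> arc_pairs" "crosses (real k) (fst s) (snd s) X"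
      using ex_crosses[OF assms] unfolding S_def by blast
    then have "(s, k) \<in> arc_pairs \<times> UNIV" "X \<in> f (s, k)" by (auto simp: f_def)
    then show "X \<in> (\<Union>c\<in>arc_pairs \<times> UNIV. f c)" by (rule UN_I)
  qed
  have op: "open (f c)" for c unfolding f_def by (rule open_crosses)
  obtain D where D: "D \<subseteq> arc_pairs \<times> UNIV" "finite D" "S \<subseteq> (\<Union>c\<in>D. f c)"
    by (rule compactE_image[OF \<open>compact S\<close> op cover])
  \<comment> \<open>The sum dominates every window in the finite subcover; the successor keeps
    \<open>\<kappa>\<close> positive even if the cover is empty.\<close>
  define \<kappa> where "\<kappa> = real (Suc (\<Sum>c\<in>D. snd c))"
  show thesis
  proof (rule that[of "fst ` D" \<kappa>])
    show "finite (fst ` D)" "fst ` D \<subseteq> arc_pairs" using D by auto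
    show "\<kappa> > 0" by (simp only: \<kappa>_def of_nat_0_less_iff zero_less_Suc)
    fix X :: "real^2^2" assume "det X = 1" "norm X \<le> R"
    then have "X \<in> S" by (simp add: S_def)
    then obtain c where "c \<in> D" "X \<in> f c" using D(3) by blast
    then have c: "c \<in> D" "crosses (real (snd c)) (fst (fst c)) (snd (fst c)) X" by (simp_all add: f_def)
    have "snd c \<le> (\<Sum>c\<in>D. snd c)" using c(1) D(2) by (intro member_le_sum) auto
    then have "snd c \<le> Suc (\<Sum>c\<in>D. snd c)" by (rule le_SucI)
    then have "real (snd c) \<le> \<kappa>" unfolding \<kappa>_def by (rule of_nat_mono)
    then have "crosses \<kappa> (fst (fst c)) (snd (fst c)) X" using crosses_mono c(2) by simp
    then show "\<exists>s\<in>fst ` D. crosses \<kappa> (fst s) (snd s) X" using c(1) by blast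
  qed
qed

text \<open>The untranslated arc \<open>s\<close> alone, indexed by \<open>mat 1\<close>,
  contributes at least the claimed amount, and every other term is nonnegative.\<close>

lemma middle_coeff_strip_sum_crosses:
  assumes n: "n \<ge> 1" and I: "finite I" "I \<subseteq> arc_pairs" and X: "det X = 1"
    and s: "s \<in> I" "crosses \<kappa> (fst s) (snd s) X" and \<kappa>: "\<kappa> > 0"
  shows "middle_coeff n X (strip_sum n I (X ** flow (- \<kappa>)) (X ** flow \<kappa>)) \<ge> (1 / \<kappa>) ^ (2 * n - 1)"
proof -
  define C where "C = real ((4 * n - 2) choose (2 * n - 1))"
  define F where "F s A = C * ((side (fst s) (snd s) (X ** flow \<kappa>) A - side (fst s) (snd s) (X ** flow (- \<kappa>)) A) *
      (((adj2 X ** A) *v fst s)$1 * ((adj2 X ** A) *v fst s)$2) ^ (2 * n - 1))" for s A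
  define D where "D s = {A \<in> G. side (fst s) (snd s) (X ** flow (- \<kappa>)) A \<noteq> side (fst s) (snd s) (X ** flow \<kappa>) A}" for s
  have "(4 * n - 2) choose (2 * n - 1) > 0" using n by (simp add: zero_less_binomial_iff)
  then have C: "C \<ge> 1" unfolding C_def by linarith
  have wedge: "wedge (fst s) (snd s) < 0" if "s \<in> I" for s using that I(2) by (auto simp: arc_pairs_def)
  have nonneg: "F s A \<ge> 0" if "s \<in> I" "A \<in> G" for s A
    unfolding F_def using C wedge[OF that(1)] n X that(2) \<kappa>
    by (intro mult_nonneg_nonneg[OF _ strip_term_nonneg]) auto
  have finD: "finite (D s)" if "s \<in> I" for s
    unfolding D_def using that I(2) X by (intro finite_side_change_arc) (auto simp: det_mul)
  define a b where "a = adj2 X *v fst s" and "b = adj2 X *v snd s"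
  define P Q where "P = a$1 * b$1" and "Q = a$2 * b$2"
  define f where "f t = exp (- t) * P + exp t * Q" for t
  have cr: "1 < \<kappa> * \<bar>a$1 * a$2\<bar>" "P\<^sup>2 + Q\<^sup>2 + P * Q * (2 * cosh (2 * \<kappa>)) < 0"
    using s(2) by (simp_all add: crosses_def a_def b_def P_def Q_def Let_def)
  have "f (- \<kappa>) * f \<kappa> = P\<^sup>2 + Q\<^sup>2 + P * Q * (2 * cosh (2 * \<kappa>))"
  proof -
    have "exp \<kappa> * exp (- \<kappa>) = 1" "exp \<kappa> * exp \<kappa> = exp (2 * \<kappa>)" "exp (- \<kappa>) * exp (- \<kappa>) = exp (- (2 * \<kappa>))"
      by (simp_all flip: exp_add)
    moreover have "f (- \<kappa>) * f \<kappa> = (exp \<kappa> * exp (- \<kappa>)) * (P\<^sup>2 + Q\<^sup>2) + P * Q * (exp \<kappa> * exp \<kappa> + exp (- \<kappa>) * exp (- \<kappa>))"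
      by (simp add: f_def power2_eq_square algebra_simps)
    ultimately show ?thesis by (simp add: cosh_def)
  qed
  then have "f (- \<kappa>) * f \<kappa> < 0" using cr(2) by simp
  then have opp: "(f (- \<kappa>) < 0) \<noteq> (f \<kappa> < 0)" by (auto simp: mult_less_0_iff)
  have side: "side (fst s) (snd s) (X ** flow t) (mat 1) = of_bool (f t < 0)" for t
    by (simp add: side_flow f_def P_def Q_def a_def b_def)
  have "mat 1 \<in> D s" using opp one_G by (auto simp: D_def side)
  have "\<bar>F s (mat 1)\<bar> = C * \<bar>a$1 * a$2\<bar> ^ (2 * n - 1)"
    using opp C by (auto simp: F_def side a_def abs_mult power_abs)
  moreover have "(1 / \<kappa>) ^ (2 * n - 1) \<le> \<bar>a$1 * a$2\<bar> ^ (2 * n - 1)"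
    using cr(1) \<kappa> by (intro power_mono) (auto simp: field_simps)
  moreover have "1 * \<bar>a$1 * a$2\<bar> ^ (2 * n - 1) \<le> C * \<bar>a$1 * a$2\<bar> ^ (2 * n - 1)"
    using C by (intro mult_right_mono) auto
  ultimately have "(1 / \<kappa>) ^ (2 * n - 1) \<le> F s (mat 1)"
    using nonneg[OF s(1) one_G] by simp
  also have "\<dots> \<le> (\<Sum>A\<in>D s. F s A)"
    using \<open>mat 1 \<in> D s\<close> finD[OF s(1)] nonneg[OF s(1)] by (intro member_le_sum) (auto simp: D_def)
  also have "\<dots> \<le> (\<Sum>s\<in>I. \<Sum>A\<in>D s. F s A)"
    using s(1) I(1) nonneg by (intro member_le_sum[of s I "\<lambda>s. \<Sum>A\<in>D s. F s A"] sum_nonneg) (auto simp: D_def)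
  also have "\<dots> = middle_coeff n X (strip_sum n I (X ** flow (- \<kappa>)) (X ** flow \<kappa>))"
    unfolding middle_coeff_strip_sum[OF n] F_def D_def C_def ..
  finally show ?thesis .
qed

end

section \<open>Properness from positivity\<close>

lemma rot_0 [simp]: "rot 0 = mat 1"
  by (simp add: rot_def mat2_simps)

lemma frame_pt_rot: "det X = 1 \<Longrightarrow> frame_pt (X ** rot x) = frame_pt X"
proof -
  assume "det X = 1"
  have "of_real (cos x) * \<i> - of_real (sin x) = \<i> * (of_real (sin x) * \<i> + of_real (cos x))"
    by (simp add: complex_eq_iff)
  moreover have "of_real (sin x) * \<i> + of_real (cos x) \<noteq> (0 :: complex)"
    using mob_denom_nonzero[OF det_rot ii_in_H2, of x] by (simp add: rot_def)
  ultimately have "frame_pt (rot x) = \<i>"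
    by (simp add: frame_pt_def mob_eq rot_def)
  then show ?thesis using frame_pt_mult[of "rot x" X] by (simp add: frame_pt_def)
qed

text \<open>\<open>B0\<close> is a frame at the base point \<open>o\<close>. In
  \<open>A ** B0 = B0 ** rot x ** flow L ** rot y\<close> the frame \<open>B0 ** rot x\<close>
  points from \<open>o\<close> towards its image under \<open>A\<close>, at distance
  \<open>L\<close>. The assumption \<open>near\<close> is cocompactness along that segment.\<close>

locale strip_cocycle = discrete_SL2_group +
  fixes n :: nat and I :: "((real^2) \<times> (real^2)) set" and \<kappa> R :: real and B0 :: "real^2^2"
  assumes n: "n \<ge> 1" and fin_I: "finite I" and I: "I \<subseteq> arc_pairs" and \<kappa>: "\<kappa> > 0"
    and crossed: "\<And>X. det X = 1 \<Longrightarrow> norm X \<le> R \<Longrightarrow> \<exists>s\<in>I. crosses \<kappa> (fst s) (snd s) X"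
    and det_B0: "det B0 = 1" and norm_B0: "norm B0 \<le> R"
    and near: "\<And>A x y L t. A \<in> G \<Longrightarrow> A ** B0 = B0 ** rot x ** flow L ** rot y \<Longrightarrow> 0 \<le> t \<Longrightarrow> t \<le> L \<Longrightarrow>
      \<exists>h\<in>G. norm (h ** (B0 ** rot x ** flow t)) \<le> R"
begin

definition strip_cocycle_value :: "real^2^2 \<Rightarrow> nat \<Rightarrow> real" where
  "strip_cocycle_value A = strip_sum n I B0 (A ** B0)"

lemma strip_cocycle_value_mult:
  assumes "A \<in> G" "B \<in> G"
  shows "strip_cocycle_value (A ** B)
    = (\<lambda>i. sym_power (4 * n - 2) A (strip_cocycle_value B) i + strip_cocycle_value A i)"
proof -
  have "strip_sum n I B0 (A ** (B ** B0))
      = (\<lambda>i. strip_sum n I B0 (A ** B0) i + strip_sum n I (A ** B0) (A ** (B ** B0)) i)"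
    using det_B0 det_G assms by (intro strip_sum_add[OF I]) (auto simp: det_mul)
  then show ?thesis
    unfolding strip_cocycle_value_def strip_sum_equivariant[OF assms(1)]
    by (simp add: matrix_mul_assoc[symmetric] add.commute)
qed

text \<open>A group element moves the midpoint of the time window to a frame of norm at most
  \<open>R\<close>, where some chosen arc is crossed. Equivariance and flow invariance carry the
  estimate back.\<close>

lemma strip_step:
  assumes A: "A \<in> G" and AB: "A ** B0 = B0 ** rot x ** flow L ** rot y" and t: "0 \<le> t" "t + 2 * \<kappa> \<le> L"
  defines "B \<equiv> B0 ** rot x"
  shows "middle_coeff n B (strip_sum n I (B ** flow t) (B ** flow (t + 2 * \<kappa>))) \<ge> (1 / \<kappa>) ^ (2 * n - 1)"
proof -
  define Y where "Y = B ** flow (t + \<kappa>)"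
  obtain h where h: "h \<in> G" "norm (h ** Y) \<le> R"
    using near[OF A AB, of "t + \<kappa>"] t \<kappa> unfolding Y_def B_def by auto
  have dh: "det h = 1" by (rule det_G[OF h(1)])
  have dY: "det Y = 1" using det_B0 by (simp add: Y_def B_def det_mul)
  define X where "X = h ** Y"
  have dX: "det X = 1" using dh dY by (simp add: X_def det_mul)
  have YX: "Y = adj2 h ** X" using adj2_left(2)[OF dh] by (simp add: X_def)
  have fl: "B ** flow t = adj2 h ** (X ** flow (- \<kappa>))" "B ** flow (t + 2 * \<kappa>) = adj2 h ** (X ** flow \<kappa>)"
    unfolding matrix_mul_assoc YX[symmetric] Y_def
    by (simp_all add: matrix_mul_assoc[symmetric] flow_add algebra_simps)
  obtain s where s: "s \<in> I" "crosses \<kappa> (fst s) (snd s) X"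
    using crossed[OF dX] h(2) by (auto simp: X_def)
  have "middle_coeff n B (strip_sum n I (B ** flow t) (B ** flow (t + 2 * \<kappa>)))
      = middle_coeff n Y (strip_sum n I (B ** flow t) (B ** flow (t + 2 * \<kappa>)))"
    unfolding Y_def by (rule middle_coeff_flow[OF n, symmetric])
  also have "\<dots> = middle_coeff n X (strip_sum n I (X ** flow (- \<kappa>)) (X ** flow \<kappa>))"
    unfolding fl strip_sum_equivariant[OF adj2_G[OF h(1)]] middle_coeff_sym_power
    by (simp add: X_def)
  also have "\<dots> \<ge> (1 / \<kappa>) ^ (2 * n - 1)"
    by (rule middle_coeff_strip_sum_crosses[OF n fin_I I dX s \<kappa>])
  finally show ?thesis .
qed

text \<open>The segment holds \<open>J\<close> consecutive windows of length
  \<open>2 * \<kappa>\<close>, each contributing a fixed amount; the leftover piece contributes a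
  nonnegative amount.\<close>

lemma middle_coeff_strip_cocycle:
  assumes A: "A \<in> G" and AB: "A ** B0 = B0 ** rot x ** flow L ** rot y" and J: "2 * \<kappa> * real J \<le> L"
  shows "middle_coeff n (B0 ** rot x) (strip_cocycle_value A) \<ge> real J * (1 / \<kappa>) ^ (2 * n - 1)"
proof -
  define B where "B = B0 ** rot x"
  have dB: "det (B ** flow t) = 1" for t using det_B0 by (simp add: B_def det_mul)
  have steps: "middle_coeff n B (strip_sum n I (B ** flow 0) (B ** flow (2 * \<kappa> * real j))) \<ge> real j * (1 / \<kappa>) ^ (2 * n - 1)"
    if "2 * \<kappa> * real j \<le> L" for j
    using that
  proof (induction j)
    case 0
    then show ?case using middle_coeff_strip_sum_nonneg[OF n I, of B 0 0] dB[of 0] by simp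
  next
    case (Suc j)
    let ?t = "2 * \<kappa> * real j"
    have t: "2 * \<kappa> * real (Suc j) = ?t + 2 * \<kappa>" by (simp add: algebra_simps)
    have le: "?t + 2 * \<kappa> \<le> L" using Suc.prems t by simp
    have "middle_coeff n B (strip_sum n I (B ** flow 0) (B ** flow (?t + 2 * \<kappa>)))
        = middle_coeff n B (strip_sum n I (B ** flow 0) (B ** flow ?t))
          + middle_coeff n B (strip_sum n I (B ** flow ?t) (B ** flow (?t + 2 * \<kappa>)))"
      unfolding strip_sum_add[OF I dB dB dB, of n 0 "?t + 2 * \<kappa>" ?t] by (rule middle_coeff_add)
    moreover have "?t \<ge> 0" using \<kappa> by simp
    then have "middle_coeff n B (strip_sum n I (B ** flow ?t) (B ** flow (?t + 2 * \<kappa>))) \<ge> (1 / \<kappa>) ^ (2 * n - 1)"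
      unfolding B_def using strip_step[OF A AB _ le] by blast
    moreover have "middle_coeff n B (strip_sum n I (B ** flow 0) (B ** flow ?t)) \<ge> real j * (1 / \<kappa>) ^ (2 * n - 1)"
      using le \<kappa> by (intro Suc.IH) simp
    ultimately show ?case unfolding t by (simp add: algebra_simps)
  qed
  have "strip_cocycle_value A = strip_sum n I (B ** flow 0) (B ** flow L)"
  proof -
    have "strip_sum n I (B0 ** rot 0) ((B ** flow L) ** rot y) = strip_sum n I B0 (B ** flow L)"
      "strip_sum n I (B0 ** rot x) ((B ** flow L) ** rot 0) = strip_sum n I B0 (B ** flow L)"
      by (rule strip_sum_rot)+
    then show ?thesis by (simp add: strip_cocycle_value_def AB B_def)
  qed
  also have "\<dots> = (\<lambda>i. strip_sum n I (B ** flow 0) (B ** flow (2 * \<kappa> * real J)) i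
      + strip_sum n I (B ** flow (2 * \<kappa> * real J)) (B ** flow L) i)"
    by (rule strip_sum_add[OF I dB dB dB])
  finally have "middle_coeff n B (strip_cocycle_value A)
      = middle_coeff n B (strip_sum n I (B ** flow 0) (B ** flow (2 * \<kappa> * real J)))
        + middle_coeff n B (strip_sum n I (B ** flow (2 * \<kappa> * real J)) (B ** flow L))"
    by (simp only: middle_coeff_add)
  moreover have "middle_coeff n B (strip_sum n I (B ** flow (2 * \<kappa> * real J)) (B ** flow L)) \<ge> 0"
    using middle_coeff_strip_sum_nonneg[OF n I _ J] dB[of 0] by simp
  ultimately show ?thesis using steps[OF J] unfolding B_def by linarith
qed

text \<open>A chain argument as in the Milnor-Schwarz lemma: \<open>A\<close> is a product of
  \<open>Suc J\<close> elements of bounded norm joining consecutive group translates along the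
  segment. Each value of \<open>w\<close> enters through a frame of norm at most
  \<open>R\<close>.\<close>

lemma middle_coeff_cocycle_bound:
  assumes A: "A \<in> G" and AB: "A ** B0 = B0 ** rot x ** flow L ** rot y"
    and J: "2 * \<kappa> * real J \<le> L" "L \<le> 2 * \<kappa> * real (Suc J)"
    and w: "\<And>X Y. X \<in> G \<Longrightarrow> Y \<in> G \<Longrightarrow> w (X ** Y) = (\<lambda>i. sym_power (4 * n - 2) X (w Y) i + w X i)"
    and K: "\<And>B v. norm B \<le> R \<Longrightarrow> \<bar>middle_coeff n B v\<bar> \<le> K * (\<Sum>k\<le>4 * n - 2. \<bar>v k\<bar>)" "K \<ge> 0"
    and small: "\<And>X k. X \<in> G \<Longrightarrow> norm X \<le> 2 * exp \<kappa> * R\<^sup>2 \<Longrightarrow> k \<le> 4 * n - 2 \<Longrightarrow> \<bar>w X k\<bar> \<le> e"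
  shows "\<bar>middle_coeff n (B0 ** rot x) (w A)\<bar> \<le> real (Suc J) * (K * (real (4 * n - 1) * e))"
proof -
  define B where "B = B0 ** rot x"
  define T where "T j = (if j \<le> J then 2 * \<kappa> * real j else L)" for j
  have dB: "det (B ** flow t) = 1" for t using det_B0 by (simp add: B_def det_mul)
  have nB: "norm B \<le> R" using norm_B0 by (simp add: B_def norm_mult_rot)
  have "2 * \<kappa> * real j \<le> L" if "j \<le> J" for j
  proof -
    have "2 * \<kappa> * real j \<le> 2 * \<kappa> * real J" using that \<kappa> by (intro mult_left_mono) auto
    then show ?thesis using J(1) by linarith
  qed
  moreover have "0 \<le> 2 * \<kappa> * real j" for j using \<kappa> by simp
  ultimately have "\<exists>h\<in>G. norm (h ** (B ** flow (T j))) \<le> R" if "j \<le> J" for j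
    using that near[OF A AB, of "T j"] by (simp add: T_def B_def)
  then obtain h0 where h0: "\<And>j. j \<le> J \<Longrightarrow> h0 j \<in> G \<and> norm (h0 j ** (B ** flow (T j))) \<le> R" by metis
  \<comment> \<open>The chain must begin at the identity and end at \<open>A\<close>: the frame at
    time 0 is already bounded, and \<open>adj2 A\<close> returns the frame at time \<open>L\<close>
    to a rotated \<open>B0\<close>.\<close>
  define h where "h j = (if j = 0 then mat 1 else if j \<le> J then h0 j else adj2 A)" for j
  have hG: "h j \<in> G" for j using h0 one_G adj2_G[OF A] by (simp add: h_def)
  have endp: "B ** flow L = A ** (B0 ** rot (- y))"
  proof -
    have "A ** (B0 ** rot (- y)) = (A ** B0) ** adj2 (rot y)" by (simp add: adj2_rot matrix_mul_assoc)
    also have "\<dots> = B ** flow L ** (rot y ** adj2 (rot y))" unfolding AB B_def by (simp add: matrix_mul_assoc)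
    finally show ?thesis by (simp add: adj2_right)
  qed
  have hR: "norm (h j ** (B ** flow (T j))) \<le> R" if jle: "j \<le> Suc J" for j
  proof -
    consider "j = 0" | "0 < j" "j \<le> J" | "j = Suc J" using jle by linarith
    then show ?thesis
    proof cases
      case 1 then show ?thesis using nB by (simp add: h_def T_def)
    next
      case 2 then show ?thesis using h0 by (simp add: h_def)
    next
      case 3
      then show ?thesis
        using norm_B0 by (simp add: h_def T_def endp adj2_left[OF det_G[OF A]] norm_mult_rot)
    qed
  qed
  have T_diff: "\<bar>T (Suc j) - T j\<bar> \<le> 2 * \<kappa>" if "j \<le> J" for j
    using that J \<kappa> by (cases "j = J") (auto simp: T_def algebra_simps)
  have flow_T: "middle_coeff n B v = middle_coeff n (B ** flow (T j)) v" for j v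
    by (rule middle_coeff_flow[OF n, symmetric])
  have zero: "middle_coeff n B (w (mat 1)) = 0"
  proof -
    have "middle_coeff n B (w (mat 1)) = middle_coeff n B (w (mat 1 ** mat 1))" by simp
    also have "\<dots> = middle_coeff n B (w (mat 1)) + middle_coeff n B (w (mat 1))"
      unfolding w[OF one_G one_G] middle_coeff_add middle_coeff_sym_power by simp
    finally show ?thesis by simp
  qed
  have "\<bar>middle_coeff n B (w (adj2 (h j)))\<bar> \<le> real j * (K * (real (4 * n - 1) * e))" if "j \<le> Suc J" for j
    using that
  proof (induction j)
    case 0
    then show ?case by (simp add: h_def zero)
  next
    case (Suc j)
    have j: "j \<le> Suc J" "j \<le> J" using Suc.prems by auto
    define s where "s = h j ** adj2 (h (Suc j))"
    have sG: "s \<in> G" using hG mult_G adj2_G by (simp add: s_def)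
    have dh: "det (h i) = 1" for i by (rule det_G[OF hG])
    have eq: "adj2 (h (Suc j)) = adj2 (h j) ** s" using adj2_left(2)[OF dh] by (simp add: s_def)
    have "s = (h j ** (B ** flow (T j))) ** flow (T (Suc j) - T j) ** adj2 (h (Suc j) ** (B ** flow (T (Suc j))))"
    proof -
      have "(B ** flow (T j)) ** flow (T (Suc j) - T j) = B ** flow (T (Suc j))"
        by (simp add: matrix_mul_assoc[symmetric] flow_add)
      then have "(h j ** (B ** flow (T j))) ** flow (T (Suc j) - T j) = h j ** (B ** flow (T (Suc j)))"
        by (simp add: matrix_mul_assoc[symmetric])
      moreover have "(h j ** (B ** flow (T (Suc j)))) ** adj2 (h (Suc j) ** (B ** flow (T (Suc j)))) = s"
        unfolding adj2_mult[of "h (Suc j)"] s_def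
        by (simp only: matrix_mul_assoc[symmetric] adj2_right(2)[OF dB[unfolded matrix_mul_assoc]])
          (simp add: matrix_mul_assoc adj2_right[OF dB])
      ultimately show ?thesis by simp
    qed
    also have "norm \<dots> \<le> norm ((h j ** (B ** flow (T j))) ** flow (T (Suc j) - T j)) * norm (h (Suc j) ** (B ** flow (T (Suc j))))"
      using norm_mat2_mult_le by (metis norm_adj2)
    also have "\<dots> \<le> (norm (h j ** (B ** flow (T j))) * norm (flow (T (Suc j) - T j))) * R"
      using hR[OF Suc.prems] by (intro mult_mono norm_mat2_mult_le) auto
    \<comment> \<open>Two frames of norm at most \<open>R\<close> and a flow of time at most
      \<open>2 * \<kappa>\<close> account for the radius in \<open>small\<close>.\<close>
    also have "\<dots> \<le> (R * (2 * exp \<kappa>)) * R"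
    proof (intro mult_right_mono mult_mono)
      have "norm (flow (T (Suc j) - T j)) \<le> 2 * exp (\<bar>T (Suc j) - T j\<bar> / 2)" by (rule norm_flow_le)
      also have "\<dots> \<le> 2 * exp \<kappa>" using T_diff[OF j(2)] by simp
      finally show "norm (flow (T (Suc j) - T j)) \<le> 2 * exp \<kappa>" .
      show "0 \<le> R" using nB norm_ge_zero[of B] by linarith
      then show "0 \<le> R" .
    qed (use hR[OF j(1)] in auto)
    finally have "norm s \<le> 2 * exp \<kappa> * R\<^sup>2" by (simp add: power2_eq_square mult_ac)
    then have "\<bar>w s k\<bar> \<le> e" if "k \<le> 4 * n - 2" for k using small sG that by blast
    then have "(\<Sum>k\<le>4 * n - 2. \<bar>w s k\<bar>) \<le> real (card {..4 * n - 2}) * e"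
      by (intro sum_bounded_above) auto
    also have "card {..4 * n - 2} = 4 * n - 1" using n by simp
    finally have sum: "(\<Sum>k\<le>4 * n - 2. \<bar>w s k\<bar>) \<le> real (4 * n - 1) * e" .
    have "middle_coeff n B (w (adj2 (h (Suc j))))
        = middle_coeff n (h j ** B) (w s) + middle_coeff n B (w (adj2 (h j)))"
      unfolding eq w[OF adj2_G[OF hG] sG] middle_coeff_add middle_coeff_sym_power by simp
    moreover have "middle_coeff n (h j ** B) (w s) = middle_coeff n (h j ** (B ** flow (T j))) (w s)"
      unfolding matrix_mul_assoc by (rule middle_coeff_flow[OF n, symmetric])
    moreover have "\<bar>middle_coeff n (h j ** (B ** flow (T j))) (w s)\<bar> \<le> K * (real (4 * n - 1) * e)"
      using K(1)[OF hR[OF j(1)], of "w s"] mult_left_mono[OF sum K(2)] by linarith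
    ultimately have "\<bar>middle_coeff n B (w (adj2 (h (Suc j))))\<bar>
        \<le> K * (real (4 * n - 1) * e) + real j * (K * (real (4 * n - 1) * e))"
      using Suc.IH[OF j(1)] by linarith
    then show ?case by (simp add: algebra_simps)
  qed
  from this[of "Suc J"] show ?thesis by (simp add: h_def B_def)
qed

end

section \<open>Groups with two limit points\<close>

lemma cocycle_scale_eval:
  assumes "subgroup \<Gamma> PSL2" "A \<in> \<Union>\<Gamma>"
  shows "cocycle_scale \<Gamma> c u {A, - A} = (\<lambda>i. c * u {A, - A} i)"
  using assms(2) unfolding mem_Union_PSL2_iff[OF assms(1)] by (simp add: cocycle_scale_def)

lemma properly_discontinuousI:
  assumes sub: "subgroup \<Gamma> PSL2" and disc: "discrete_in_PSL2 \<Gamma>" and n: "n \<ge> 1"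
    and bound: "\<And>M. \<exists>N. \<forall>A\<in>\<Union>\<Gamma>. \<forall>x y. (\<forall>k\<le>4 * n - 2. \<bar>x k\<bar> \<le> M) \<longrightarrow> (\<forall>k\<le>4 * n - 2. \<bar>y k\<bar> \<le> M) \<longrightarrow>
      y = (\<lambda>i. sym_power (4 * n - 2) A x i + u {A, - A} i) \<longrightarrow> norm A \<le> N"
  shows "properly_discontinuous \<Gamma> (R_sig n) (affine_action n u)"
  unfolding properly_discontinuous_def
proof (intro allI impI)
  interpret discrete_SL2_group "\<Union>\<Gamma>" by (rule discrete_SL2_group_Union[OF sub disc])
  fix C assume C: "compactin (R_sig n) C"
  obtain M where M: "\<And>x k. x \<in> C \<Longrightarrow> k \<le> 4 * n - 2 \<Longrightarrow> \<bar>x k\<bar> \<le> M"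
    using compactin_R_sig_bounded[OF C] by blast
  obtain N where N: "\<forall>A\<in>\<Union>\<Gamma>. \<forall>x y. (\<forall>k\<le>4 * n - 2. \<bar>x k\<bar> \<le> M) \<longrightarrow> (\<forall>k\<le>4 * n - 2. \<bar>y k\<bar> \<le> M) \<longrightarrow>
      y = (\<lambda>i. sym_power (4 * n - 2) A x i + u {A, - A} i) \<longrightarrow> norm A \<le> N"
    using bound[of M] ..
  have "{g \<in> \<Gamma>. affine_action n u g ` C \<inter> C \<noteq> {}} \<subseteq> (\<lambda>A. {A, - A}) ` {A \<in> \<Union>\<Gamma>. norm A \<le> N}"
  proof
    fix g assume g: "g \<in> {g \<in> \<Gamma>. affine_action n u g ` C \<inter> C \<noteq> {}}"
    then obtain x where x: "x \<in> C" "affine_action n u g x \<in> C" by blast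
    have "g \<in> carrier PSL2" using g subgroup.subset[OF sub] by blast
    then obtain A where A: "g = {A, - A}" unfolding carrier_PSL2 by blast
    have AG: "A \<in> \<Union>\<Gamma>" using g A unfolding mem_Union_PSL2_iff[OF sub] by simp
    have "sigma n g = sym_power (4 * n - 2) A"
      using \<open>g \<in> carrier PSL2\<close> A by (intro sigma_eq[OF n]) auto
    then have "affine_action n u g x = (\<lambda>i. sym_power (4 * n - 2) A x i + u {A, - A} i)"
      by (simp add: affine_action_def A)
    then have "norm A \<le> N" using N[rule_format, OF AG M[OF x(1)] M[OF x(2)]] by simp
    then show "g \<in> (\<lambda>A. {A, - A}) ` {A \<in> \<Union>\<Gamma>. norm A \<le> N}" using A AG by blast
  qed
  then show "finite {g \<in> \<Gamma>. affine_action n u g ` C \<inter> C \<noteq> {}}"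
    using finite_ball[of N] by (meson finite_imageI finite_subset)
qed

text \<open>Two limit points give a base point in the hull. By convexity all segments between points
  of its orbit stay there, which yields the uniform constant \<open>R\<close>.\<close>

lemma exists_cone_two_limit_points:
  assumes n: "n \<ge> 1" and sub: "subgroup \<Gamma> PSL2" and disc: "discrete_in_PSL2 \<Gamma>"
    and nc: "\<not> compact_space (quotient_surface \<Gamma>)" and cc: "convex_cocompact \<Gamma>"
    and pq: "p \<in> lim_dirs (\<Union>\<Gamma>)" "q \<in> lim_dirs (\<Union>\<Gamma>)" "wedge p q \<noteq> 0"
  shows "\<exists>K. K \<noteq> {} \<and> openin (cocycle_space n \<Gamma>) K \<and> cocycle_cone \<Gamma> K \<and>
    (\<forall>u\<in>K. properly_discontinuous \<Gamma> (R_sig n) (affine_action n u))"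
proof -
  interpret G: discrete_SL2_group "\<Union>\<Gamma>" by (rule discrete_SL2_group_Union[OF sub disc])
  define m where "m = 4 * n - 2"
  \<comment> \<open>The columns are \<open>p\<close> and a multiple of \<open>q\<close>, so the
    geodesic of \<open>B0\<close> joins two limit points; the scaling makes the determinant
    1.\<close>
  define B0 where "B0 = mat2 (p$1) (q$1 / wedge p q) (p$2) (q$2 / wedge p q)"
  have "det B0 = (p$1 * q$2 - p$2 * q$1) / wedge p q"
    by (simp add: B0_def det_2 diff_divide_distrib mult.commute)
  then have dB0: "det B0 = 1" using pq(3) by (simp add: wedge_def)
  have "B0 *v vec2 1 0 = p" "B0 *v vec2 0 1 = (1 / wedge p q) *\<^sub>R q"
    by (simp_all add: B0_def mat2_simps)
  then have col: "B0 *v vec2 1 0 \<in> lim_dirs (\<Union>\<Gamma>)" "B0 *v vec2 0 1 \<in> lim_dirs (\<Union>\<Gamma>)"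
    using pq lim_dirs_scaleR by simp_all
  have hull: "frame_pt (A ** B0) \<in> hyp_convex_hull (limit_set \<Gamma>)" if "A \<in> \<Union>\<Gamma>" for A
  proof (rule frame_pt_in_hull[OF sub])
    show "det (A ** B0) = 1" using G.det_G[OF that] dB0 by (simp add: det_mul)
    show "(A ** B0) *v vec2 1 0 \<in> lim_dirs (\<Union>\<Gamma>)" "(A ** B0) *v vec2 0 1 \<in> lim_dirs (\<Union>\<Gamma>)"
      using G.lim_dirs_invariant[OF col(1) that] G.lim_dirs_invariant[OF col(2) that]
      by (simp_all add: matrix_vector_mul_assoc[symmetric])
  qed
  obtain r where r: "\<And>X. det X = 1 \<Longrightarrow> frame_pt X \<in> hyp_convex_hull (limit_set \<Gamma>) \<Longrightarrow> \<exists>A\<in>\<Union>\<Gamma>. norm (A ** X) < r"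
    using convex_cocompact_frames[OF sub cc] by blast
  define R where "R = max r (norm B0)"
  have R: "R \<ge> 1" using norm_SL2_ge_1[OF dB0] by (simp add: R_def)
  have near: "\<exists>h\<in>\<Union>\<Gamma>. norm (h ** (B0 ** rot x ** flow t)) \<le> R"
    if A: "A \<in> \<Union>\<Gamma>" "A ** B0 = B0 ** rot x ** flow L ** rot y" and t: "0 \<le> t" "t \<le> L" for A x y L t
  proof -
    have d: "det (B0 ** rot x ** flow t) = 1" for t using dB0 by (simp add: det_mul)
    have h1: "frame_pt (B0 ** rot x) \<in> hyp_convex_hull (limit_set \<Gamma>)"
      using hull[OF G.one_G] frame_pt_rot[OF dB0] by simp
    have h2: "frame_pt (B0 ** rot x ** flow L) \<in> hyp_convex_hull (limit_set \<Gamma>)"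
      using hull[OF A(1)] frame_pt_rot[OF d] A(2) by simp
    have "det (B0 ** rot x) = 1" using d[of 0] by simp
    then have "frame_pt (B0 ** rot x ** flow t) \<in> hyp_convex_hull (limit_set \<Gamma>)"
      by (rule frame_pt_segment_in_hull[OF _ h1 h2 t])
    then obtain h where h: "h \<in> \<Union>\<Gamma>" "norm (h ** (B0 ** rot x ** flow t)) < r" using r[OF d] by blast
    have "norm (h ** (B0 ** rot x ** flow t)) \<le> R" using h(2) by (simp add: R_def)
    then show ?thesis using h(1) by (rule bexI)
  qed
  have dens: "\<exists>x. a < x \<and> x < b \<and> vec2 x 1 \<notin> lim_dirs (\<Union>\<Gamma>)" if "a < b" for a b
    using ex_not_lim_dir[OF sub cc nc that] by metis
  obtain I \<kappa> where I: "finite I" "I \<subseteq> G.arc_pairs" "\<kappa> > 0"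
    "\<And>X. det X = 1 \<Longrightarrow> norm X \<le> R \<Longrightarrow> \<exists>s\<in>I. crosses \<kappa> (fst s) (snd s) X"
    using G.ex_finite_arcs[OF dens, of R] by metis
  interpret S: strip_cocycle "\<Union>\<Gamma>" n I \<kappa> R B0
    by unfold_locales (use n I dB0 near in \<open>auto simp: R_def\<close>)
  let ?w = "S.strip_cocycle_value"
  have w_zero: "?w A j = 0" if "j > 4 * n - 2" for A j
    unfolding S.strip_cocycle_value_def by (rule G.strip_sum_zero[OF that])
  obtain u0 where u0: "u0 \<in> cocycles n \<Gamma>" "\<And>A. A \<in> \<Union>\<Gamma> \<Longrightarrow> u0 {A, - A} = ?w A"
    using cocycle_of_matrices[OF sub n S.strip_cocycle_value_mult w_zero] by blast
  obtain Kc where Kc: "Kc \<ge> 0" "\<And>B v. norm B \<le> R \<Longrightarrow> \<bar>middle_coeff n B v\<bar> \<le> Kc * (\<Sum>k\<le>4 * n - 2. \<bar>v k\<bar>)"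
    using middle_coeff_bound[of R n] by metis
  define c1 where "c1 = (1 / \<kappa>) ^ (2 * n - 1)"
  have c1: "c1 > 0" using I(3) by (simp add: c1_def)
  define D where "D = Kc * real (4 * n - 1)"
  have D: "D \<ge> 0" using Kc(1) by (simp add: D_def)
  \<comment> \<open>Each chain step may cost \<open>D * \<epsilon>\<close>, at most half of the gain
    \<open>c1\<close> per window; \<open>D + 1\<close> avoids division by zero.\<close>
  define \<epsilon> where "\<epsilon> = c1 / (2 * (D + 1))"
  have \<epsilon>: "\<epsilon> > 0" "D * \<epsilon> \<le> c1 / 2"
  proof -
    show "\<epsilon> > 0" using c1 D by (simp add: \<epsilon>_def)
    have "D * \<epsilon> \<le> (D + 1) * \<epsilon>" using \<open>\<epsilon> > 0\<close> by simp
    also have "\<dots> = c1 / 2"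
    proof -
      have "D + 1 \<noteq> 0" using D by linarith
      then show ?thesis unfolding \<epsilon>_def by (metis mult.commute nonzero_mult_divide_mult_cancel_right times_divide_eq_right)
    qed
    finally show "D * \<epsilon> \<le> c1 / 2" .
  qed
  define S where "S = {A \<in> \<Union>\<Gamma>. norm A \<le> 2 * exp \<kappa> * R\<^sup>2}"
  have S: "finite S" unfolding S_def by (rule G.finite_ball)
  \<comment> \<open>The tolerance scales with \<open>c\<close>, so that the union of these
    neighbourhoods is a cone.\<close>
  define U where "U c = {u \<in> cocycles n \<Gamma>. \<forall>s\<in>S. \<forall>k\<le>m. \<bar>u {s, - s} k - c * ?w s k\<bar> < c * \<epsilon>}" for c
  define K where "K = (\<Union>c\<in>{0<..}. U c)"
  have "u0 \<in> U 1" using u0 \<epsilon>(1) by (auto simp: U_def S_def)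
  then have ne: "K \<noteq> {}" unfolding K_def using zero_less_one by blast
  have openU: "openin (cocycle_space n \<Gamma>) (U c)" for c
  proof -
    have "openin (cocycle_space n \<Gamma>) {u \<in> cocycles n \<Gamma>. \<bar>u {s, - s} k - c * ?w s k\<bar> < c * \<epsilon>}" if "s \<in> S" for s k
    proof -
      have "{s, - s} \<in> \<Gamma>" using that unfolding S_def mem_Union_PSL2_iff[OF sub, symmetric] by blast
      then have "continuous_map (cocycle_space n \<Gamma>) euclideanreal (\<lambda>u. u {s, - s} k)"
        by (rule continuous_map_cocycle_eval)
      moreover have "open (ball (c * ?w s k) (c * \<epsilon>))" by (rule open_ball)
      ultimately have "openin (cocycle_space n \<Gamma>)
          {u \<in> topspace (cocycle_space n \<Gamma>). u {s, - s} k \<in> ball (c * ?w s k) (c * \<epsilon>)}"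
        by (intro openin_continuous_map_preimage) auto
      then show ?thesis by (simp add: topspace_cocycle_space dist_real_def abs_minus_commute)
    qed
    then have "openin (cocycle_space n \<Gamma>) ((\<Inter>i\<in>S \<times> {..m}.
        {u \<in> cocycles n \<Gamma>. \<bar>u {fst i, - fst i} (snd i) - c * ?w (fst i) (snd i)\<bar> < c * \<epsilon>}) \<inter> topspace (cocycle_space n \<Gamma>))"
      using S by (intro openin_INT) auto
    also have "(\<Inter>i\<in>S \<times> {..m}.
        {u \<in> cocycles n \<Gamma>. \<bar>u {fst i, - fst i} (snd i) - c * ?w (fst i) (snd i)\<bar> < c * \<epsilon>}) \<inter> topspace (cocycle_space n \<Gamma>) = U c"
      by (auto simp: U_def topspace_cocycle_space)
    finally show ?thesis .
  qed
  then have op: "openin (cocycle_space n \<Gamma>) K" unfolding K_def by (intro openin_Union) auto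
  have cone: "cocycle_cone \<Gamma> K"
    unfolding cocycle_cone_def
  proof (intro ballI allI impI)
    fix u and d :: real assume "u \<in> K" "d > 0"
    then obtain c where c: "c > 0" "u \<in> U c" by (auto simp: K_def)
    have "\<bar>cocycle_scale \<Gamma> d u {s, - s} k - d * c * ?w s k\<bar> < d * c * \<epsilon>" if "s \<in> S" "k \<le> m" for s k
    proof -
      have "s \<in> \<Union>\<Gamma>" using that(1) by (simp add: S_def)
      then have "cocycle_scale \<Gamma> d u {s, - s} k - d * c * ?w s k = d * (u {s, - s} k - c * ?w s k)"
        by (simp add: cocycle_scale_eval[OF sub] algebra_simps)
      then have "\<bar>cocycle_scale \<Gamma> d u {s, - s} k - d * c * ?w s k\<bar> = d * \<bar>u {s, - s} k - c * ?w s k\<bar>"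
        using \<open>d > 0\<close> by (simp add: abs_mult)
      also have "\<dots> < d * (c * \<epsilon>)"
        using c(2) that \<open>d > 0\<close> by (intro mult_strict_left_mono) (auto simp: U_def)
      finally show ?thesis by (simp add: mult.assoc)
    qed
    then have "cocycle_scale \<Gamma> d u \<in> U (d * c)"
      using c(2) cocycle_scale_in_cocycles[OF _ sub] by (auto simp: U_def)
    moreover have "d * c > 0" using c(1) \<open>d > 0\<close> by simp
    ultimately show "cocycle_scale \<Gamma> d u \<in> K" by (auto simp: K_def)
  qed
  have proper: "properly_discontinuous \<Gamma> (R_sig n) (affine_action n u)" if "u \<in> K" for u
  proof (rule properly_discontinuousI[OF sub disc n])
    obtain c where c: "c > 0" "u \<in> U c" using \<open>u \<in> K\<close> by (auto simp: K_def)
    fix M :: real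
    define M' where "M' = Kc * (real (4 * n - 1) * \<bar>M\<bar>)"
    define J0 where "J0 = 4 * M' / (c * c1) + 1"
    define N where "N = R * (2 * exp (\<kappa> * (J0 + 1))) * R"
    have bnd: "norm A \<le> N"
      if A: "A \<in> \<Union>\<Gamma>" and x: "\<forall>k\<le>4 * n - 2. \<bar>x k\<bar> \<le> M" and y: "\<forall>k\<le>4 * n - 2. \<bar>y k\<bar> \<le> M"
        and xy: "y = (\<lambda>i. sym_power (4 * n - 2) A x i + u {A, - A} i)" for A x y
    proof -
      have dA: "det A = 1" by (rule G.det_G[OF A])
      have "det (adj2 B0 ** A ** B0) = 1" using dA dB0 by (simp add: det_mul)
      then obtain \<theta> \<eta> L where L: "L \<ge> 0" "adj2 B0 ** A ** B0 = rot \<theta> ** flow L ** rot \<eta>"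
        using cartan_decomposition by blast
      have "A ** B0 = B0 ** (adj2 B0 ** A ** B0)"
        by (simp only: matrix_mul_assoc[symmetric] adj2_right(2)[OF dB0])
      then have AB: "A ** B0 = B0 ** rot \<theta> ** flow L ** rot \<eta>"
        unfolding L(2) by (simp only: matrix_mul_assoc)
      define B where "B = B0 ** rot \<theta>"
      have nB: "norm B \<le> R" by (simp add: B_def norm_mult_rot R_def)
      \<comment> \<open>The pairing with the image of \<open>x\<close> is read in the frame
        \<open>adj2 A ** B\<close>, whose norm is uncontrolled; sliding it by time \<open>L\<close>
        gives a rotated \<open>B0\<close>.\<close>
      have "adj2 A ** B ** flow L = B0 ** rot (- \<eta>)"
      proof -
        have "adj2 A ** B ** flow L = adj2 A ** (B0 ** rot \<theta> ** flow L ** rot \<eta>) ** adj2 (rot \<eta>)"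
          by (simp add: B_def matrix_mul_assoc[symmetric] adj2_right)
        also have "\<dots> = B0 ** rot (- \<eta>)"
          unfolding AB[symmetric] adj2_left(2)[OF dA] adj2_rot ..
        finally show ?thesis .
      qed
      then have nBL: "norm (adj2 A ** B ** flow L) \<le> R" by (simp add: norm_mult_rot R_def)
      define J where "J = nat \<lfloor>L / (2 * \<kappa>)\<rfloor>"
      have "L / (2 * \<kappa>) \<ge> 0" using L(1) I(3) by simp
      then have "real J \<le> L / (2 * \<kappa>)" "L / (2 * \<kappa>) \<le> real (Suc J)" by (simp_all add: J_def) linarith+
      then have J: "2 * \<kappa> * real J \<le> L" "L \<le> 2 * \<kappa> * real (Suc J)"
        using I(3) by (simp_all add: field_simps)
      define \<delta> where "\<delta> X = (\<lambda>i. u {X, - X} i + (- c) * ?w X i)" for X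
      have uc: "u \<in> cocycles n \<Gamma>" using c(2) by (simp add: U_def)
      have \<delta>_mult: "\<delta> (X ** Y) = (\<lambda>i. sym_power (4 * n - 2) X (\<delta> Y) i + \<delta> X i)"
        if "X \<in> \<Union>\<Gamma>" "Y \<in> \<Union>\<Gamma>" for X Y
        unfolding \<delta>_def cocycle_sum[OF uc sub n that] S.strip_cocycle_value_mult[OF that]
          sym_power_add sym_power_scale by (simp add: algebra_simps)
      have \<delta>_small: "\<bar>\<delta> X k\<bar> \<le> c * \<epsilon>"
        if "X \<in> \<Union>\<Gamma>" "norm X \<le> 2 * exp \<kappa> * R\<^sup>2" "k \<le> 4 * n - 2" for X k
        using c(2) that by (auto simp: \<delta>_def U_def S_def m_def less_imp_le)
      have dev: "\<bar>middle_coeff n B (\<delta> A)\<bar> \<le> real (Suc J) * (Kc * (real (4 * n - 1) * (c * \<epsilon>)))"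
        unfolding B_def by (rule S.middle_coeff_cocycle_bound[OF A AB J \<delta>_mult Kc(2) Kc(1) \<delta>_small])
      have pos: "middle_coeff n B (?w A) \<ge> real J * c1"
        unfolding B_def c1_def by (rule S.middle_coeff_strip_cocycle[OF A AB J(1)])
      have "u {A, - A} = (\<lambda>i. \<delta> A i + c * ?w A i)" by (simp add: \<delta>_def)
      then have u_eq: "middle_coeff n B (u {A, - A}) = middle_coeff n B (\<delta> A) + c * middle_coeff n B (?w A)"
        by (simp only: middle_coeff_add middle_coeff_scale)
      have "real (Suc J) * (Kc * (real (4 * n - 1) * (c * \<epsilon>))) = c * (real (Suc J) * (D * \<epsilon>))"
        by (simp add: D_def)
      also have "\<dots> \<le> c * (real (Suc J) * (c1 / 2))"
        using \<epsilon>(2) c(1) by (intro mult_left_mono) auto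
      finally have "middle_coeff n B (\<delta> A) \<ge> - (c * (real (Suc J) * (c1 / 2)))" using dev by linarith
      moreover have "c * middle_coeff n B (?w A) \<ge> c * (real J * c1)" using pos c(1) by (intro mult_left_mono) auto
      \<comment> \<open>There are \<open>J\<close> windows of gain but \<open>Suc J\<close> chain
        steps of loss, hence \<open>J - 1\<close>.\<close>
      moreover have "c * c1 * (real J - 1) / 2 = c * (real J * c1) - c * (real (Suc J) * (c1 / 2))"
        by (simp add: field_simps)
      ultimately have lower: "middle_coeff n B (u {A, - A}) \<ge> c * c1 * (real J - 1) / 2"
        unfolding u_eq by linarith
      have sum: "(\<Sum>k\<le>4 * n - 2. \<bar>z k\<bar>) \<le> real (4 * n - 1) * \<bar>M\<bar>" if "\<forall>k\<le>4 * n - 2. \<bar>z k\<bar> \<le> M" for z :: "nat \<Rightarrow> real"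
      proof -
        have "(\<Sum>k\<le>4 * n - 2. \<bar>z k\<bar>) \<le> real (card {..4 * n - 2}) * \<bar>M\<bar>"
          using that by (intro sum_bounded_above) fastforce
        moreover have "card {..4 * n - 2} = 4 * n - 1" using n by simp
        ultimately show ?thesis by simp
      qed
      have "middle_coeff n B y = middle_coeff n (adj2 A ** B) x + middle_coeff n B (u {A, - A})"
        unfolding xy middle_coeff_add middle_coeff_sym_power ..
      moreover have "middle_coeff n (adj2 A ** B) x = middle_coeff n (adj2 A ** B ** flow L) x"
        by (rule middle_coeff_flow[OF n, symmetric])
      moreover have "\<bar>middle_coeff n (adj2 A ** B ** flow L) x\<bar> \<le> M'"
        using Kc(2)[OF nBL, of x] mult_left_mono[OF sum[OF x] Kc(1)] by (simp add: M'_def)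
      moreover have "\<bar>middle_coeff n B y\<bar> \<le> M'"
        using Kc(2)[OF nB, of y] mult_left_mono[OF sum[OF y] Kc(1)] by (simp add: M'_def)
      ultimately have "c * c1 * (real J - 1) / 2 \<le> 2 * M'" using lower by linarith
      then have "(real J - 1) * (c * c1) \<le> 4 * M'" by (simp add: algebra_simps)
      moreover have "c * c1 > 0" using c(1) c1 by simp
      ultimately have "real J - 1 \<le> 4 * M' / (c * c1)" by (simp only: pos_le_divide_eq)
      then have "real J \<le> J0" by (simp add: J0_def)
      then have "2 * \<kappa> * real (Suc J) \<le> 2 * \<kappa> * (J0 + 1)" using I(3) by (intro mult_left_mono) auto
      then have L2: "L / 2 \<le> \<kappa> * (J0 + 1)" using J(2) by linarith
      have "A = (B ** flow L ** rot \<eta>) ** adj2 B0"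
      proof -
        have "(B ** flow L ** rot \<eta>) ** adj2 B0 = A ** (B0 ** adj2 B0)"
          unfolding B_def AB[symmetric] by (simp add: matrix_mul_assoc)
        then show ?thesis by (simp add: adj2_right[OF dB0])
      qed
      then have "norm A \<le> norm (B ** flow L ** rot \<eta>) * norm B0"
        using norm_mat2_mult_le[of "B ** flow L ** rot \<eta>" "adj2 B0"] by simp
      also have "\<dots> \<le> norm (B ** flow L) * R" by (simp add: norm_mult_rot R_def mult_left_mono)
      also have "\<dots> \<le> (norm B * norm (flow L)) * R"
        using R by (intro mult_right_mono norm_mat2_mult_le) auto
      also have "\<dots> \<le> N"
        unfolding N_def
      proof (intro mult_right_mono mult_mono nB)
        have "norm (flow L) \<le> 2 * exp (L / 2)" using norm_flow_le[of L] L(1) by simp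
        also have "\<dots> \<le> 2 * exp (\<kappa> * (J0 + 1))" using L2 by simp
        finally show "norm (flow L) \<le> 2 * exp (\<kappa> * (J0 + 1))" .
      qed (use R in auto)
      finally show ?thesis .
    qed
    show "\<exists>N. \<forall>A\<in>\<Union>\<Gamma>. \<forall>x y. (\<forall>k\<le>4 * n - 2. \<bar>x k\<bar> \<le> M) \<longrightarrow> (\<forall>k\<le>4 * n - 2. \<bar>y k\<bar> \<le> M) \<longrightarrow>
      y = (\<lambda>i. sym_power (4 * n - 2) A x i + u {A, - A} i) \<longrightarrow> norm A \<le> N"
      by (intro exI[of _ N] ballI allI impI, rule bnd, assumption+)
  qed
  show ?thesis by (intro exI[of _ K] conjI ballI ne op cone proper)
qed

section \<open>Groups with at most one limit point\<close>

text \<open>An eigenvalue of modulus above 1 on \<open>p\<close> would give a second eigendirection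
  contracted by the powers of \<open>A\<close>, hence a second limit point.\<close>

lemma (in discrete_SL2_group) no_expanded_lim_dir:
  assumes p: "p \<in> lim_dirs G" and line: "\<And>q. q \<in> lim_dirs G \<Longrightarrow> wedge p q = 0"
    and A: "A \<in> G" "A *v p = l *\<^sub>R p"
  shows "\<bar>l\<bar> \<le> 1"
proof (rule ccontr)
  assume "\<not> \<bar>l\<bar> \<le> 1"
  then have l: "\<bar>l\<bar> > 1" "l \<noteq> 0" by auto
  have dA: "det A = 1" by (rule det_G[OF A(1)])
  have p0: "p \<noteq> 0" using p by (rule nonzero_lim_dirs)
  define v where "v = vec2 (- p$2) (p$1)"
  \<comment> \<open>By Cayley-Hamilton the image of \<open>A - l\<close> consists of eigenvectors
    for the other eigenvalue \<open>1 / l\<close>.\<close>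
  define q where "q = A *v v - l *\<^sub>R v"
  have pv: "wedge p v \<noteq> 0"
  proof -
    have "wedge p v = (norm p)\<^sup>2" unfolding norm_vec2_sq by (simp add: wedge_def v_def power2_eq_square)
    then show ?thesis using p0 by simp
  qed
  have "l * wedge p (A *v v) = wedge (A *v p) (A *v v)"
    unfolding A(2) by (simp add: wedge_def algebra_simps)
  also have "\<dots> = wedge p v" by (simp add: wedge_mult dA)
  finally have 1: "wedge p (A *v v) = wedge p v / l" using l(2) by (simp add: field_simps)
  have "wedge p q = wedge p (A *v v) - l * wedge p v" by (simp add: q_def wedge_def algebra_simps)
  also have "\<dots> = wedge p v * (1 / l - l)" unfolding 1 by (simp add: algebra_simps)
  finally have wq: "wedge p q = wedge p v * (1 / l - l)" .
  have "1 / l - l \<noteq> 0"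
  proof
    assume "1 / l - l = 0"
    then have "l * l = 1" using l(2) by (simp add: field_simps)
    then have "\<bar>l\<bar> * \<bar>l\<bar> = 1" by (simp flip: abs_mult)
    moreover have "1 * 1 < \<bar>l\<bar> * \<bar>l\<bar>" using l(1) by (intro mult_strict_mono) auto
    ultimately show False by simp
  qed
  then have wq0: "wedge p q \<noteq> 0" using wq pv by simp
  have eig: "A *v q = (1 / l) *\<^sub>R q"
  proof -
    have e: "A$1$1 * p$1 + A$1$2 * p$2 = l * p$1" "A$2$1 * p$1 + A$2$2 * p$2 = l * p$2"
      using A(2) by (simp_all add: vec2_eq_iff mat2_vec_nth)
    have d: "A$1$1 * A$2$2 - A$1$2 * A$2$1 = 1" using dA by (simp add: det_2)
    have "p$1 * (1 - l * (A$1$1 + A$2$2) + l\<^sup>2) = 0" "p$2 * (1 - l * (A$1$1 + A$2$2) + l\<^sup>2) = 0"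
      using e d by algebra+
    then have "1 - l * (A$1$1 + A$2$2) + l\<^sup>2 = 0" using p0 by (auto simp: vec2_eq_iff)
    then have "l * (A *v q)$1 = q$1" "l * (A *v q)$2 = q$2"
      using d unfolding q_def mat2_vec_nth vector_minus_component vector_scaleR_component real_scaleR_def by algebra+
    then show ?thesis using l(2) by (simp add: vec2_eq_iff field_simps)
  qed
  have pow: "\<exists>B\<in>G. B *v q = (1 / l) ^ k *\<^sub>R q" for k
  proof (induction k)
    case 0
    show ?case using one_G by (intro bexI[of _ "mat 1"]) auto
  next
    case (Suc k)
    then obtain B where B: "B \<in> G" "B *v q = (1 / l) ^ k *\<^sub>R q" by blast
    have "(A ** B) *v q = A *v (B *v q)" by (simp add: matrix_vector_mul_assoc)
    also have "\<dots> = (1 / l) ^ k *\<^sub>R (A *v q)"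
      unfolding B(2) by (simp add: vec2_eq_iff mat2_vec_nth algebra_simps)
    also have "\<dots> = (1 / l) ^ Suc k *\<^sub>R q" by (simp add: eig)
    finally show ?case using mult_G[OF A(1) B(1)] by blast
  qed
  have "q \<in> lim_dirs G"
    unfolding lim_dirs_def
  proof (intro CollectI conjI allI impI)
    show q0: "q \<noteq> 0" using wq0 by (auto simp: wedge_def)
    fix \<epsilon> :: real assume \<epsilon>: "\<epsilon> > 0"
    have "1 / \<bar>l\<bar> < 1" using l(1) by simp
    moreover have "\<epsilon> / norm q > 0" using \<epsilon> q0 by simp
    ultimately obtain k where "(1 / \<bar>l\<bar>) ^ k < \<epsilon> / norm q" using real_arch_pow_inv by blast
    then have k: "(1 / \<bar>l\<bar>) ^ k * norm q < \<epsilon>" using q0 by (simp add: pos_less_divide_eq)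
    obtain B where B: "B \<in> G" "B *v q = (1 / l) ^ k *\<^sub>R q" using pow by blast
    have "norm (B *v q) = (1 / \<bar>l\<bar>) ^ k * norm q" by (simp add: B(2) power_abs)
    also have "\<dots> < \<epsilon> * 1" using k by simp
    also have "\<dots> \<le> \<epsilon> * norm B" using norm_SL2_ge_1[OF det_G[OF B(1)]] \<epsilon> by (intro mult_left_mono) auto
    finally show "\<exists>B\<in>G. norm (B *v q) < \<epsilon> * norm B" using B(1) by blast
  qed
  then show False using line wq0 by blast
qed

locale parabolic_group = discrete_SL2_group +
  fixes p :: "real^2"
  assumes p: "p \<in> lim_dirs G" and line: "\<And>q. q \<in> lim_dirs G \<Longrightarrow> wedge p q = 0"
begin

definition P :: "real^2^2" where
  "P = mat2 (p$1) (- p$2 / (norm p)\<^sup>2) (p$2) (p$1 / (norm p)\<^sup>2)"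

text \<open>In the basis \<open>P\<close>, whose first vector is \<open>p\<close>, the group consists of matrices
  \<open>\<plusminus> (1 s; 0 1)\<close>.\<close>

definition conj_P :: "real^2^2 \<Rightarrow> real^2^2" where
  "conj_P A = adj2 P ** A ** P"

text \<open>The product cancels the common sign of the two entries, leaving the translation length
  \<open>s\<close> itself, unchanged under \<open>A \<mapsto> - A\<close>.\<close>

definition shear :: "real^2^2 \<Rightarrow> real" where
  "shear A = conj_P A$1$1 * conj_P A$1$2"

lemma det_P: "det P = 1"
proof -
  have p0: "(norm p)\<^sup>2 \<noteq> 0" using nonzero_lim_dirs[OF p] by simp
  have "det P = ((p$1)\<^sup>2 + (p$2)\<^sup>2) / (norm p)\<^sup>2"
    by (simp add: P_def det_2 power2_eq_square add_divide_distrib)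
  then show ?thesis unfolding norm_vec2_sq[symmetric] using p0 by simp
qed

text \<open>Every element maps the only limit direction to itself, and neither it nor its inverse
  expands that direction, so the eigenvalue has modulus 1.\<close>

lemma eigenvector:
  assumes "A \<in> G"
  obtains l where "A *v p = l *\<^sub>R p" "l\<^sup>2 = 1"
proof -
  have p0: "p \<noteq> 0" using p by (rule nonzero_lim_dirs)
  have ex: "\<exists>c. B *v p = c *\<^sub>R p" if "B \<in> G" for B
    using line[OF lim_dirs_invariant[OF p that]] wedge_zero_iff[OF p0] by blast
  obtain l where l: "A *v p = l *\<^sub>R p" using ex[OF assms] by blast
  obtain k where k: "adj2 A *v p = k *\<^sub>R p" using ex[OF adj2_G[OF assms]] by blast
  have "\<bar>l\<bar> \<le> 1" by (rule no_expanded_lim_dir[OF p line assms l])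
  have "\<bar>k\<bar> \<le> 1" by (rule no_expanded_lim_dir[OF p line adj2_G[OF assms] k])
  have "p = adj2 A *v (A *v p)" using adj2_left(3)[OF det_G[OF assms]] by simp
  also have "\<dots> = (l * k) *\<^sub>R p"
    unfolding l using k by (simp add: vec2_eq_iff mat2_vec_nth algebra_simps flip: distrib_left)
  finally have "(1 - l * k) *\<^sub>R p = 0" by (simp add: algebra_simps)
  then have "l * k = 1" using p0 by simp
  then have "\<bar>l\<bar> * \<bar>k\<bar> = 1" by (simp flip: abs_mult)
  moreover have "\<bar>l\<bar> * \<bar>k\<bar> \<le> \<bar>l\<bar> * 1" using \<open>\<bar>k\<bar> \<le> 1\<close> by (intro mult_left_mono) auto
  ultimately have "\<bar>l\<bar> = 1" using \<open>\<bar>l\<bar> \<le> 1\<close> by linarith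
  then have "l\<^sup>2 = 1" by (simp add: abs_square_eq_1)
  then show thesis using l that by blast
qed

lemma conj_P_entries:
  assumes "A \<in> G"
  shows "conj_P A$2$1 = 0" "(conj_P A$1$1)\<^sup>2 = 1" "conj_P A$2$2 = conj_P A$1$1"
    "A *v p = conj_P A$1$1 *\<^sub>R p"
proof -
  obtain l where l: "A *v p = l *\<^sub>R p" "l\<^sup>2 = 1" using eigenvector[OF assms] .
  have Pe: "P *v vec2 1 0 = p" by (simp add: P_def mat2_simps)
  have "conj_P A *v vec2 1 0 = adj2 P *v (A *v p)"
    by (simp add: conj_P_def matrix_vector_mul_assoc[symmetric] Pe)
  also have "\<dots> = l *\<^sub>R (adj2 P *v (P *v vec2 1 0))"
    unfolding l(1) Pe by (simp add: vec2_eq_iff mat2_vec_nth algebra_simps)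
  also have "\<dots> = l *\<^sub>R vec2 1 0" using adj2_left(3)[OF det_P] by simp
  finally have 1: "conj_P A$1$1 = l" and 2: "conj_P A$2$1 = 0"
    by (simp_all add: vec2_eq_iff mat2_vec_nth)
  show "conj_P A$2$1 = 0" by (rule 2)
  show l1: "(conj_P A$1$1)\<^sup>2 = 1" using 1 l(2) by simp
  have "det (conj_P A) = 1" using det_P det_G[OF assms] by (simp add: conj_P_def det_mul)
  then have "conj_P A$1$1 * conj_P A$2$2 = 1" using 2 by (simp add: det_2)
  then show "conj_P A$2$2 = conj_P A$1$1" using l1 by algebra
  show "A *v p = conj_P A$1$1 *\<^sub>R p" using l(1) 1 by simp
qed

lemma shear_mult:
  assumes "A \<in> G" "B \<in> G"
  shows "shear (A ** B) = shear A + shear B"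
proof -
  have "conj_P (A ** B) = conj_P A ** conj_P B"
    by (simp add: conj_P_def matrix_mul_assoc[symmetric] adj2_right(2)[OF det_P])
  then have "shear (A ** B) = (conj_P A$1$1 * conj_P B$1$1 + conj_P A$1$2 * conj_P B$2$1)
      * (conj_P A$1$1 * conj_P B$1$2 + conj_P A$1$2 * conj_P B$2$2)"
    by (simp add: shear_def mat2_mult_nth)
  also have "\<dots> = (conj_P A$1$1)\<^sup>2 * shear B + (conj_P B$1$1)\<^sup>2 * shear A"
    unfolding conj_P_entries(1,3)[OF assms(2)] shear_def by algebra
  finally show ?thesis using conj_P_entries(2)[OF assms(1)] conj_P_entries(2)[OF assms(2)] by simp
qed

lemma shear_one [simp]: "shear (mat 1) = 0"
  using shear_mult[OF one_G one_G] by simp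

lemma shear_adj2:
  assumes "A \<in> G"
  shows "shear (adj2 A) = - shear A"
  using shear_mult[OF adj2_G[OF assms] assms] adj2_left(1)[OF det_G[OF assms]] by simp

lemma conj_P_inverse: "P ** conj_P A ** adj2 P = A"
proof -
  have "P ** conj_P A ** adj2 P = (P ** (adj2 P ** A)) ** (P ** adj2 P)"
    by (simp add: conj_P_def matrix_mul_assoc)
  then show ?thesis using adj2_right[OF det_P] by simp
qed

lemma norm_le_shear:
  assumes "A \<in> G"
  shows "norm A \<le> (norm P)\<^sup>2 * (2 + \<bar>shear A\<bar>)"
proof -
  have "\<bar>conj_P A$1$1\<bar> = 1" using conj_P_entries(2)[OF assms] by (simp add: abs_square_eq_1)
  then have "\<bar>conj_P A$1$2\<bar> = \<bar>shear A\<bar>" by (simp add: shear_def abs_mult)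
  then have s: "(conj_P A$1$2)\<^sup>2 = (shear A)\<^sup>2" by (metis power2_abs)
  have "(norm (conj_P A))\<^sup>2 = 2 + (shear A)\<^sup>2"
    unfolding norm_mat2_sq conj_P_entries(1,3)[OF assms] s using conj_P_entries(2)[OF assms] by simp
  also have "\<dots> \<le> (2 + \<bar>shear A\<bar>)\<^sup>2" by (simp add: power2_sum)
  finally have c: "norm (conj_P A) \<le> 2 + \<bar>shear A\<bar>" by (rule power2_le_imp_le) simp
  have "norm A \<le> norm (P ** conj_P A) * norm P"
    using norm_mat2_mult_le[of "P ** conj_P A" "adj2 P"] by (simp add: conj_P_inverse)
  also have "\<dots> \<le> (norm P * norm (conj_P A)) * norm P"
    by (intro mult_right_mono norm_mat2_mult_le) auto
  also have "\<dots> \<le> (norm P * (2 + \<bar>shear A\<bar>)) * norm P"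
    using c by (intro mult_right_mono mult_left_mono) auto
  finally show ?thesis by (simp add: power2_eq_square mult_ac)
qed

lemma finite_shear_ball: "finite {A \<in> G. \<bar>shear A\<bar> \<le> C}"
proof (rule finite_subset[OF _ finite_ball])
  show "{A \<in> G. \<bar>shear A\<bar> \<le> C} \<subseteq> {A \<in> G. norm A \<le> (norm P)\<^sup>2 * (2 + C)}"
  proof
    fix A assume A: "A \<in> {A \<in> G. \<bar>shear A\<bar> \<le> C}"
    then have "norm A \<le> (norm P)\<^sup>2 * (2 + \<bar>shear A\<bar>)" using norm_le_shear by blast
    also have "\<dots> \<le> (norm P)\<^sup>2 * (2 + C)" using A by (intro mult_left_mono) auto
    finally show "A \<in> {A \<in> G. norm A \<le> (norm P)\<^sup>2 * (2 + C)}" using A by blast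
  qed
qed

lemma shear_zero:
  assumes "A \<in> G" "shear A = 0"
  shows "A = mat 1 \<or> A = - mat 1"
proof -
  have c: "conj_P A$1$1 = 1 \<or> conj_P A$1$1 = - 1"
    using conj_P_entries(2)[OF assms(1)] by (simp add: power2_eq_1_iff)
  then have "conj_P A$1$2 = 0" using assms(2) by (auto simp: shear_def)
  then have "conj_P A = mat 1 \<or> conj_P A = - mat 1"
    using c conj_P_entries(1,3)[OF assms(1)] by (auto simp: mat2_eq_iff)
  moreover have "P ** - mat 1 ** adj2 P = - mat 1"
    using adj2_right(1)[OF det_P] by (simp add: mat2_simps)
  ultimately show ?thesis using conj_P_inverse[of A] adj2_right(1)[OF det_P] by auto
qed

lemma ex_minimal_shear:
  assumes "infinite G"
  obtains A where "A \<in> G" "shear A > 0" "\<And>B. B \<in> G \<Longrightarrow> shear B > 0 \<Longrightarrow> shear A \<le> shear B"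
proof -
  have "\<exists>A\<in>G. shear A \<noteq> 0"
  proof (rule ccontr)
    assume "\<not> ?thesis"
    then have "G \<subseteq> {mat 1, - mat 1}" using shear_zero by blast
    then show False using assms finite_subset by blast
  qed
  then obtain A1 where A1: "A1 \<in> G" "shear A1 \<noteq> 0" by blast
  define A2 where "A2 = (if shear A1 > 0 then A1 else adj2 A1)"
  have A2: "A2 \<in> G" "shear A2 > 0" using A1 adj2_G shear_adj2 by (auto simp: A2_def)
  define S where "S = {A \<in> G. 0 < shear A \<and> shear A \<le> shear A2}"
  have "S \<subseteq> {A \<in> G. \<bar>shear A\<bar> \<le> shear A2}" by (auto simp: S_def)
  then have S: "finite S" using finite_shear_ball finite_subset by blast
  have "S \<noteq> {}" using A2 by (auto simp: S_def)
  define A where "A = arg_min_on shear S"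
  have A: "A \<in> S" "\<And>B. B \<in> S \<Longrightarrow> shear A \<le> shear B"
    using arg_min_if_finite[OF S \<open>S \<noteq> {}\<close>, of shear] unfolding A_def by (auto simp: not_less)
  show thesis
  proof
    show "A \<in> G" "shear A > 0" using A(1) by (auto simp: S_def)
    fix B assume B: "B \<in> G" "shear B > 0"
    show "shear A \<le> shear B"
    proof (cases "shear B \<le> shear A2")
      case True
      then show ?thesis using A(2) B by (auto simp: S_def)
    next
      case False
      then show ?thesis using A(1) by (auto simp: S_def)
    qed
  qed
qed

text \<open>Modulo sign the group is cyclic, generated by \<open>A0\<close>; the proof uses division
  with remainder. The defect \<open>\<psi>\<close> vanishes at \<open>A0\<close> and at both
  \<open>mat 1\<close> and \<open>- mat 1\<close>, and subtracting multiples of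
  \<open>shear A0\<close> leads to shear zero.\<close>

lemma additive_proportional_shear:
  fixes \<phi> :: "real^2^2 \<Rightarrow> real"
  assumes A0: "A0 \<in> G" "shear A0 > 0" "\<And>B. B \<in> G \<Longrightarrow> shear B > 0 \<Longrightarrow> shear A0 \<le> shear B"
    and add: "\<And>A B. A \<in> G \<Longrightarrow> B \<in> G \<Longrightarrow> \<phi> (A ** B) = \<phi> A + \<phi> B"
    and A: "A \<in> G"
  shows "\<phi> A * shear A0 = shear A * \<phi> A0"
proof -
  define \<psi> where "\<psi> A = \<phi> A * shear A0 - shear A * \<phi> A0" for A
  have \<psi>: "\<psi> (A ** B) = \<psi> A + \<psi> B" if "A \<in> G" "B \<in> G" for A B
    using add[OF that] shear_mult[OF that] by (simp add: \<psi>_def algebra_simps)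
  have one: "\<psi> (mat 1) = 0" using \<psi>[OF one_G one_G] by simp
  have "- mat 1 ** - mat 1 = (mat 1 :: real^2^2)" by (simp add: mat_neg_mult)
  then have minus_one: "\<psi> (- mat 1) = 0"
    using \<psi>[OF uminus_G[OF one_G] uminus_G[OF one_G]] one by simp
  have inv: "\<psi> (adj2 A) = - \<psi> A" if "A \<in> G" for A
    using \<psi>[OF adj2_G[OF that] that] adj2_left(1)[OF det_G[OF that]] one by simp
  have A00: "\<psi> A0 = 0" by (simp add: \<psi>_def)
  have nn: "\<psi> A = 0" if "A \<in> G" "0 \<le> shear A" "shear A < real k * shear A0" for A k
    using that
  proof (induction k arbitrary: A)
    case (Suc k)
    show ?case
    proof (cases "shear A < shear A0")
      case True
      then have "shear A = 0" using A0(3)[OF Suc.prems(1)] Suc.prems(2) by force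
      then show ?thesis using shear_zero[OF Suc.prems(1)] one minus_one by auto
    next
      case False
      let ?B = "adj2 A0 ** A"
      have B: "?B \<in> G" using A0(1) Suc.prems(1) adj2_G mult_G by blast
      have "shear ?B = shear A - shear A0"
        using shear_mult[OF adj2_G[OF A0(1)] Suc.prems(1)] shear_adj2[OF A0(1)] by simp
      then have "\<psi> ?B = 0" using False Suc.prems(3) by (intro Suc.IH[OF B]) (auto simp: algebra_simps)
      then show ?thesis using \<psi>[OF adj2_G[OF A0(1)] Suc.prems(1)] inv[OF A0(1)] A00 by simp
    qed
  qed simp
  have pos: "\<psi> A = 0" if "A \<in> G" "0 \<le> shear A" for A
  proof -
    obtain k :: nat where "shear A / shear A0 < real k" using reals_Archimedean2 by blast
    then have "shear A < real k * shear A0" using A0(2) by (simp add: pos_divide_less_eq)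
    then show ?thesis using nn that by blast
  qed
  have "\<psi> A = 0"
  proof (cases "shear A \<ge> 0")
    case False
    then have "\<psi> (adj2 A) = 0" using shear_adj2[OF A] by (intro pos adj2_G[OF A]) simp
    then show ?thesis using inv[OF A] by simp
  qed (use pos A in blast)
  then show ?thesis by (simp add: \<psi>_def)
qed

text \<open>Evaluation at the fixed direction is an invariant functional, since it pairs with the
  \<open>m\<close>-th power of \<open>p\<close>.\<close>

definition fixed_eval :: "nat \<Rightarrow> (nat \<Rightarrow> real) \<Rightarrow> real" where
  "fixed_eval m x = sym_eval m x (- p$2) (p$1)"

text \<open>The vector perpendicular to \<open>p\<close> is an eigenvector of the transpose with
  eigenvalue 1 or -1, and the even degree removes the sign.\<close>

lemma fixed_eval_sym_power:
  assumes "even m" "A \<in> G"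
  shows "fixed_eval m (sym_power m A x) = fixed_eval m x"
proof -
  define l where "l = conj_P A$1$1"
  have l2: "l\<^sup>2 = 1" and Ap: "A *v p = l *\<^sub>R p" using conj_P_entries(2,4)[OF assms(2)] by (auto simp: l_def)
  have d: "A$1$1 * A$2$2 - A$1$2 * A$2$1 = 1" using det_G[OF assms(2)] by (simp add: det_2)
  have e: "A$1$1 * p$1 + A$1$2 * p$2 = l * p$1" "A$2$1 * p$1 + A$2$2 * p$2 = l * p$2"
    using Ap by (simp_all add: vec2_eq_iff mat2_vec_nth)
  have "A$1$1 * (- p$2) + A$2$1 * p$1 = l * (- p$2)" "A$1$2 * (- p$2) + A$2$2 * p$1 = l * p$1"
    using l2 d e by algebra+
  then have "fixed_eval m (sym_power m A x) = sym_eval m x (l * (- p$2)) (l * p$1)"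
    by (simp add: fixed_eval_def sym_eval_sym_power)
  also have "\<dots> = l ^ m * fixed_eval m x"
    unfolding fixed_eval_def sym_eval_def sum_distrib_left
  proof (intro sum.cong refl)
    fix k assume "k \<in> {..m}"
    then have m: "l ^ m = l ^ (m - k) * l ^ k" by (simp flip: power_add)
    show "x k * (l * - p$2) ^ (m - k) * (l * p$1) ^ k = l ^ m * (x k * (- p$2) ^ (m - k) * p$1 ^ k)"
      unfolding power_mult_distrib m by (simp only: mult_ac)
  qed
  also have "l ^ m = 1" using l2 assms(1) by (metis dvdE power_mult power_one)
  finally show ?thesis by simp
qed

lemma fixed_eval_add: "fixed_eval m (\<lambda>i. x i + y i) = fixed_eval m x + fixed_eval m y"
  by (simp add: fixed_eval_def sym_eval_def sum.distrib algebra_simps)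

lemma fixed_eval_scale: "fixed_eval m (\<lambda>i. c * x i) = c * fixed_eval m x"
  by (simp add: fixed_eval_def sym_eval_def sum_distrib_left mult_ac)

lemma fixed_eval_sum: "fixed_eval m (\<lambda>i. \<Sum>s\<in>S. c s * v s i) = (\<Sum>s\<in>S. c s * fixed_eval m (v s))"
proof -
  have "fixed_eval m (\<lambda>i. \<Sum>s\<in>S. c s * v s i) = (\<Sum>k\<le>m. \<Sum>s\<in>S. c s * (v s k * (- p$2) ^ (m - k) * p$1 ^ k))"
    by (simp add: fixed_eval_def sym_eval_def sum_distrib_right mult.assoc)
  then show ?thesis
    by (subst (asm) sum.swap) (simp add: fixed_eval_def sym_eval_def sum_distrib_left)
qed

lemma fixed_eval_bound:
  obtains K where "K \<ge> 0" "\<And>x M. \<forall>k\<le>m. \<bar>x k\<bar> \<le> M \<Longrightarrow> \<bar>fixed_eval m x\<bar> \<le> K * M"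
proof
  define K where "K = (\<Sum>k\<le>m. \<bar>(- p$2) ^ (m - k) * p$1 ^ k\<bar>)"
  show "K \<ge> 0" by (simp add: K_def sum_nonneg)
  fix x :: "nat \<Rightarrow> real" and M assume x: "\<forall>k\<le>m. \<bar>x k\<bar> \<le> M"
  have "\<bar>fixed_eval m x\<bar> \<le> (\<Sum>k\<le>m. \<bar>x k * ((- p$2) ^ (m - k) * p$1 ^ k)\<bar>)"
    unfolding fixed_eval_def sym_eval_def mult.assoc by (rule sum_abs)
  also have "\<dots> \<le> (\<Sum>k\<le>m. M * \<bar>(- p$2) ^ (m - k) * p$1 ^ k\<bar>)"
    using x by (intro sum_mono) (simp add: abs_mult mult_right_mono)
  finally show "\<bar>fixed_eval m x\<bar> \<le> K * M" by (simp add: K_def sum_distrib_left mult.commute)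
qed

text \<open>The parabolic analogue of a strip sum: the half-plane is replaced by the half-line of
  elements whose shear does not exceed that of \<open>Y\<close>.\<close>

definition shear_cocycle_value :: "nat \<Rightarrow> real^2^2 \<Rightarrow> nat \<Rightarrow> real" where
  "shear_cocycle_value m A = jump_sum m G (\<lambda>Y A. of_bool (shear (adj2 Y ** A) \<le> 0))
    (pure_power m (P$1$2) (P$2$2)) (mat 1) A"

lemma finite_shear_jump:
  assumes "A \<in> G" "B \<in> G"
  shows "finite {X \<in> G. of_bool (shear (adj2 A ** X) \<le> 0) \<noteq> (of_bool (shear (adj2 B ** X) \<le> 0) :: real)}"
proof (rule finite_subset[OF _ finite_shear_ball])
  show "{X \<in> G. of_bool (shear (adj2 A ** X) \<le> 0) \<noteq> (of_bool (shear (adj2 B ** X) \<le> 0) :: real)}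
      \<subseteq> {X \<in> G. \<bar>shear X\<bar> \<le> \<bar>shear A\<bar> + \<bar>shear B\<bar>}"
    using shear_mult[OF adj2_G] shear_adj2 assms by auto
qed

lemma shear_cocycle_value_mult:
  assumes "A \<in> G" "B \<in> G"
  shows "shear_cocycle_value m (A ** B)
    = (\<lambda>i. sym_power m A (shear_cocycle_value m B) i + shear_cocycle_value m A i)"
proof -
  let ?h = "\<lambda>Y A. of_bool (shear (adj2 Y ** A) \<le> 0) :: real"
  let ?J = "jump_sum m G ?h (pure_power m (P$1$2) (P$2$2))"
  have "?J (mat 1) (A ** B) = (\<lambda>i. ?J (mat 1) A i + ?J A (A ** B) i)"
    by (intro jump_sum_add finite_shear_jump one_G assms mult_G)
  moreover have "?J (A ** mat 1) (A ** B) = sym_power m A (?J (mat 1) B)"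
    by (rule jump_sum_equivariant[OF assms(1)])
      (simp add: adj2_mult matrix_mul_assoc[symmetric] adj2_left[OF det_G[OF assms(1)]])
  ultimately show ?thesis by (simp add: shear_cocycle_value_def add.commute)
qed

text \<open>The chosen vector evaluates to 1 and evaluation is invariant, so the pairing counts the
  \<open>X\<close> with \<open>0 < shear X \<le> shear A\<close>, among them \<open>A\<close>
  itself.\<close>

lemma fixed_eval_shear_cocycle:
  assumes "even m" "A \<in> G" "shear A > 0"
  shows "fixed_eval m (shear_cocycle_value m A) > 0"
proof -
  let ?h = "\<lambda>Y A. of_bool (shear (adj2 Y ** A) \<le> 0) :: real"
  let ?S = "{X \<in> G. ?h (mat 1) X \<noteq> ?h A X}"
  have sh: "shear (adj2 A ** X) = shear X - shear A" if "X \<in> G" for X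
    using shear_mult[OF adj2_G[OF assms(2)] that] shear_adj2[OF assms(2)] by simp
  have "fixed_eval m (pure_power m (P$1$2) (P$2$2)) = (det P) ^ m"
    by (simp add: fixed_eval_def sym_eval_pure_power P_def det_2 algebra_simps)
  then have v: "fixed_eval m (pure_power m (P$1$2) (P$2$2)) = 1" by (simp add: det_P)
  have "fixed_eval m (shear_cocycle_value m A) = (\<Sum>X\<in>?S. ?h A X - ?h (mat 1) X)"
    unfolding shear_cocycle_value_def jump_sum_def fixed_eval_sum
    by (intro sum.cong refl) (simp add: fixed_eval_sym_power[OF assms(1)] v)
  also have "\<dots> > 0"
  proof (rule sum_pos2)
    show "finite ?S" by (rule finite_shear_jump[OF one_G assms(2)])
    show "A \<in> ?S" using assms(2,3) sh[OF assms(2)] by simp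
    show "?h A A - ?h (mat 1) A > 0" using assms(3) sh[OF assms(2)] by simp
    show "?h A X - ?h (mat 1) X \<ge> 0" if "X \<in> ?S" for X
      using that assms(3) sh[of X] by auto
  qed
  finally show ?thesis .
qed

end

text \<open>The hull of a single limit point is empty, so compactness of the core cannot exclude
  this case. The invariant functional turns a cocycle into a homomorphism, necessarily proportional
  to \<open>shear\<close>. If it is positive at \<open>A0\<close>, bounded pairings bound the shear
  and thus the norm; this positivity is an open cone condition.\<close>

lemma exists_cone_one_limit_point:
  assumes n: "n \<ge> 1" and sub: "subgroup \<Gamma> PSL2" and disc: "discrete_in_PSL2 \<Gamma>"
    and inf: "infinite (\<Union>\<Gamma>)"
    and p: "p \<in> lim_dirs (\<Union>\<Gamma>)" "\<And>q. q \<in> lim_dirs (\<Union>\<Gamma>) \<Longrightarrow> wedge p q = 0"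
  shows "\<exists>K. K \<noteq> {} \<and> openin (cocycle_space n \<Gamma>) K \<and> cocycle_cone \<Gamma> K \<and>
    (\<forall>u\<in>K. properly_discontinuous \<Gamma> (R_sig n) (affine_action n u))"
proof -
  interpret G: discrete_SL2_group "\<Union>\<Gamma>" by (rule discrete_SL2_group_Union[OF sub disc])
  interpret parabolic_group "\<Union>\<Gamma>" p by unfold_locales (use p in auto)
  define m where "m = 4 * n - 2"
  have even: "even m" using n by (auto simp: m_def)
  obtain A0 where A0: "A0 \<in> \<Union>\<Gamma>" "shear A0 > 0" "\<And>B. B \<in> \<Union>\<Gamma> \<Longrightarrow> shear B > 0 \<Longrightarrow> shear A0 \<le> shear B"
    using ex_minimal_shear[OF inf] by blast
  have zero: "shear_cocycle_value (4 * n - 2) A j = 0" if "j > 4 * n - 2" for A j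
    unfolding shear_cocycle_value_def by (rule jump_sum_zero[OF that])
  obtain u0 where u0: "u0 \<in> cocycles n \<Gamma>" "\<And>A. A \<in> \<Union>\<Gamma> \<Longrightarrow> u0 {A, - A} = shear_cocycle_value (4 * n - 2) A"
    using cocycle_of_matrices[OF sub n shear_cocycle_value_mult zero] by blast
  define K where "K = {u \<in> cocycles n \<Gamma>. fixed_eval m (u {A0, - A0}) > 0}"
  have "fixed_eval m (u0 {A0, - A0}) > 0"
    unfolding u0(2)[OF A0(1)] m_def[symmetric] by (rule fixed_eval_shear_cocycle[OF even A0(1,2)])
  then have ne: "K \<noteq> {}" using u0(1) by (auto simp: K_def)
  have g0: "{A0, - A0} \<in> \<Gamma>" using A0(1) unfolding mem_Union_PSL2_iff[OF sub] .
  have "continuous_map (cocycle_space n \<Gamma>) euclideanreal (\<lambda>u. fixed_eval m (u {A0, - A0}))"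
    unfolding fixed_eval_def sym_eval_def
    by (intro continuous_map_sum continuous_map_real_mult_right continuous_map_cocycle_eval g0) simp
  then have "openin (cocycle_space n \<Gamma>)
      {u \<in> topspace (cocycle_space n \<Gamma>). fixed_eval m (u {A0, - A0}) \<in> {0<..}}"
    by (intro openin_continuous_map_preimage) auto
  then have op: "openin (cocycle_space n \<Gamma>) K" by (simp add: topspace_cocycle_space K_def)
  have cone: "cocycle_cone \<Gamma> K"
    unfolding cocycle_cone_def K_def
    by (auto simp: cocycle_scale_in_cocycles[OF _ sub] cocycle_scale_eval[OF sub A0(1)] fixed_eval_scale)
  have proper: "properly_discontinuous \<Gamma> (R_sig n) (affine_action n u)" if "u \<in> K" for u
  proof (rule properly_discontinuousI[OF sub disc n])
    fix M :: real
    obtain Kb where Kb: "Kb \<ge> 0" "\<And>x M. \<forall>k\<le>m. \<bar>x k\<bar> \<le> M \<Longrightarrow> \<bar>fixed_eval m x\<bar> \<le> Kb * M"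
      using fixed_eval_bound[of m] by blast
    define \<phi> where "\<phi> A = fixed_eval m (u {A, - A})" for A
    have u: "u \<in> cocycles n \<Gamma>" "\<phi> A0 > 0" using that by (auto simp: K_def \<phi>_def)
    have add: "\<phi> (A ** B) = \<phi> A + \<phi> B" if "A \<in> \<Union>\<Gamma>" "B \<in> \<Union>\<Gamma>" for A B
      unfolding \<phi>_def cocycle_sum[OF u(1) sub n that] m_def[symmetric] fixed_eval_add
        fixed_eval_sym_power[OF even that(1)] by simp
    define N where "N = (norm P)\<^sup>2 * (2 + 2 * Kb * M * shear A0 / \<phi> A0)"
    have bnd: "norm A \<le> N"
      if A: "A \<in> \<Union>\<Gamma>" and x: "\<forall>k\<le>4 * n - 2. \<bar>x k\<bar> \<le> M" and y: "\<forall>k\<le>4 * n - 2. \<bar>y k\<bar> \<le> M"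
        and xy: "y = (\<lambda>i. sym_power (4 * n - 2) A x i + u {A, - A} i)" for A x y
    proof -
      have "fixed_eval m y = fixed_eval m x + \<phi> A"
        unfolding xy m_def[symmetric] fixed_eval_add fixed_eval_sym_power[OF even A] \<phi>_def ..
      moreover have "\<bar>fixed_eval m x\<bar> \<le> Kb * M" "\<bar>fixed_eval m y\<bar> \<le> Kb * M"
        using Kb(2) x y by (simp_all add: m_def)
      ultimately have "\<bar>\<phi> A\<bar> \<le> 2 * Kb * M" by linarith
      then have "\<bar>\<phi> A\<bar> * shear A0 \<le> 2 * Kb * M * shear A0" using A0(2) by (intro mult_right_mono) auto
      moreover have "\<phi> A * shear A0 = shear A * \<phi> A0"
        by (rule additive_proportional_shear[OF A0 add A])
      then have "\<bar>\<phi> A\<bar> * shear A0 = \<bar>shear A\<bar> * \<phi> A0"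
        using A0(2) u(2) by (metis abs_mult abs_of_pos)
      ultimately have "\<bar>shear A\<bar> \<le> 2 * Kb * M * shear A0 / \<phi> A0"
        using u(2) by (simp add: pos_le_divide_eq)
      then have "(norm P)\<^sup>2 * (2 + \<bar>shear A\<bar>) \<le> N"
        unfolding N_def by (intro mult_left_mono) auto
      then show ?thesis using norm_le_shear[OF A] by linarith
    qed
    show "\<exists>N. \<forall>A\<in>\<Union>\<Gamma>. \<forall>x y. (\<forall>k\<le>4 * n - 2. \<bar>x k\<bar> \<le> M) \<longrightarrow> (\<forall>k\<le>4 * n - 2. \<bar>y k\<bar> \<le> M) \<longrightarrow>
      y = (\<lambda>i. sym_power (4 * n - 2) A x i + u {A, - A} i) \<longrightarrow> norm A \<le> N"
      by (intro exI[of _ N] ballI allI impI, rule bnd, assumption+)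
  qed
  show ?thesis by (intro exI[of _ K] conjI ballI ne op cone proper)
qed

text \<open>Any action of a finite group is properly discontinuous, so the whole cocycle space
  serves; the zero cocycle shows that it is nonempty.\<close>

lemma exists_cone_finite:
  assumes n: "n \<ge> 1" and sub: "subgroup \<Gamma> PSL2" and fin: "finite (\<Union>\<Gamma>)"
  shows "\<exists>K. K \<noteq> {} \<and> openin (cocycle_space n \<Gamma>) K \<and> cocycle_cone \<Gamma> K \<and>
    (\<forall>u\<in>K. properly_discontinuous \<Gamma> (R_sig n) (affine_action n u))"
proof (intro exI[of _ "cocycles n \<Gamma>"] conjI ballI)
  have "\<Gamma> \<subseteq> Pow (\<Union>\<Gamma>)" by blast
  then have "finite \<Gamma>" using fin by (meson finite_Pow_iff finite_subset)
  then show "properly_discontinuous \<Gamma> (R_sig n) (affine_action n u)" for u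
    by (simp add: properly_discontinuous_def)
  have "\<exists>u. u \<in> cocycles n \<Gamma>"
    by (rule cocycle_of_matrices[OF sub n, of "\<lambda>A j. 0"]) (auto simp: sym_power_def)
  then show "cocycles n \<Gamma> \<noteq> {}" by blast
  show "openin (cocycle_space n \<Gamma>) (cocycles n \<Gamma>)"
    using openin_topspace[of "cocycle_space n \<Gamma>"] by (simp add: topspace_cocycle_space)
  show "cocycle_cone \<Gamma> (cocycles n \<Gamma>)"
    by (simp add: cocycle_cone_def cocycle_scale_in_cocycles[OF _ sub])
qed

theorem theorem1p1:
  fixes n :: nat and \<Gamma> :: "(real^2^2) set set"
  assumes "n \<ge> 1"
    and "subgroup \<Gamma> PSL2"
    and "discrete_in_PSL2 \<Gamma>"
    and "finitely_generated_group (PSL2_restrict \<Gamma>)"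
    and "free_group (PSL2_restrict \<Gamma>)"
    and "\<not> compact_space (quotient_surface \<Gamma>)"
    and "convex_cocompact \<Gamma>"
  shows "\<exists>K. K \<noteq> {} \<and> openin (cocycle_space n \<Gamma>) K \<and> cocycle_cone \<Gamma> K \<and>
    (\<forall>u\<in>K. properly_discontinuous \<Gamma> (R_sig n) (affine_action n u))"
proof (cases "finite (\<Union>\<Gamma>)")
  case True
  then show ?thesis by (rule exists_cone_finite[OF assms(1,2)])
next
  case False
  interpret G: discrete_SL2_group "\<Union>\<Gamma>" by (rule discrete_SL2_group_Union[OF assms(2,3)])
  obtain p where p: "p \<in> lim_dirs (\<Union>\<Gamma>)" using G.lim_dirs_nonempty[OF False] by blast
  show ?thesis
  \<comment> \<open>All limit directions are parallel exactly when there is only one limit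
    point.\<close>
  proof (cases "\<forall>q\<in>lim_dirs (\<Union>\<Gamma>). wedge p q = 0")
    case True
    then show ?thesis by (intro exists_cone_one_limit_point[OF assms(1-3) False p]) blast
  next
    case False
    then obtain q where "q \<in> lim_dirs (\<Union>\<Gamma>)" "wedge p q \<noteq> 0" by blast
    then show ?thesis by (rule exists_cone_two_limit_points[OF assms(1-3,6,7) p])
  qed
qed

end
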